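(* Let $n\ge 1$ and let $\mathfrak{g}$ be a semisimple Lie subalgebra of $\mathfrak{sp}(n)$. Let $\mathfrak{C}_{\mathfrak{g}}=\{x\in\mathfrak{sp}(n) : [x,y]=0 \text{ for all } y\in\mathfrak{g}\}$ be the commutant (centralizer) of $\mathfrak{g}$ in $\mathfrak{sp}(n)$. Then there are finite index sets (ranging over $i$, $p$, $q$ respectively), positive integers $k_i$, $l_p$, $m_q$, and distinct (pairwise inequivalent) irreducible representations $\mathbf{r}^+_i$, $\mathbf{r}^-_p$, $\mathbf{r}^c_q$ of $\mathfrak{g}$, with each $\mathbf{r}^+_i$ real, each $\mathbf{r}^-_p$ pseudoreal and each $\mathbf{r}^c_q$ complex, such that $$\mathfrak{C}_{\mathfrak{g}} \cong \bigoplus_i \mathfrak{sp}(k_i)\oplus\bigoplus_p \mathfrak{so}(l_p)\oplus\bigoplus_q \mathfrak{u}(m_q),$$ and, under the restriction to the subalgebra $\mathfrak{g}\oplus\mathfrak{C}_{\mathfrak{g}}\subset\mathfrak{sp}(n)$, the fundamental representation $\mathbf{2n}$ of $\mathfrak{sp}(n)$ decomposes as $$\mathbf{2n}=\bigoplus_i(\mathbf{r}^+_i,\mathbf{2k}_i)\oplus\bigoplus_p(\mathbf{r}^-_p,\mathbf{l}_p)\oplus\bigoplus_q\left[(\mathbf{r}^c_q,\mathbf{m}_q)\oplus(\overline{\mathbf{r}}{}^c_q,\overline{\mathbf{m}}_q)\right],$$ where $\mathbf{2k}_i$, $\mathbf{l}_p$, $\mathbf{m}_q$ denote the fundamental representations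 of the corresponding summands $\mathfrak{sp}(k_i)$, $\mathfrak{so}(l_p)$, $\mathfrak{u}(m_q)$ of $\mathfrak{C}_{\mathfrak{g}}$ (all other summands of $\mathfrak{C}_{\mathfrak{g}}$ acting trivially on the given term).
   Context: $\mathfrak{sp}(n)$ is the (real) Lie algebra of the compact unitary symplectic group $\mathrm{Sp}(n)=\mathrm{U}(2n)\cap\mathrm{Sp}(2n,\mathbb{C})$ (so $\mathrm{Sp}(1)=\mathrm{SU}(2)$); its fundamental representation $\mathbf{2n}$ is the defining one on $\mathbb{C}^{2n}$. $\mathfrak{so}(l)$ and $\mathfrak{u}(m)$ are the compact Lie algebras of $\mathrm{SO}(l)$ and $\mathrm{U}(m)$ (in particular $\mathfrak{so}(1)=0$ and $\mathfrak{so}(2)\cong\mathfrak{u}(1)$). The fundamental representations of $\mathfrak{sp}(k)$, $\mathfrak{so}(l)$, $\mathfrak{u}(m)$ are their (complexified) defining representations, of complex dimension $2k$, $l$, $m$. All representations are finite-dimensional, complex, and by anti-Hermitian matrices; $\overline{\mathbf{r}}$ is the complex conjugate representation of $\mathbf{r}$. $(\mathbf{r},\mathbf{s})$ denotes the external tensor product representation of a direct sum of two Lie algebras. $\mathbf{1}$ is the trivial one-dimensional representation. An irreducible representation $\mathbf{r}$ is real if $\mathrm{Sym}^2\mathbf{r}\supset\mathbf{1}$, pseudoreal if $\wedge^2\mathbf{r}\supset\mathbf{1}$, and complex if it is neither real nor pseudoreal. Any of the index sets may be empty. *)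

theory Defs
  imports "Jordan_Normal_Form.Schur_Decomposition" "Jordan_Normal_Form.VS_Connect"
begin

definition lie_bracket :: "complex mat \<Rightarrow> complex mat \<Rightarrow> complex mat" where
  "lie_bracket x y = x * y - y * x"

definition real_subspace :: "nat \<Rightarrow> complex mat set \<Rightarrow> bool" where
  "real_subspace d V \<longleftrightarrow>
     V \<subseteq> carrier_mat d d \<and> 0\<^sub>m d d \<in> V \<and>
     (\<forall>x\<in>V. \<forall>y\<in>V. x + y \<in> V) \<and>
     (\<forall>t::real. \<forall>x\<in>V. complex_of_real t \<cdot>\<^sub>m x \<in> V)"

definition real_span :: "nat \<Rightarrow> complex mat set \<Rightarrow> complex mat set" where
  "real_span d S = \<Inter> {V. real_subspace d V \<and> S \<subseteq> V}"

definition lie_algebra :: "nat \<Rightarrow> complex mat set \<Rightarrow> bool" where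
  "lie_algebra d g \<longleftrightarrow> real_subspace d g \<and> (\<forall>x\<in>g. \<forall>y\<in>g. lie_bracket x y \<in> g)"

definition lie_subalgebra :: "nat \<Rightarrow> complex mat set \<Rightarrow> complex mat set \<Rightarrow> bool" where
  "lie_subalgebra d g h \<longleftrightarrow> lie_algebra d g \<and> g \<subseteq> h"

definition lie_ideal :: "nat \<Rightarrow> complex mat set \<Rightarrow> complex mat set \<Rightarrow> bool" where
  "lie_ideal d a g \<longleftrightarrow>
     real_subspace d a \<and> a \<subseteq> g \<and> (\<forall>x\<in>g. \<forall>y\<in>a. lie_bracket x y \<in> a)"

definition derived_algebra :: "nat \<Rightarrow> complex mat set \<Rightarrow> complex mat set" where
  "derived_algebra d h = real_span d {lie_bracket x y | x y. x \<in> h \<and> y \<in> h}"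

definition solvable_lie :: "nat \<Rightarrow> complex mat set \<Rightarrow> bool" where
  "solvable_lie d h \<longleftrightarrow> (\<exists>k. (derived_algebra d ^^ k) h = {0\<^sub>m d d})"

text \<open>Vanishing radical. The zero algebra is semisimple in this convention.\<close>

definition semisimple_lie :: "nat \<Rightarrow> complex mat set \<Rightarrow> bool" where
  "semisimple_lie d g \<longleftrightarrow>
     lie_algebra d g \<and> (\<forall>a. lie_ideal d a g \<and> solvable_lie d a \<longrightarrow> a = {0\<^sub>m d d})"

definition lie_hom ::
  "complex mat set \<Rightarrow> complex mat set \<Rightarrow> (complex mat \<Rightarrow> complex mat) \<Rightarrow> bool" where
  "lie_hom g h f \<longleftrightarrow>
     (\<forall>x\<in>g. f x \<in> h) \<and>
     (\<forall>x\<in>g. \<forall>y\<in>g. f (x + y) = f x + f y) \<and>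
     (\<forall>t::real. \<forall>x\<in>g. f (complex_of_real t \<cdot>\<^sub>m x) = complex_of_real t \<cdot>\<^sub>m f x) \<and>
     (\<forall>x\<in>g. \<forall>y\<in>g. f (lie_bracket x y) = lie_bracket (f x) (f y))"

text \<open>The external direct sum of a list of Lie algebras is \<^const>\<open>listset\<close> with componentwise
  operations. A map into it is given by the list of its components, and it is a homomorphism
  if and only if every component is one.\<close>

definition lie_iso_direct_sum ::
  "complex mat set \<Rightarrow> complex mat set list \<Rightarrow> (complex mat \<Rightarrow> complex mat) list \<Rightarrow> bool" where
  "lie_iso_direct_sum g hs fs \<longleftrightarrow>
     list_all2 (lie_hom g) hs fs \<and>
     bij_betw (\<lambda>x. map (\<lambda>f. f x) fs) g (listset hs)"

definition lie_u :: "nat \<Rightarrow> complex mat set" where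
  "lie_u m = {x \<in> carrier_mat m m. mat_adjoint x = - x}"

definition lie_so :: "nat \<Rightarrow> complex mat set" where
  "lie_so l = {x \<in> carrier_mat l l. elements_mat x \<subseteq> \<real> \<and> transpose_mat x = - x}"

definition symplectic_J :: "nat \<Rightarrow> complex mat" where
  "symplectic_J n = four_block_mat (0\<^sub>m n n) (1\<^sub>m n) (- 1\<^sub>m n) (0\<^sub>m n n)"

definition lie_sp :: "nat \<Rightarrow> complex mat set" where
  "lie_sp n = {x \<in> lie_u (2 * n).
     transpose_mat x * symplectic_J n + symplectic_J n * x = 0\<^sub>m (2 * n) (2 * n)}"

definition commutant_sp :: "nat \<Rightarrow> complex mat set \<Rightarrow> complex mat set" where
  "commutant_sp n g = {x \<in> lie_sp n. \<forall>y\<in>g. lie_bracket x y = 0\<^sub>m (2 * n) (2 * n)}"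

text \<open>A representation is its dimension together with the representing map. The argument type
  is a parameter, so that a direct sum of two Lie algebras can be represented as a set of
  pairs.\<close>

type_synonym 'a rep = "nat \<times> ('a \<Rightarrow> complex mat)"

definition is_rep :: "complex mat set \<Rightarrow> complex mat rep \<Rightarrow> bool" where
  "is_rep g R \<longleftrightarrow> lie_hom g (lie_u (fst R)) (snd R)"

definition rep_equiv :: "'a set \<Rightarrow> 'a rep \<Rightarrow> 'a rep \<Rightarrow> bool" where
  "rep_equiv S R R' \<longleftrightarrow> fst R = fst R' \<and>
     (\<exists>T \<in> carrier_mat (fst R) (fst R). invertible_mat T \<and> (\<forall>x\<in>S. T * snd R x = snd R' x * T))"

definition pairwise_inequivalent :: "'a set \<Rightarrow> 'a rep list \<Rightarrow> bool" where
  "pairwise_inequivalent S Rs \<longleftrightarrow>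
     (\<forall>a<length Rs. \<forall>b<length Rs. a \<noteq> b \<longrightarrow> \<not> rep_equiv S (Rs ! a) (Rs ! b))"

definition conj_rep :: "'a rep \<Rightarrow> 'a rep" where
  "conj_rep R = (fst R, \<lambda>x. map_mat cnj (snd R x))"

definition rep_direct_sum :: "'a rep list \<Rightarrow> 'a rep" where
  "rep_direct_sum Rs = (sum_list (map fst Rs), \<lambda>x. diag_block_mat (map (\<lambda>R. snd R x) Rs))"

definition kronecker :: "complex mat \<Rightarrow> complex mat \<Rightarrow> complex mat" where
  "kronecker A B = mat (dim_row A * dim_row B) (dim_col A * dim_col B)
     (\<lambda>(i, j). A $$ (i div dim_row B, j div dim_col B) * B $$ (i mod dim_row B, j mod dim_col B))"

definition ext_tensor :: "'a rep \<Rightarrow> 'b rep \<Rightarrow> ('a \<times> 'b) rep" where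
  "ext_tensor R R' = (fst R * fst R',
     \<lambda>(x, y). kronecker (snd R x) (1\<^sub>m (fst R')) + kronecker (1\<^sub>m (fst R)) (snd R' y))"

definition tensor_square :: "'a rep \<Rightarrow> 'a rep" where
  "tensor_square R = (fst R * fst R, \<lambda>x. snd (ext_tensor R R) (x, x))"

text \<open>In the ordering of \<^const>\<open>kronecker\<close>, the coordinate of a tensor at \<open>e\<^sub>i \<otimes> e\<^sub>j\<close> is the one
  with index \<open>i * d + j\<close>.\<close>

definition Sym2 :: "nat \<Rightarrow> complex vec set" where
  "Sym2 d = {v \<in> carrier_vec (d * d). \<forall>i<d. \<forall>j<d. v $ (i * d + j) = v $ (j * d + i)}"

definition Wedge2 :: "nat \<Rightarrow> complex vec set" where
  "Wedge2 d = {v \<in> carrier_vec (d * d). \<forall>i<d. \<forall>j<d. v $ (i * d + j) = - v $ (j * d + i)}"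

text \<open>A copy of the trivial one-dimensional representation inside an invariant subspace \<open>W\<close> is
  the line through a nonzero vector of \<open>W\<close> annihilated by the Lie algebra.\<close>

definition contains_trivial :: "'a set \<Rightarrow> 'a rep \<Rightarrow> complex vec set \<Rightarrow> bool" where
  "contains_trivial S R W \<longleftrightarrow>
     (\<exists>v\<in>W. v \<noteq> 0\<^sub>v (fst R) \<and> (\<forall>x\<in>S. snd R x *\<^sub>v v = 0\<^sub>v (fst R)))"

definition irreducible_rep :: "complex mat set \<Rightarrow> complex mat rep \<Rightarrow> bool" where
  "irreducible_rep g R \<longleftrightarrow> is_rep g R \<and> fst R > 0 \<and>
     (\<forall>W. VectorSpace.subspace class_ring W (module_vec TYPE(complex) (fst R)) \<and>
          (\<forall>x\<in>g. \<forall>w\<in>W. snd R x *\<^sub>v w \<in> W) \<longrightarrow>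
          W = {0\<^sub>v (fst R)} \<or> W = carrier_vec (fst R))"

definition real_irrep :: "complex mat set \<Rightarrow> complex mat rep \<Rightarrow> bool" where
  "real_irrep g R \<longleftrightarrow>
     irreducible_rep g R \<and> contains_trivial g (tensor_square R) (Sym2 (fst R))"

definition pseudoreal_irrep :: "complex mat set \<Rightarrow> complex mat rep \<Rightarrow> bool" where
  "pseudoreal_irrep g R \<longleftrightarrow>
     irreducible_rep g R \<and> contains_trivial g (tensor_square R) (Wedge2 (fst R))"

definition complex_irrep :: "complex mat set \<Rightarrow> complex mat rep \<Rightarrow> bool" where
  "complex_irrep g R \<longleftrightarrow>
     irreducible_rep g R \<and> \<not> real_irrep g R \<and> \<not> pseudoreal_irrep g R"

end

theory Submission
  imports Defs "Jordan_Normal_Form.Spectral_Radius"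
begin

text \<open>Being anti-Hermitian, \<open>g\<close> acts completely reducibly on \<open>V = \<complex>\<^sup>2\<^sup>n\<close>, and \<open>g\<close> and its commutant
  both commute with the quaternionic structure on \<open>V\<close>, that is, \<open>J\<close> after complex conjugation.
  For an irreducible representation \<open>r\<close> of dimension \<open>d\<close>, the multiplicity space
  \<open>M = Hom\<^sub>g(r, V)\<close> consists of \<open>2n \<times> d\<close> matrices, and by Schur's lemma \<open>A\<^sup>* B\<close> is a scalar for
  \<open>A, B \<in> M\<close>, which makes \<open>M\<close> a Hermitian space. If \<open>r\<close> is real or pseudoreal, a unitary
  intertwiner from \<open>r\<close> to its conjugate turns the quaternionic structure into an antiunitary map
  of \<open>M\<close> with square \<open>-1\<close> or \<open>+1\<close>, so that \<open>M\<close> has a symplectic or a real orthonormal basis,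
  and the commutant acts on \<open>M\<close> as \<open>sp(k)\<close> or \<open>so(l)\<close>. If \<open>r\<close> is complex, the quaternionic
  structure exchanges the isotypic components of \<open>r\<close> and its conjugate, and the commutant acts
  on \<open>M\<close> as the full \<open>u(m)\<close>. The orthonormal bases of all the isotypic components form the
  columns of the unitary matrix that realises the decomposition.\<close>

text \<open>The obstacle is that multiplicity spaces and isotypic components come with no ready
  dimension count. Every space is therefore presented by a matrix with orthonormal columns:
  containment of a range is an equation \<open>U * (adj U * A) = A\<close>, and all dimension bounds
  come from the trace of \<open>1 - T * adj T\<close>. One orthogonalisation argument serves all
  three coefficient rings, since it asks only for closure under \<open>A * (adj B * X)\<close> and
  for \<open>adj A * A\<close> to be a real scalar. A quaternionic line is made to fit by placing A
  and its image under the antiunitary map side by side.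

  No list of irreducibles of g is given in advance. A largest family of irreducibles occurring in V
  is chosen, no two related by an intertwiner to each other or to a conjugate, so that a complex
  irreducible and its conjugate are represented once. If the components of this family did not fill
  V, their orthogonal complement, being invariant, would contain a further irreducible.

  Semisimplicity enters through the centre: an abelian ideal is solvable, so g meets its commutant
  in 0 and the sum of the two is direct.\<close>

abbreviation cj :: "complex mat \<Rightarrow> complex mat" where
  "cj \<equiv> map_mat cnj"

abbreviation adj :: "complex mat \<Rightarrow> complex mat" where
  "adj \<equiv> mat_adjoint"

subsection \<open>Matrix identities with dimension premises\<close>

lemma dim_adj [simp]: "dim_row (adj A) = dim_col A" "dim_col (adj A) = dim_row A"
  by (auto simp: mat_adjoint_def)

lemma index_adj [simp]:
  "i < dim_col A \<Longrightarrow> j < dim_row A \<Longrightarrow> adj A $$ (i, j) = cnj (A $$ (j, i))"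
  by (auto simp: mat_adjoint_def mat_of_rows_def)

lemma adj_carrier [simp]: "A \<in> carrier_mat n m \<Longrightarrow> adj A \<in> carrier_mat m n"
  by auto

text \<open>The premises are equations between dimensions, so that \<open>simp\<close> can use the
  law as a conditional rewrite rule; membership in \<open>carrier_mat\<close> would leave the
  dimensions to be guessed.\<close>

lemma mat_assoc:
  fixes A B D :: "complex mat"
  shows "dim_col A = dim_row B \<Longrightarrow> dim_col B = dim_row D \<Longrightarrow> A * B * D = A * (B * D)"
  by (rule assoc_mult_mat[of _ "dim_row A" "dim_row B" _ "dim_row D" _ "dim_col D"]) auto

lemma mat_distr:
  fixes A B D :: "complex mat"
  shows "dim_col A = dim_row B \<Longrightarrow> dim_row D = dim_row B \<Longrightarrow> dim_col D = dim_col B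
      \<Longrightarrow> A * (B + D) = A * B + A * D"
    and "dim_col A = dim_row B \<Longrightarrow> dim_row D = dim_row B \<Longrightarrow> dim_col D = dim_col B
      \<Longrightarrow> A * (B - D) = A * B - A * D"
    and "dim_col A = dim_row D \<Longrightarrow> dim_row A = dim_row B \<Longrightarrow> dim_col A = dim_col B
      \<Longrightarrow> (A + B) * D = A * D + B * D"
    and "dim_col A = dim_row D \<Longrightarrow> dim_row A = dim_row B \<Longrightarrow> dim_col A = dim_col B
      \<Longrightarrow> (A - B) * D = A * D - B * D"
  by (auto intro!: eq_matI simp: scalar_prod_def algebra_simps sum.distrib sum_subtractf)

lemma mat_scal:
  fixes A B :: "complex mat"
  shows "dim_col A = dim_row B \<Longrightarrow> A * (z \<cdot>\<^sub>m B) = z \<cdot>\<^sub>m (A * B)"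
    and "dim_col A = dim_row B \<Longrightarrow> (z \<cdot>\<^sub>m A) * B = z \<cdot>\<^sub>m (A * B)"
    and "dim_col A = dim_row B \<Longrightarrow> A * (- B) = - (A * B)"
    and "dim_col A = dim_row B \<Longrightarrow> (- A) * B = - (A * B)"
  by (auto intro!: eq_matI simp: scalar_prod_def algebra_simps sum_distrib_left sum_negf)

lemma mat_one [simp]:
  fixes A :: "complex mat"
  shows "dim_row A = n \<Longrightarrow> 1\<^sub>m n * A = A"
    and "dim_col A = n \<Longrightarrow> A * 1\<^sub>m n = A"
  by (metis carrier_matI left_mult_one_mat) (metis carrier_matI right_mult_one_mat)

lemma mat_zero [simp]:
  fixes A :: "complex mat"
  shows "dim_row A = n \<Longrightarrow> 0\<^sub>m k n * A = 0\<^sub>m k (dim_col A)"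
    and "dim_col A = n \<Longrightarrow> A * 0\<^sub>m n k = 0\<^sub>m (dim_row A) k"
  by (metis carrier_matI left_mult_zero_mat) (metis carrier_matI right_mult_zero_mat)

lemma mat_add_zero [simp]:
  fixes A :: "complex mat"
  shows "dim_row A = n \<Longrightarrow> dim_col A = k \<Longrightarrow> 0\<^sub>m n k + A = A"
    and "dim_row A = n \<Longrightarrow> dim_col A = k \<Longrightarrow> A + 0\<^sub>m n k = A"
    and "dim_row A = n \<Longrightarrow> dim_col A = k \<Longrightarrow> A - 0\<^sub>m n k = A"
    and "dim_row A = n \<Longrightarrow> dim_col A = k \<Longrightarrow> A - A = 0\<^sub>m n k"
  by (auto intro!: eq_matI)

lemma adj_mult [simp]: "dim_col A = dim_row B \<Longrightarrow> adj (A * B) = adj B * adj A"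
  by (auto intro!: eq_matI simp: scalar_prod_def mult.commute)

lemma adj_adj [simp]: "adj (adj A) = A"
  by (auto intro!: eq_matI)

lemma adj_add [simp]:
  "dim_row A = dim_row B \<Longrightarrow> dim_col A = dim_col B \<Longrightarrow> adj (A + B) = adj A + adj B"
  "dim_row A = dim_row B \<Longrightarrow> dim_col A = dim_col B \<Longrightarrow> adj (A - B) = adj A - adj B"
  by (auto intro!: eq_matI)

lemma adj_scal [simp]: "adj (z \<cdot>\<^sub>m A) = cnj z \<cdot>\<^sub>m adj A" "adj (- A) = - adj A"
  by (auto intro!: eq_matI)

lemma adj_one [simp]: "adj (1\<^sub>m n) = 1\<^sub>m n" "adj (0\<^sub>m n k) = 0\<^sub>m k n"
  by (auto intro!: eq_matI)

lemma cj_mult [simp]: "dim_col A = dim_row B \<Longrightarrow> cj (A * B) = cj A * cj B"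
  by (auto intro!: eq_matI simp: scalar_prod_def)

lemma cj_cj [simp]: "cj (cj A) = A"
  by (auto intro!: eq_matI)

lemma cj_add [simp]:
  "dim_row A = dim_row B \<Longrightarrow> dim_col A = dim_col B \<Longrightarrow> cj (A + B) = cj A + cj B"
  "dim_row A = dim_row B \<Longrightarrow> dim_col A = dim_col B \<Longrightarrow> cj (A - B) = cj A - cj B"
  by (auto intro!: eq_matI)

lemma cj_scal [simp]: "cj (z \<cdot>\<^sub>m A) = cnj z \<cdot>\<^sub>m cj A" "cj (- A) = - cj A"
  by (auto intro!: eq_matI)

lemma cj_one [simp]: "cj (1\<^sub>m n) = 1\<^sub>m n" "cj (0\<^sub>m n k) = 0\<^sub>m n k"
  by (auto intro!: eq_matI)

lemma adj_cj: "adj (cj A) = cj (adj A)"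
  by (auto intro!: eq_matI)

lemma transpose_eq_cj_adj: "transpose_mat A = cj (adj A)"
  by (auto intro!: eq_matI)

lemma smult_smult [simp]: "a \<cdot>\<^sub>m (b \<cdot>\<^sub>m A) = (a * b :: complex) \<cdot>\<^sub>m A"
  by (auto intro!: eq_matI)

lemma smult_one_left [simp]: "(1 :: complex) \<cdot>\<^sub>m A = A"
  by (auto intro!: eq_matI)

lemma smult_zero_left [simp]: "(0 :: complex) \<cdot>\<^sub>m A = 0\<^sub>m (dim_row A) (dim_col A)"
  by (auto intro!: eq_matI)

lemma smult_minus_one: "(- 1 :: complex) \<cdot>\<^sub>m A = - A"
  by (auto intro!: eq_matI)

lemma smult_zero_right [simp]: "(z :: complex) \<cdot>\<^sub>m 0\<^sub>m n k = 0\<^sub>m n k"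
  by (auto intro!: eq_matI)

text \<open>The form in which \<open>A * B = 1\<close> applies inside the right-nested products that
  \<open>mat_assoc\<close> produces.\<close>

lemma cancel_left:
  fixes A B X :: "complex mat"
  assumes "A * B = 1\<^sub>m n" "dim_row X = n" "dim_col A = dim_row B"
  shows "A * (B * X) = X"
proof -
  have "dim_col B = n"
    using arg_cong[OF assms(1), of dim_col] by simp
  then show ?thesis
    using assms by (simp flip: mat_assoc)
qed

lemma eq_smult_iff:
  assumes "z \<noteq> (0::complex)"
  shows "z \<cdot>\<^sub>m A = z \<cdot>\<^sub>m B \<longleftrightarrow> A = B"
proof
  assume "z \<cdot>\<^sub>m A = z \<cdot>\<^sub>m B"
  then have "inverse z \<cdot>\<^sub>m (z \<cdot>\<^sub>m A) = inverse z \<cdot>\<^sub>m (z \<cdot>\<^sub>m B)"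
    by simp
  then show "A = B"
    using assms by simp
qed simp

lemma smult_eq_zero_iff:
  assumes "z \<noteq> (0::complex)"
  shows "z \<cdot>\<^sub>m A = 0\<^sub>m n k \<longleftrightarrow> A = 0\<^sub>m n k"
  using eq_smult_iff[OF assms, of A "0\<^sub>m n k"] by simp

lemma smult_one_eqD:
  assumes "a \<cdot>\<^sub>m 1\<^sub>m d = b \<cdot>\<^sub>m 1\<^sub>m d" "d > 0"
  shows "a = (b :: complex)"
proof -
  have "(a \<cdot>\<^sub>m 1\<^sub>m d) $$ (0, 0) = (b \<cdot>\<^sub>m 1\<^sub>m d) $$ (0, 0)"
    using assms by simp
  then show ?thesis
    using assms(2) by simp
qed

lemma mat_diff_eq_0_iff:
  fixes A B :: "complex mat"
  assumes "dim_row A = n" "dim_col A = k" "dim_row B = n" "dim_col B = k"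
  shows "A - B = 0\<^sub>m n k \<longleftrightarrow> A = B"
proof
  assume *: "A - B = 0\<^sub>m n k"
  show "A = B"
  proof (rule eq_matI)
    fix i j assume "i < dim_row B" "j < dim_col B"
    then show "A $$ (i, j) = B $$ (i, j)"
      using arg_cong[OF *, of "\<lambda>X. X $$ (i, j)"] assms by simp
  qed (use assms in auto)
qed (use assms in auto)

lemma one_neq_zero_mat:
  assumes "d > 0"
  shows "1\<^sub>m d \<noteq> (0\<^sub>m d d :: complex mat)"
proof
  assume "1\<^sub>m d = (0\<^sub>m d d :: complex mat)"
  then have "(1\<^sub>m d :: complex mat) $$ (0, 0) = 0\<^sub>m d d $$ (0, 0)"
    by simp
  then show False
    using assms by simp
qed

lemma mult_vec_assoc:
  fixes A B :: "complex mat"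
  shows "dim_col A = dim_row B \<Longrightarrow> dim_col B = dim_vec v \<Longrightarrow> A * B *\<^sub>v v = A *\<^sub>v (B *\<^sub>v v)"
  by (rule assoc_mult_mat_vec[of _ "dim_row A" "dim_row B" _ "dim_vec v"]) (auto intro: carrier_vecI)

lemma mat_eq_iff_mult_vec:
  fixes A B :: "complex mat"
  assumes "A \<in> carrier_mat n m" "B \<in> carrier_mat n m"
    and "\<And>v. v \<in> carrier_vec m \<Longrightarrow> A *\<^sub>v v = B *\<^sub>v v"
  shows "A = B"
proof (rule eq_matI)
  fix i j assume ij: "i < dim_row B" "j < dim_col B"
  have "A *\<^sub>v unit_vec m j = B *\<^sub>v unit_vec m j"
    by (rule assms(3)) simp
  then have "(A *\<^sub>v unit_vec m j) $ i = (B *\<^sub>v unit_vec m j) $ i"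
    by simp
  then show "A $$ (i, j) = B $$ (i, j)"
    using assms(1,2) ij by (auto simp: row_def)
qed (use assms in auto)

subsection \<open>The Frobenius norm\<close>

text \<open>The square of the Frobenius norm: without the root it is the trace of
  \<open>adj A * A\<close>.\<close>

definition frob :: "complex mat \<Rightarrow> real" where
  "frob A = (\<Sum>j<dim_col A. \<Sum>i<dim_row A. (cmod (A $$ (i, j)))\<^sup>2)"

lemma frob_nonneg: "frob A \<ge> 0"
  unfolding frob_def by (intro sum_nonneg) simp

lemma frob_eq_0_imp:
  assumes "frob A = 0"
  shows "A = 0\<^sub>m (dim_row A) (dim_col A)"
proof (rule eq_matI)
  fix i j assume "i < dim_row (0\<^sub>m (dim_row A) (dim_col A) :: complex mat)"
    "j < dim_col (0\<^sub>m (dim_row A) (dim_col A) :: complex mat)"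
  then have ij: "i < dim_row A" "j < dim_col A"
    by auto
  have "(\<Sum>i<dim_row A. (cmod (A $$ (i, j)))\<^sup>2) = 0"
    using assms ij unfolding frob_def by (subst (asm) sum_nonneg_eq_0_iff) (auto intro!: sum_nonneg)
  then have "(cmod (A $$ (i, j)))\<^sup>2 = 0"
    using ij by (subst (asm) sum_nonneg_eq_0_iff) auto
  then show "A $$ (i, j) = 0\<^sub>m (dim_row A) (dim_col A) $$ (i, j)"
    using ij by simp
qed auto

lemma adj_mult_diag:
  assumes "j < dim_col A"
  shows "(adj A * A) $$ (j, j) = complex_of_real (\<Sum>i<dim_row A. (cmod (A $$ (i, j)))\<^sup>2)"
  using assms by (simp add: scalar_prod_def atLeast0LessThan complex_norm_square mult.commute del: of_real_power)

lemma frob_trace: "complex_of_real (frob A) = (\<Sum>j<dim_col A. (adj A * A) $$ (j, j))"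
  unfolding frob_def by (simp add: adj_mult_diag del: index_mult_mat)

lemma adj_mult_eq_0_imp:
  assumes "adj A * A = 0\<^sub>m n n"
  shows "A = 0\<^sub>m (dim_row A) (dim_col A)"
proof -
  have "dim_col A = n"
    using arg_cong[OF assms, of dim_row] by simp
  then have "complex_of_real (frob A) = 0"
    using assms by (simp add: frob_trace)
  then show ?thesis
    by (simp add: frob_eq_0_imp)
qed

text \<open>A diagonal entry of \<open>adj A * A\<close> is the squared norm of a column;
  \<open>d > 0\<close> provides the first column, from which z is read off.\<close>

lemma scalar_gram_nonneg:
  assumes "adj A * A = z \<cdot>\<^sub>m 1\<^sub>m d" "d > 0"
  shows "\<exists>t. z = complex_of_real t \<and> t \<ge> 0 \<and> (A \<noteq> 0\<^sub>m (dim_row A) d \<longrightarrow> t > 0)"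
proof -
  have dc: "dim_col A = d"
    using arg_cong[OF assms(1), of dim_row] by simp
  let ?t = "\<Sum>i<dim_row A. (cmod (A $$ (i, 0)))\<^sup>2"
  have z: "z = complex_of_real ?t"
    using adj_mult_diag[of 0 A] assms dc by simp
  moreover have "?t \<noteq> 0" if "A \<noteq> 0\<^sub>m (dim_row A) d"
  proof
    assume "?t = 0"
    then have "adj A * A = 0\<^sub>m d d"
      using assms(1) z by simp
    then show False
      using adj_mult_eq_0_imp[of A d] that dc by simp
  qed
  moreover have "?t \<ge> 0"
    by (simp add: sum_nonneg)
  ultimately show ?thesis
    by (metis less_eq_real_def)
qed

text \<open>The factor u is real, so normalisation does not leave a space that is closed under real
  scalars only.\<close>

lemma normalise_scalar_gram:
  assumes "adj A * A = z \<cdot>\<^sub>m 1\<^sub>m d" "d > 0" "A \<noteq> 0\<^sub>m (dim_row A) d"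
  shows "\<exists>u. adj (complex_of_real u \<cdot>\<^sub>m A) * (complex_of_real u \<cdot>\<^sub>m A) = 1\<^sub>m d"
proof -
  obtain t where t: "z = complex_of_real t" "t > 0"
    using scalar_gram_nonneg[OF assms(1,2)] assms(3) by blast
  define u where "u = 1 / sqrt t"
  have u: "u * (u * t) = 1"
    using t by (simp add: u_def field_simps)
  have "adj (complex_of_real u \<cdot>\<^sub>m A) * (complex_of_real u \<cdot>\<^sub>m A) = complex_of_real (u * (u * t)) \<cdot>\<^sub>m 1\<^sub>m d"
    by (simp add: mat_scal assms(1) t)
  then show ?thesis
    by (intro exI[of _ u]) (simp add: u)
qed

text \<open>Counting dimensions by traces: the projection \<open>1 - T T\<^sup>*\<close> has trace \<open>N - D\<close>.\<close>

lemma isometry_frob: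
  assumes T: "T \<in> carrier_mat N D" and iso: "adj T * T = 1\<^sub>m D"
  shows "frob (1\<^sub>m N - T * adj T) = real N - real D"
proof -
  note [simp] = carrier_matD[OF T]
  \<comment> \<open>\<open>1 - T * adj T\<close> is Hermitian and idempotent, so its squared norm
    equals its trace.\<close>
  have "complex_of_real (frob (1\<^sub>m N - T * adj T)) = (\<Sum>j<N. (1\<^sub>m N - T * adj T) $$ (j, j))"
    by (simp add: frob_trace mat_distr mat_assoc cancel_left[OF iso] del: index_mult_mat(1))
  also have "\<dots> = of_nat N - (\<Sum>j<N. (T * adj T) $$ (j, j))"
    by (simp add: sum_subtractf del: index_mult_mat(1))
  also have "(\<Sum>j<N. (T * adj T) $$ (j, j)) = (\<Sum>j<N. \<Sum>i<D. T $$ (j, i) * cnj (T $$ (j, i)))"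
    by (auto simp: scalar_prod_def atLeast0LessThan)
  also have "\<dots> = (\<Sum>i<D. (adj T * T) $$ (i, i))"
    by (subst sum.swap) (auto simp: scalar_prod_def atLeast0LessThan mult.commute)
  also have "\<dots> = of_nat D"
    by (simp add: iso)
  finally have "complex_of_real (frob (1\<^sub>m N - T * adj T)) = complex_of_real (real N - real D)"
    by simp
  then show ?thesis
    by (simp only: of_real_eq_iff)
qed

text \<open>A squared norm is nonnegative. The bounds on multiplicities and on the number of
  irreducibles all rest on this inequality.\<close>

lemma isometry_le:
  assumes "T \<in> carrier_mat N D" "adj T * T = 1\<^sub>m D"
  shows "D \<le> N"
  using frob_nonneg[of "1\<^sub>m N - T * adj T"] isometry_frob[OF assms] by simp

text \<open>For D = N the squared norm computed in \<open>isometry_frob\<close> vanishes.\<close>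

lemma isometry_square:
  assumes T: "T \<in> carrier_mat N N" and iso: "adj T * T = 1\<^sub>m N"
  shows "T * adj T = 1\<^sub>m N"
proof -
  have "1\<^sub>m N - T * adj T = 0\<^sub>m N N"
    using frob_eq_0_imp[of "1\<^sub>m N - T * adj T"] isometry_frob[OF assms] T by simp
  then show ?thesis
    using T mat_diff_eq_0_iff[of "1\<^sub>m N" N N "T * adj T"] by simp
qed

subsection \<open>Sums of matrices\<close>

text \<open>Matrices of all sizes share one type and hence have no common zero; the sum carries its
  dimensions so that the empty sum is the right zero matrix.\<close>

definition msum :: "nat \<Rightarrow> nat \<Rightarrow> (nat \<Rightarrow> complex mat) \<Rightarrow> nat \<Rightarrow> complex mat" where
  "msum r c f m = mat r c (\<lambda>(i, j). \<Sum>b<m. f b $$ (i, j))"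

lemma dim_msum [simp]: "dim_row (msum r c f m) = r" "dim_col (msum r c f m) = c"
  by (auto simp: msum_def)

lemma msum_0 [simp]: "msum r c f 0 = 0\<^sub>m r c"
  by (auto simp: msum_def)

lemma msum_Suc:
  "f m \<in> carrier_mat r c \<Longrightarrow> msum r c f (Suc m) = msum r c f m + f m"
  by (auto simp: msum_def intro!: eq_matI)

lemma msum_cong: "(\<And>b. b < m \<Longrightarrow> f b = g b) \<Longrightarrow> msum r c f m = msum r c g m"
  by (auto simp: msum_def intro!: eq_matI sum.cong)

lemma mult_msum:
  assumes "\<And>b. b < m \<Longrightarrow> f b \<in> carrier_mat r c" "dim_col Y = r"
  shows "Y * msum r c f m = msum (dim_row Y) c (\<lambda>b. Y * f b) m"
  using assms
proof (induction m)
  case (Suc m)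
  then have "f m \<in> carrier_mat r c" "Y * f m \<in> carrier_mat (dim_row Y) c"
    by (auto simp: carrier_matD[OF Suc.prems(1), of m])
  moreover from this(1) have "dim_row (f m) = r" "dim_col (f m) = c"
    by auto
  ultimately show ?case
    using Suc by (simp add: msum_Suc mat_distr)
qed simp

lemma msum_mult:
  assumes "\<And>b. b < m \<Longrightarrow> f b \<in> carrier_mat r c" "dim_row Y = c"
  shows "msum r c f m * Y = msum r (dim_col Y) (\<lambda>b. f b * Y) m"
  using assms
proof (induction m)
  case (Suc m)
  then have "f m \<in> carrier_mat r c" "f m * Y \<in> carrier_mat r (dim_col Y)"
    by (auto simp: carrier_matD[OF Suc.prems(1), of m])
  moreover from this(1) have "dim_row (f m) = r" "dim_col (f m) = c"
    by auto
  ultimately show ?case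
    using Suc by (simp add: msum_Suc mat_distr)
qed simp

lemma msum_closed:
  assumes "0\<^sub>m r c \<in> M" "\<And>A B. A \<in> M \<Longrightarrow> B \<in> M \<Longrightarrow> A + B \<in> M" "M \<subseteq> carrier_mat r c"
    and "\<And>b. b < m \<Longrightarrow> f b \<in> M"
  shows "msum r c f m \<in> M"
  using assms(4)
proof (induction m)
  case 0
  then show ?case
    using assms(1) by simp
next
  case (Suc m)
  then have "f m \<in> carrier_mat r c"
    using assms(3) by auto
  then show ?case
    using Suc assms(2) by (simp add: msum_Suc)
qed

lemma msum_single:
  assumes "a < m" "f a \<in> carrier_mat r c" "\<And>b. b < m \<Longrightarrow> b \<noteq> a \<Longrightarrow> f b = 0\<^sub>m r c"
  shows "msum r c f m = f a"
proof (rule eq_matI)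
  fix i j assume "i < dim_row (f a)" "j < dim_col (f a)"
  then have ij: "i < r" "j < c"
    using assms by auto
  have "(\<Sum>b<m. f b $$ (i, j)) = (\<Sum>b<m. if b = a then f a $$ (i, j) else 0)"
    using assms(3) ij by (intro sum.cong) auto
  also have "\<dots> = f a $$ (i, j)"
    using assms(1) by simp
  finally show "msum r c f m $$ (i, j) = f a $$ (i, j)"
    using ij by (simp add: msum_def)
qed (use assms in auto)

subsection \<open>Kronecker products and column families\<close>

lemma div_mod_less:
  assumes "c < d * (m::nat)"
  shows "c div m < d" "c mod m < m"
proof -
  have "m > 0"
    using assms by (cases m) auto
  then show "c div m < d" "c mod m < m"
    using assms by (auto simp: less_mult_imp_div_less)
qed

lemma mult_add_less: "a < d \<Longrightarrow> b < m \<Longrightarrow> a * m + b < d * (m::nat)"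
proof -
  assume "a < d" "b < m"
  then have "a * m + b < Suc a * m" "Suc a * m \<le> d * m"
    by (simp, intro mult_le_mono1, simp)
  then show ?thesis
    by linarith
qed

lemma sum_div_mod: "(\<Sum>c<d * m. f (c div m) (c mod m)) = (\<Sum>a<d. \<Sum>b<(m::nat). f a b)"
  unfolding sum.cartesian_product
  by (rule sum.reindex_bij_witness[of _ "\<lambda>(a, b). a * m + b" "\<lambda>c. (c div m, c mod m)"])
     (auto simp: div_mod_less mult_add_less)

lemma eq_div_mod: "(c = c') \<longleftrightarrow> (c div m = c' div m \<and> c mod m = c' mod (m::nat))"
  by (metis div_mult_mod_eq)

lemma dim_kronecker [simp]:
  "dim_row (kronecker A B) = dim_row A * dim_row B" "dim_col (kronecker A B) = dim_col A * dim_col B"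
  by (auto simp: kronecker_def)

lemma index_kronecker [simp]:
  "i < dim_row A * dim_row B \<Longrightarrow> j < dim_col A * dim_col B \<Longrightarrow> kronecker A B $$ (i, j) =
    A $$ (i div dim_row B, j div dim_col B) * B $$ (i mod dim_row B, j mod dim_col B)"
  by (auto simp: kronecker_def)

lemma kronecker_mult:
  assumes "dim_col A = dim_row A'" "dim_col B = dim_row B'"
  shows "kronecker A B * kronecker A' B' = kronecker (A * A') (B * B')"
proof (rule eq_matI)
  fix i j assume "i < dim_row (kronecker (A * A') (B * B'))" "j < dim_col (kronecker (A * A') (B * B'))"
  then have i: "i < dim_row A * dim_row B" and j: "j < dim_col A' * dim_col B'"
    by auto
  note ii = div_mod_less[OF i] and jj = div_mod_less[OF j]
  have "(kronecker A B * kronecker A' B') $$ (i, j) =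
    (\<Sum>c<dim_row A' * dim_row B'. (\<lambda>a b. A $$ (i div dim_row B, a) * B $$ (i mod dim_row B, b)
      * (A' $$ (a, j div dim_col B') * B' $$ (b, j mod dim_col B'))) (c div dim_row B') (c mod dim_row B'))"
    using i j assms by (auto simp: scalar_prod_def atLeast0LessThan intro!: sum.cong)
  also have "\<dots> = (\<Sum>a<dim_row A'. \<Sum>b<dim_row B'. A $$ (i div dim_row B, a) * B $$ (i mod dim_row B, b)
      * (A' $$ (a, j div dim_col B') * B' $$ (b, j mod dim_col B')))"
    by (rule sum_div_mod)
  also have "\<dots> = kronecker (A * A') (B * B') $$ (i, j)"
    using i j ii jj assms by (simp add: scalar_prod_def atLeast0LessThan sum_product algebra_simps)
  finally show "(kronecker A B * kronecker A' B') $$ (i, j) = kronecker (A * A') (B * B') $$ (i, j)" .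
qed auto

lemma cj_kronecker [simp]: "cj (kronecker A B) = kronecker (cj A) (cj B)"
  by (rule eq_matI) (auto simp: div_mod_less)

lemma adj_kronecker [simp]: "adj (kronecker A B) = kronecker (adj A) (adj B)"
  by (rule eq_matI) (auto simp: div_mod_less)

lemma kronecker_one [simp]: "kronecker (1\<^sub>m d) (1\<^sub>m m) = 1\<^sub>m (d * m)"
proof (rule eq_matI)
  fix i j assume "i < dim_row (1\<^sub>m (d * m) :: complex mat)" "j < dim_col (1\<^sub>m (d * m) :: complex mat)"
  then show "kronecker (1\<^sub>m d) (1\<^sub>m m) $$ (i, j) = 1\<^sub>m (d * m) $$ (i, j)"
    using div_mod_less[of i d m] div_mod_less[of j d m] eq_div_mod[of i j m] by auto
qed auto

text \<open>For \<open>d > 0\<close> the top left block of the Kronecker product is X itself, so X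
  can be recovered from it.\<close>

lemma kronecker_one_index:
  assumes "d > 0" "a < dim_row X" "b < dim_col X"
  shows "kronecker (1\<^sub>m d) X $$ (a, b) = X $$ (a, b)"
proof -
  have "a < d * dim_row X" "b < d * dim_col X"
    using assms by (auto simp: less_le_trans)
  then show ?thesis
    using assms by simp
qed

lemma kronecker_one_inj:
  assumes "kronecker (1\<^sub>m d) X = kronecker (1\<^sub>m d) Y" "d > 0"
  shows "X = Y"
proof -
  have d: "dim_row X = dim_row Y" "dim_col X = dim_col Y"
    using arg_cong[OF assms(1), of dim_row] arg_cong[OF assms(1), of dim_col] assms(2) by auto
  show ?thesis
  proof (rule eq_matI)
    fix i j assume "i < dim_row Y" "j < dim_col Y"
    then show "X $$ (i, j) = Y $$ (i, j)"
      using assms d kronecker_one_index[of d i X j] kronecker_one_index[of d i Y j] by simp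
  qed (use d in auto)
qed

lemma kronecker_one_add:
  "dim_row X = dim_row Y \<Longrightarrow> dim_col X = dim_col Y \<Longrightarrow>
    kronecker (1\<^sub>m d) (X + Y) = kronecker (1\<^sub>m d) X + kronecker (1\<^sub>m d) Y"
  by (rule eq_matI) (auto simp: div_mod_less algebra_simps)

lemma kronecker_one_smult: "kronecker (1\<^sub>m d) (z \<cdot>\<^sub>m X) = z \<cdot>\<^sub>m kronecker (1\<^sub>m d) X"
  by (rule eq_matI) (auto simp: div_mod_less algebra_simps)

text \<open>\<open>cols_of N d m A\<close> lists the columns of the \<open>N \<times> d\<close> matrices \<open>A 0, \<dots>, A (m - 1)\<close> in the
  order of \<^const>\<open>kronecker\<close>: column \<open>a * m + b\<close> is column \<open>a\<close> of \<open>A b\<close>.\<close>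

definition cols_of :: "nat \<Rightarrow> nat \<Rightarrow> nat \<Rightarrow> (nat \<Rightarrow> complex mat) \<Rightarrow> complex mat" where
  "cols_of N d m A = mat N (d * m) (\<lambda>(i, c). A (c mod m) $$ (i, c div m))"

lemma dim_cols_of [simp]: "dim_row (cols_of N d m A) = N" "dim_col (cols_of N d m A) = d * m"
  by (auto simp: cols_of_def)

lemma cols_of_carrier [simp]: "cols_of N d m A \<in> carrier_mat N (d * m)"
  by auto

lemma index_cols_of:
  "i < N \<Longrightarrow> c < d * m \<Longrightarrow> cols_of N d m A $$ (i, c) = A (c mod m) $$ (i, c div m)"
  by (auto simp: cols_of_def)

lemma cols_of_cong: "(\<And>b. b < m \<Longrightarrow> A b = B b) \<Longrightarrow> cols_of N d m A = cols_of N d m B"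
  by (rule eq_matI) (auto simp: index_cols_of dest: div_mod_less)

lemma cj_cols_of: 
  "(\<And>b. b < m \<Longrightarrow> A b \<in> carrier_mat N d) \<Longrightarrow> cj (cols_of N d m A) = cols_of N d m (\<lambda>b. cj (A b))"
proof (rule eq_matI)
  fix i c assume *: "\<And>b. b < m \<Longrightarrow> A b \<in> carrier_mat N d"
    and "i < dim_row (cols_of N d m (\<lambda>b. cj (A b)))" "c < dim_col (cols_of N d m (\<lambda>b. cj (A b)))"
  then have ic: "i < N" "c < d * m"
    by auto
  have "A (c mod m) \<in> carrier_mat N d"
    using * ic div_mod_less by blast
  then show "cj (cols_of N d m A) $$ (i, c) = cols_of N d m (\<lambda>b. cj (A b)) $$ (i, c)"
    using ic by (auto simp: index_cols_of div_mod_less)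
qed auto

lemma mult_cols_of:
  assumes "\<And>b. b < m \<Longrightarrow> A b \<in> carrier_mat N d" "dim_col Y = N"
  shows "Y * cols_of N d m A = cols_of (dim_row Y) d m (\<lambda>b. Y * A b)"
proof (rule eq_matI)
  fix i c assume "i < dim_row (cols_of (dim_row Y) d m (\<lambda>b. Y * A b))"
    "c < dim_col (cols_of (dim_row Y) d m (\<lambda>b. Y * A b))"
  then have ic: "i < dim_row Y" "c < d * m"
    by auto
  have "A (c mod m) \<in> carrier_mat N d"
    using assms(1) ic div_mod_less by blast
  then show "(Y * cols_of N d m A) $$ (i, c) = cols_of (dim_row Y) d m (\<lambda>b. Y * A b) $$ (i, c)"
    using ic assms(2) by (auto simp: index_cols_of div_mod_less scalar_prod_def)
qed auto

text \<open>The left tensor factor is the representation space: it acts inside each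
  \<open>A b\<close> separately, as the algebra g will.\<close>

lemma cols_of_mult_kronecker_left:
  assumes A: "\<And>b. b < m \<Longrightarrow> A b \<in> carrier_mat N d" and X: "X \<in> carrier_mat d d'"
  shows "cols_of N d m A * kronecker X (1\<^sub>m m) = cols_of N d' m (\<lambda>b. A b * X)"
proof (rule eq_matI)
  fix i c assume "i < dim_row (cols_of N d' m (\<lambda>b. A b * X))" "c < dim_col (cols_of N d' m (\<lambda>b. A b * X))"
  then have ic: "i < N" "c < d' * m"
    by auto
  have c: "A (c mod m) \<in> carrier_mat N d"
    using A ic div_mod_less by blast
  have "(cols_of N d m A * kronecker X (1\<^sub>m m)) $$ (i, c) =
    (\<Sum>k<d * m. (\<lambda>a b. A b $$ (i, a) * (X $$ (a, c div m) * 1\<^sub>m m $$ (b, c mod m))) (k div m) (k mod m))"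
    using ic X by (auto simp: scalar_prod_def atLeast0LessThan index_cols_of div_mod_less intro!: sum.cong)
  also have "\<dots> = (\<Sum>a<d. \<Sum>b<m. A b $$ (i, a) * (X $$ (a, c div m) * 1\<^sub>m m $$ (b, c mod m)))"
    by (rule sum_div_mod)
  also have "\<dots> = (\<Sum>a<d. \<Sum>b<m. if b = c mod m then A b $$ (i, a) * X $$ (a, c div m) else 0)"
    using div_mod_less[OF ic(2)] by (intro sum.cong) auto
  also have "\<dots> = (\<Sum>a<d. A (c mod m) $$ (i, a) * X $$ (a, c div m))"
    using div_mod_less[OF ic(2)] by simp
  also have "\<dots> = cols_of N d' m (\<lambda>b. A b * X) $$ (i, c)"
    using ic c X by (auto simp: index_cols_of div_mod_less scalar_prod_def atLeast0LessThan)
  finally show "(cols_of N d m A * kronecker X (1\<^sub>m m)) $$ (i, c) = cols_of N d' m (\<lambda>b. A b * X) $$ (i, c)" .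
qed (use X in auto)

text \<open>The right tensor factor is the multiplicity space: it mixes the \<open>A b\<close>,
  column b of G holding the coefficients of the new matrix number b.\<close>

lemma cols_of_mult_kronecker_right:
  assumes A: "\<And>b. b < m \<Longrightarrow> A b \<in> carrier_mat N d" and G: "G \<in> carrier_mat m m'"
  shows "cols_of N d m A * kronecker (1\<^sub>m d) G
    = cols_of N d m' (\<lambda>b. msum N d (\<lambda>b'. G $$ (b', b) \<cdot>\<^sub>m A b') m)" (is "_ = ?R")
proof (rule eq_matI)
  fix i c assume "i < dim_row ?R" "c < dim_col ?R"
  then have ic: "i < N" "c < d * m'"
    by auto
  note cc = div_mod_less[OF ic(2)]
  have "(cols_of N d m A * kronecker (1\<^sub>m d) G) $$ (i, c) =
    (\<Sum>k<d * m. (\<lambda>a b. A b $$ (i, a) * (1\<^sub>m d $$ (a, c div m') * G $$ (b, c mod m'))) (k div m) (k mod m))"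
    using ic G by (auto simp: scalar_prod_def atLeast0LessThan index_cols_of div_mod_less intro!: sum.cong)
  also have "\<dots> = (\<Sum>a<d. \<Sum>b<m. A b $$ (i, a) * (1\<^sub>m d $$ (a, c div m') * G $$ (b, c mod m')))"
    by (rule sum_div_mod)
  also have "\<dots> = (\<Sum>b<m. \<Sum>a<d. if a = c div m' then A b $$ (i, a) * G $$ (b, c mod m') else 0)"
    using cc by (subst sum.swap, intro sum.cong) auto
  also have "\<dots> = (\<Sum>b<m. A b $$ (i, c div m') * G $$ (b, c mod m'))"
    using cc by simp
  also have "\<dots> = (\<Sum>b<m. (G $$ (b, c mod m') \<cdot>\<^sub>m A b) $$ (i, c div m'))"
    using ic cc carrier_matD[OF A] by (intro sum.cong) auto
  also have "\<dots> = ?R $$ (i, c)"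
    using ic cc by (simp add: index_cols_of msum_def)
  finally show "(cols_of N d m A * kronecker (1\<^sub>m d) G) $$ (i, c) = ?R $$ (i, c)" .
qed (use G in auto)

lemma adj_cols_of_index:
  assumes A: "\<And>b. b < m \<Longrightarrow> A b \<in> carrier_mat N d" and B: "B \<in> carrier_mat N e"
    and c: "c < d * m" and j: "j < e"
  shows "(adj (cols_of N d m A) * B) $$ (c, j) = (adj (A (c mod m)) * B) $$ (c div m, j)"
proof -
  have "A (c mod m) \<in> carrier_mat N d"
    using A c div_mod_less by blast
  then show ?thesis
    using B c j by (auto simp: scalar_prod_def index_cols_of div_mod_less)
qed

lemma adj_cols_of_eq_0:
  assumes A: "\<And>b. b < m \<Longrightarrow> A b \<in> carrier_mat N d" and B: "B \<in> carrier_mat N e"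
    and "\<And>b. b < m \<Longrightarrow> adj (A b) * B = 0\<^sub>m d e"
  shows "adj (cols_of N d m A) * B = 0\<^sub>m (d * m) e"
proof (rule eq_matI)
  fix c j assume "c < dim_row (0\<^sub>m (d * m) e :: complex mat)" "j < dim_col (0\<^sub>m (d * m) e :: complex mat)"
  then show "(adj (cols_of N d m A) * B) $$ (c, j) = 0\<^sub>m (d * m) e $$ (c, j)"
    using adj_cols_of_index[OF A B] assms(3) div_mod_less by simp
qed (use B in auto)

text \<open>For an orthonormal family \<open>A = B\<close> this is the projection onto the sum of
  the ranges of the \<open>A b\<close>.\<close>

lemma cols_of_mult_adj:
  assumes A: "\<And>b. b < m \<Longrightarrow> A b \<in> carrier_mat N d" and B: "\<And>b. b < m \<Longrightarrow> B b \<in> carrier_mat N' d"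
  shows "cols_of N d m A * adj (cols_of N' d m B) = msum N N' (\<lambda>b. A b * adj (B b)) m"
proof (rule eq_matI)
  fix i j assume "i < dim_row (msum N N' (\<lambda>b. A b * adj (B b)) m)" "j < dim_col (msum N N' (\<lambda>b. A b * adj (B b)) m)"
  then have ij: "i < N" "j < N'"
    by auto
  have "(cols_of N d m A * adj (cols_of N' d m B)) $$ (i, j) =
    (\<Sum>k<d * m. (\<lambda>a b. A b $$ (i, a) * cnj (B b $$ (j, a))) (k div m) (k mod m))"
    using ij by (auto simp: scalar_prod_def atLeast0LessThan index_cols_of intro!: sum.cong)
  also have "\<dots> = (\<Sum>b<m. \<Sum>a<d. A b $$ (i, a) * cnj (B b $$ (j, a)))"
    by (subst sum.swap) (rule sum_div_mod)
  also have "\<dots> = (\<Sum>b<m. (A b * adj (B b)) $$ (i, j))"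
    using ij carrier_matD[OF A] carrier_matD[OF B]
    by (intro sum.cong) (auto simp: scalar_prod_def atLeast0LessThan)
  finally show "(cols_of N d m A * adj (cols_of N' d m B)) $$ (i, j) = msum N N' (\<lambda>b. A b * adj (B b)) m $$ (i, j)"
    using ij by (simp add: msum_def)
qed auto

text \<open>The inner product has D x D matrices as values. D is the dimension of the
  representation, except for quaternionic bases, where elements are stored as pairs and D is twice
  that.\<close>

definition orthonormal :: "nat \<Rightarrow> nat \<Rightarrow> (nat \<Rightarrow> complex mat) \<Rightarrow> bool" where
  "orthonormal D m A \<longleftrightarrow> (\<forall>a<m. \<forall>b<m. adj (A a) * A b = (if a = b then 1\<^sub>m D else 0\<^sub>m D D))"

lemma cols_of_isometry:
  assumes A: "\<And>b. b < m \<Longrightarrow> A b \<in> carrier_mat N d" and on: "orthonormal d m A"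
  shows "adj (cols_of N d m A) * cols_of N d m A = 1\<^sub>m (d * m)"
proof -
  have 1: "adj (A b) * cols_of N d m A = cols_of d d m (\<lambda>a. if b = a then 1\<^sub>m d else 0\<^sub>m d d)" if "b < m" for b
    using A[OF that] on that by (auto simp: mult_cols_of[OF A] orthonormal_def intro!: cols_of_cong)
  show ?thesis
  proof (rule eq_matI)
    fix i j assume "i < dim_row (1\<^sub>m (d * m) :: complex mat)" "j < dim_col (1\<^sub>m (d * m) :: complex mat)"
    then have ij: "i < d * m" "j < d * m"
      by auto
    note ii = div_mod_less[OF ij(1)] and jj = div_mod_less[OF ij(2)]
    show "(adj (cols_of N d m A) * cols_of N d m A) $$ (i, j) = 1\<^sub>m (d * m) $$ (i, j)"
      using ij ii jj eq_div_mod[of i j m]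
      by (simp add: adj_cols_of_index[OF A cols_of_carrier] 1 index_cols_of del: index_mult_mat(1))
  qed auto
qed

text \<open>Gram--Schmidt over the coefficient ring generated by the \<open>A\<^sup>* B\<close>, which will be the complex
  numbers, the reals, or the quaternions (as \<open>2 \<times> 2\<close> block matrices).\<close>

lemma orthonormal_basis_exists:
  assumes sub: "M \<subseteq> carrier_mat N D" and D: "D > 0" and zero: "0\<^sub>m N D \<in> M"
    and add: "\<And>A B. A \<in> M \<Longrightarrow> B \<in> M \<Longrightarrow> A + B \<in> M"
    and scal: "\<And>A t. A \<in> M \<Longrightarrow> complex_of_real t \<cdot>\<^sub>m A \<in> M"
    and coeff: "\<And>A B X. A \<in> M \<Longrightarrow> B \<in> M \<Longrightarrow> X \<in> M \<Longrightarrow> A * (adj B * X) \<in> M"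
    and norm: "\<And>A. A \<in> M \<Longrightarrow> \<exists>t. adj A * A = complex_of_real t \<cdot>\<^sub>m 1\<^sub>m D"
  shows "\<exists>m A. (\<forall>b<m. A b \<in> M) \<and> orthonormal D m A \<and>
    (\<forall>B\<in>M. msum N N (\<lambda>b. A b * adj (A b)) m * B = B)"
proof -
  let ?P = "\<lambda>m. \<exists>A. (\<forall>b<m. A b \<in> M) \<and> orthonormal D m A"
  have bound: "m \<le> N" if "?P m" for m
  proof -
    from that obtain A where A: "\<And>b. b < m \<Longrightarrow> A b \<in> M" "orthonormal D m A"
      by blast
    then have "D * m \<le> N"
      using isometry_le[OF cols_of_carrier cols_of_isometry[of m A N D]] sub by blast
    then show ?thesis
      using D by (cases D) auto
  qed
  have "?P 0"
    by (auto simp: orthonormal_def)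
  \<comment> \<open>Completeness comes from maximality: an element not fixed by the projection onto
    a longest family leaves a nonzero residue that would extend the family.\<close>
  then obtain m where m: "?P m" and max: "\<And>k. ?P k \<Longrightarrow> k \<le> m"
    using bound Nat.ex_has_greatest_nat[of ?P 0 N] by blast
  from m obtain A where A: "\<And>b. b < m \<Longrightarrow> A b \<in> M" and on: "orthonormal D m A"
    by blast
  have Ac: "A b \<in> carrier_mat N D" if "b < m" for b
    using A[OF that] sub by auto
  note Ad = carrier_matD[OF Ac]
  define Q where "Q = msum N N (\<lambda>b. A b * adj (A b)) m"
  have [simp]: "dim_row Q = N" "dim_col Q = N"
    by (auto simp: Q_def)
  have "Q * B = B" if B: "B \<in> M" for B
  proof (rule ccontr)
    assume neq: "Q * B \<noteq> B"
    have Bc: "B \<in> carrier_mat N D"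
      using B sub by auto
    note [simp] = carrier_matD[OF Bc]
    have QB: "Q * B = msum N D (\<lambda>b. A b * (adj (A b) * B)) m"
    proof -
      have "Q * B = msum N D (\<lambda>b. A b * adj (A b) * B) m"
        unfolding Q_def using Ad by (subst msum_mult) (auto intro!: carrier_matI)
      also have "\<dots> = msum N D (\<lambda>b. A b * (adj (A b) * B)) m"
        using Ad by (intro msum_cong mat_assoc) auto
      finally show ?thesis .
    qed
    \<comment> \<open>The residue \<open>B - Q * B\<close>, written with the real scalar -1 because
      closure is given for sums and real multiples.\<close>
    define B' where "B' = B + complex_of_real (- 1) \<cdot>\<^sub>m (Q * B)"
    have "Q * B \<in> M"
      unfolding QB using A by (intro msum_closed[OF zero add sub] coeff[OF _ _ B])
    then have B'M: "B' \<in> M"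
      unfolding B'_def by (rule add[OF B scal])
    have B'c: "B' \<in> carrier_mat N D"
      using B'M sub by auto
    note [simp] = carrier_matD[OF B'c]
    have orth: "adj (A a) * B' = 0\<^sub>m D D" if a: "a < m" for a
    proof -
      have "adj (A a) * (Q * B) = msum D D (\<lambda>b. adj (A a) * (A b * (adj (A b) * B))) m"
        unfolding QB using Ad a by (subst mult_msum) auto
      also have "\<dots> = adj (A a) * (A a * (adj (A a) * B))"
      proof (rule msum_single[OF a])
        show "adj (A a) * (A a * (adj (A a) * B)) \<in> carrier_mat D D"
          using Ad a by auto
        fix b assume b: "b < m" "b \<noteq> a"
        then have "adj (A a) * A b = 0\<^sub>m D D"
          using on a by (auto simp: orthonormal_def)
        then have "adj (A a) * A b * (adj (A b) * B) = 0\<^sub>m D D"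
          using Ad a b by simp
        then show "adj (A a) * (A b * (adj (A b) * B)) = 0\<^sub>m D D"
          using Ad a b by (simp add: mat_assoc)
      qed
      also have "\<dots> = adj (A a) * B"
        using on a Ad by (intro cancel_left) (auto simp: orthonormal_def)
      finally show ?thesis
        unfolding B'_def using Ad a
        by (simp add: mat_distr mat_scal) (auto intro!: eq_matI simp del: index_mult_mat(1))
    qed
    obtain t where t: "adj B' * B' = complex_of_real t \<cdot>\<^sub>m 1\<^sub>m D"
      using norm[OF B'M] by blast
    have "B' = B - Q * B"
      unfolding B'_def by (auto intro!: eq_matI simp del: index_mult_mat(1))
    then have "B' \<noteq> 0\<^sub>m N D"
      using neq mat_diff_eq_0_iff[of B N D "Q * B"] by auto
    then obtain r where r: "adj (complex_of_real r \<cdot>\<^sub>m B') * (complex_of_real r \<cdot>\<^sub>m B') = 1\<^sub>m D"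
      using normalise_scalar_gram[OF t D] by auto
    define X where "X = complex_of_real r \<cdot>\<^sub>m B'"
    have XM: "X \<in> M"
      unfolding X_def by (intro scal B'M)
    have [simp]: "dim_row X = N" "dim_col X = D"
      by (auto simp: X_def)
    have XX: "adj X * X = 1\<^sub>m D"
      unfolding X_def by (rule r)
    have AX: "adj (A a) * X = 0\<^sub>m D D" if "a < m" for a
      unfolding X_def using Ad that by (simp add: mat_scal orth)
    have XA: "adj X * A a = 0\<^sub>m D D" if "a < m" for a
    proof -
      have "adj (adj (A a) * X) = 0\<^sub>m D D"
        using AX[OF that] by simp
      then show ?thesis
        using Ad that by simp
    qed
    have "?P (Suc m)"
    proof (intro exI[of _ "A(m := X)"] conjI)
      show "\<forall>b<Suc m. (A(m := X)) b \<in> M"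
        using A XM by (auto simp: less_Suc_eq)
      show "orthonormal D (Suc m) (A(m := X))"
        using on XX AX XA unfolding orthonormal_def by (auto simp: less_Suc_eq)
    qed
    then show False
      using max[of "Suc m"] by simp
  qed
  then show ?thesis
    using A on unfolding Q_def by (intro exI[of _ m] exI[of _ A]) auto
qed

subsection \<open>Subspaces and irreducible representations\<close>

lemma subspace_vecI:
  assumes "W \<subseteq> carrier_vec d" "0\<^sub>v d \<in> W"
    and "\<And>v w. v \<in> W \<Longrightarrow> w \<in> W \<Longrightarrow> v + w \<in> W"
    and "\<And>z v. v \<in> W \<Longrightarrow> z \<cdot>\<^sub>v v \<in> W"
  shows "VectorSpace.subspace class_ring W (module_vec TYPE(complex) d)"
proof -
  interpret vec_space "TYPE(complex)" d .
  show ?thesis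
    unfolding VectorSpace.subspace_def LinearCombinations.submodule_def
    using assms vec_vs vec_module by (auto simp: module_vec_simps class_ring_simps)
qed

lemma subspace_vecD:
  assumes "VectorSpace.subspace class_ring W (module_vec TYPE(complex) d)"
  shows "W \<subseteq> carrier_vec d" "0\<^sub>v d \<in> W"
    and "\<And>v w. v \<in> W \<Longrightarrow> w \<in> W \<Longrightarrow> v + w \<in> W"
    and "\<And>z v. v \<in> W \<Longrightarrow> z \<cdot>\<^sub>v v \<in> W"
  using assms unfolding VectorSpace.subspace_def LinearCombinations.submodule_def
  by (auto simp: module_vec_simps class_ring_simps)

text \<open>Gram-Schmidt with D = 1, vectors being regarded as one-column matrices. Invariant
  subspaces can then be handled as matrices with orthonormal columns.\<close>

lemma subspace_isometry:
  assumes sub: "W \<subseteq> carrier_vec n" and zero: "0\<^sub>v n \<in> W"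
    and add: "\<And>v w. v \<in> W \<Longrightarrow> w \<in> W \<Longrightarrow> v + w \<in> W"
    and scal: "\<And>z v. v \<in> W \<Longrightarrow> z \<cdot>\<^sub>v v \<in> W"
  shows "\<exists>k B. B \<in> carrier_mat n k \<and> adj B * B = 1\<^sub>m k \<and> W = {B *\<^sub>v y | y. y \<in> carrier_vec k}"
proof -
  define cm where "cm = (\<lambda>w. mat n 1 (\<lambda>(i, j). w $ i) :: complex mat)"
  define M where "M = cm ` W"
  have cm_inj: "v = w" if "cm v = cm w" "v \<in> carrier_vec n" "w \<in> carrier_vec n" for v w
  proof (rule eq_vecI)
    fix i assume "i < dim_vec w"
    then have "i < n" using that by auto
    then show "v $ i = w $ i"
      using arg_cong[OF that(1), of "\<lambda>X. X $$ (i, 0)"] by (simp add: cm_def)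
  qed (use that in auto)
  have cm_mult: "cm (X *\<^sub>v v) = X * cm v" if "X \<in> carrier_mat n n" "v \<in> carrier_vec n" for X v
    using that by (intro eq_matI) (auto simp: cm_def scalar_prod_def)
  have Msub: "M \<subseteq> carrier_mat n 1"
    by (auto simp: M_def cm_def)
  have Mzero: "0\<^sub>m n 1 \<in> M"
    unfolding M_def using zero by (intro image_eqI[of _ _ "0\<^sub>v n"]) (auto simp: cm_def)
  have Madd: "A + B \<in> M" if AB: "A \<in> M" "B \<in> M" for A B
  proof -
    obtain v w where "v \<in> W" "w \<in> W" "A = cm v" "B = cm w"
      using AB by (auto simp: M_def)
    moreover then have "A + B = cm (v + w)"
      using sub by (intro eq_matI) (auto simp: cm_def)
    ultimately show ?thesis
      unfolding M_def using add by blast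
  qed
  have Mscal: "z \<cdot>\<^sub>m A \<in> M" if A: "A \<in> M" for A z
  proof -
    obtain v where "v \<in> W" "A = cm v"
      using A by (auto simp: M_def)
    moreover then have "z \<cdot>\<^sub>m A = cm (z \<cdot>\<^sub>v v)"
      using sub by (intro eq_matI) (auto simp: cm_def)
    ultimately show ?thesis
      unfolding M_def using scal by blast
  qed
  have coeff: "A * (adj B * X) \<in> M" if A: "A \<in> M" and B: "B \<in> M" and X: "X \<in> M" for A B X
  proof -
    have "A \<in> carrier_mat n 1" "B \<in> carrier_mat n 1" "X \<in> carrier_mat n 1"
      using A B X Msub by auto
    then have "A * (adj B * X) = (adj B * X) $$ (0, 0) \<cdot>\<^sub>m A"
      by (intro eq_matI) (auto simp: scalar_prod_def)
    then show ?thesis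
      using Mscal[OF A] by simp
  qed
  have norm: "\<exists>t. adj A * A = complex_of_real t \<cdot>\<^sub>m 1\<^sub>m 1" if A: "A \<in> M" for A
  proof (intro exI)
    show "adj A * A = complex_of_real (\<Sum>i<n. (cmod (A $$ (i, 0)))\<^sup>2) \<cdot>\<^sub>m 1\<^sub>m 1"
      using A Msub adj_mult_diag[of 0 A] by (intro eq_matI) (auto simp del: index_mult_mat(1))
  qed
  obtain m A where A: "\<And>b. b < m \<Longrightarrow> A b \<in> M" and on: "orthonormal 1 m A"
    and full: "\<And>B. B \<in> M \<Longrightarrow> msum n n (\<lambda>b. A b * adj (A b)) m * B = B"
    using orthonormal_basis_exists[OF Msub _ Mzero Madd Mscal coeff norm] by auto
  have Ac: "A b \<in> carrier_mat n 1" if "b < m" for b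
    using A[OF that] Msub by auto
  define B where "B = cols_of n 1 m A"
  have Bc: "B \<in> carrier_mat n m"
    unfolding B_def by auto
  have iso: "adj B * B = 1\<^sub>m m"
    using cols_of_isometry[OF Ac on] by (simp add: B_def)
  have BB: "B * adj B = msum n n (\<lambda>b. A b * adj (A b)) m"
    unfolding B_def by (rule cols_of_mult_adj[OF Ac Ac])
  have "\<exists>y. w = B *\<^sub>v y \<and> y \<in> carrier_vec m" if w: "w \<in> W" for w
  proof (intro exI conjI)
    have wc: "w \<in> carrier_vec n"
      using w sub by auto
    have "cm (B * adj B *\<^sub>v w) = cm w"
      using full[of "cm w"] w wc Bc unfolding BB[symmetric] by (subst cm_mult) (auto simp: M_def)
    then have "B * adj B *\<^sub>v w = w"
      using Bc wc by (intro cm_inj) (auto intro!: mult_mat_vec_carrier[of _ n n])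
    then show "w = B *\<^sub>v (adj B *\<^sub>v w)"
      using Bc wc by (simp add: mult_vec_assoc)
    show "adj B *\<^sub>v w \<in> carrier_vec m"
      using Bc by (auto intro!: carrier_vecI)
  qed
  moreover have "B *\<^sub>v y \<in> W" if y: "y \<in> carrier_vec m" for y
  proof -
    have Ad: "dim_row (A b) = n" "dim_col (A b) = 1" if "b < m" for b
      using Ac[OF that] by auto
    have "cm (B *\<^sub>v y) = msum n 1 (\<lambda>b. y $ b \<cdot>\<^sub>m A b) m"
      using y Bc Ad by (intro eq_matI)
        (auto simp: cm_def scalar_prod_def msum_def B_def index_cols_of atLeast0LessThan mult.commute)
    also have "\<dots> \<in> M"
      by (rule msum_closed[OF Mzero Madd Msub Mscal[OF A]])
    finally obtain w where "w \<in> W" "cm (B *\<^sub>v y) = cm w"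
      by (auto simp: M_def)
    moreover have "B *\<^sub>v y \<in> carrier_vec n"
      using Bc y by (rule mult_mat_vec_carrier)
    ultimately show ?thesis
      using cm_inj[of "B *\<^sub>v y" w] sub by auto
  qed
  ultimately show ?thesis
    using Bc iso by blast
qed

text \<open>\<open>B * adj B\<close> is the orthogonal projection onto the range of B, so invariance
  of the range becomes a matrix equation.\<close>

lemma isometry_range_invariant:
  assumes B: "B \<in> carrier_mat n k" "adj B * B = 1\<^sub>m k" and X: "X \<in> carrier_mat n n"
    and inv: "\<And>y. y \<in> carrier_vec k \<Longrightarrow> X *\<^sub>v (B *\<^sub>v y) \<in> {B *\<^sub>v y | y. y \<in> carrier_vec k}"
  shows "B * (adj B * (X * B)) = X * B"
proof (rule mat_eq_iff_mult_vec[of _ n k])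
  note [simp] = carrier_matD[OF B(1)] carrier_matD[OF X]
  show "B * (adj B * (X * B)) \<in> carrier_mat n k" "X * B \<in> carrier_mat n k"
    by (auto intro!: carrier_matI)
  fix y :: "complex vec" assume y: "y \<in> carrier_vec k"
  then obtain z where z: "X *\<^sub>v (B *\<^sub>v y) = B *\<^sub>v z" "z \<in> carrier_vec k"
    using inv by blast
  have "B * (adj B * (X * B)) *\<^sub>v y = B *\<^sub>v (adj B *\<^sub>v (B *\<^sub>v z))"
    using y z by (simp add: mult_vec_assoc)
  also have "\<dots> = B *\<^sub>v (adj B * B *\<^sub>v z)"
    using z(2) by (simp add: mult_vec_assoc)
  also have "\<dots> = X * B *\<^sub>v y"
    using y z B(2) by (simp add: mult_vec_assoc)
  finally show "B * (adj B * (X * B)) *\<^sub>v y = X * B *\<^sub>v y" .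
qed

section \<open>Intertwiners, Schur's lemma and the existence of irreducible
  subrepresentations\<close>

lemma is_repD:
  assumes "is_rep g R" "x \<in> g"
  shows "snd R x \<in> carrier_mat (fst R) (fst R)" "adj (snd R x) = - snd R x"
    and "dim_row (snd R x) = fst R" "dim_col (snd R x) = fst R"
  using assms by (auto simp: is_rep_def lie_hom_def lie_u_def)

text \<open>The space of homomorphisms over g, source first. With the ambient representation as
  target it is the multiplicity space of R.\<close>

definition intw :: "'a set \<Rightarrow> 'a rep \<Rightarrow> 'a rep \<Rightarrow> complex mat set" where
  "intw g R R' = {B \<in> carrier_mat (fst R') (fst R). \<forall>x\<in>g. snd R' x * B = B * snd R x}"

lemma intw_dim:
  assumes "B \<in> intw g R R'"
  shows "dim_row B = fst R'" "dim_col B = fst R" "B \<in> carrier_mat (fst R') (fst R)"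
  using assms by (auto simp: intw_def)

lemma intwD: "B \<in> intw g R R' \<Longrightarrow> x \<in> g \<Longrightarrow> snd R' x * B = B * snd R x"
  by (auto simp: intw_def)

lemma minus_mat_eq_iff: "- A = - B \<longleftrightarrow> A = (B :: complex mat)"
  by (metis uminus_uminus_mat)

text \<open>Both representations are anti-Hermitian, so taking adjoints reverses an intertwiner and
  the two signs cancel.\<close>

lemma intw_adj:
  assumes R: "is_rep g R" and R': "is_rep g R'" and B: "B \<in> intw g R R'"
  shows "adj B \<in> intw g R' R"
proof -
  note [simp] = intw_dim[OF B]
  have "snd R x * adj B = adj B * snd R' x" if x: "x \<in> g" for x
  proof -
    note r = is_repD[OF R x] is_repD[OF R' x]
    have "adj (snd R' x * B) = adj (B * snd R x)"
      using intwD[OF B x] by simp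
    then show ?thesis
      using r by (simp add: mat_scal minus_mat_eq_iff)
  qed
  then show ?thesis
    using intw_dim[OF B] by (auto simp: intw_def)
qed

lemma intw_mult:
  assumes R: "is_rep g R" and R': "is_rep g R'" and R'': "is_rep g R''"
    and B: "B \<in> intw g R R'" and D: "D \<in> intw g R' R''"
  shows "D * B \<in> intw g R R''"
proof -
  note [simp] = intw_dim[OF B] intw_dim[OF D]
  have "snd R'' x * (D * B) = D * B * snd R x" if x: "x \<in> g" for x
  proof -
    note [simp] = is_repD[OF R x] is_repD[OF R' x] is_repD[OF R'' x]
    have "snd R'' x * (D * B) = snd R'' x * D * B"
      by (subst mat_assoc) auto
    also have "\<dots> = D * (snd R' x * B)"
      using intwD[OF D x] by (simp add: mat_assoc)
    also have "\<dots> = D * B * snd R x"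
      using intwD[OF B x] by (simp add: mat_assoc)
    finally show ?thesis .
  qed
  then show ?thesis
    by (auto simp: intw_def)
qed

text \<open>An eigenspace of B is invariant and nonzero, hence everything; an eigenvalue exists over
  the complex numbers in positive dimension.\<close>

lemma schur:
  assumes irr: "irreducible_rep g R" and B: "B \<in> intw g R R"
  shows "\<exists>z. B = z \<cdot>\<^sub>m 1\<^sub>m (fst R)"
proof -
  define d where "d = fst R"
  have d: "d > 0" and rep: "is_rep g R"
    using irr by (auto simp: irreducible_rep_def d_def)
  have Bc: "B \<in> carrier_mat d d"
    using B by (simp add: intw_def d_def)
  obtain z where "eigenvalue B z"
    using spectrum_non_empty[OF Bc d] by (auto simp: spectrum_def)
  then obtain v where v: "v \<in> carrier_vec d" "v \<noteq> 0\<^sub>v d" "B *\<^sub>v v = z \<cdot>\<^sub>v v"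
    using Bc by (auto simp: eigenvalue_def eigenvector_def)
  define W where "W = {v \<in> carrier_vec d. B *\<^sub>v v = z \<cdot>\<^sub>v v}"
  have sub: "VectorSpace.subspace class_ring W (module_vec TYPE(complex) d)"
    using Bc by (intro subspace_vecI)
      (auto simp: W_def mult_add_distrib_mat_vec[of _ d d] smult_add_distrib_vec[of _ d]
        mult_mat_vec[of _ d d] smult_smult_assoc mult.commute)
  have "snd R x *\<^sub>v w \<in> W" if x: "x \<in> g" and w: "w \<in> W" for x w
  proof -
    note r = is_repD[OF rep x, folded d_def]
    have wc: "w \<in> carrier_vec d" "B *\<^sub>v w = z \<cdot>\<^sub>v w"
      using w by (auto simp: W_def)
    have "B *\<^sub>v (snd R x *\<^sub>v w) = (B * snd R x) *\<^sub>v w"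
      using r wc Bc by (simp add: mult_vec_assoc)
    also have "\<dots> = snd R x *\<^sub>v (B *\<^sub>v w)"
      using r wc(1) Bc by (simp add: mult_vec_assoc intwD[OF B x, symmetric])
    also have "\<dots> = z \<cdot>\<^sub>v (snd R x *\<^sub>v w)"
      using r wc by (simp add: mult_mat_vec[of _ d d])
    finally show ?thesis
      using r wc by (simp add: W_def mult_mat_vec_carrier[of _ d d])
  qed
  then have "W = {0\<^sub>v d} \<or> W = carrier_vec d"
    using irr sub unfolding irreducible_rep_def d_def by blast
  moreover have "v \<in> W"
    using v by (simp add: W_def)
  ultimately have W: "W = carrier_vec d"
    using v by auto
  have "B = z \<cdot>\<^sub>m 1\<^sub>m d"
  proof (rule mat_eq_iff_mult_vec[OF Bc])
    fix v :: "complex vec" assume v: "v \<in> carrier_vec d"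
    then have "B *\<^sub>v v = z \<cdot>\<^sub>v v"
      using W by (auto simp: W_def)
    also have "\<dots> = z \<cdot>\<^sub>m 1\<^sub>m d *\<^sub>v v"
      using v by (auto intro!: eq_vecI)
    finally show "B *\<^sub>v v = z \<cdot>\<^sub>m 1\<^sub>m d *\<^sub>v v" .
  qed simp
  then show ?thesis
    unfolding d_def by blast
qed

text \<open>Among the isometries whose range is invariant and lies in the range of P, one with the
  fewest columns is irreducible: an invariant subspace of its source is the range of an isometry B,
  and \<open>A * B\<close> is a competitor. P will be the projection onto the complement of what is
  already decomposed.\<close>

lemma exists_irreducible_subrep:
  assumes g: "g \<subseteq> lie_u N"
    and P: "P \<in> carrier_mat N N" "P * P = P" "P \<noteq> 0\<^sub>m N N"
    and com: "\<And>x. x \<in> g \<Longrightarrow> x * P = P * x"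
  shows "\<exists>R A. irreducible_rep g R \<and> A \<in> intw g R (N, \<lambda>x. x) \<and> A \<noteq> 0\<^sub>m N (fst R) \<and> P * A = A"
proof -
  have gd: "dim_row x = N" "dim_col x = N" "adj x = - x" "x \<in> carrier_mat N N" if "x \<in> g" for x
    using g that by (auto simp: lie_u_def)
  note [simp] = carrier_matD[OF P(1)]
  define Q where "Q = (\<lambda>d A. A \<in> carrier_mat N d \<and> d > 0 \<and> adj A * A = 1\<^sub>m d \<and>
    (\<forall>x\<in>g. A * (adj A * (x * A)) = x * A) \<and> P * A = A)"
  have "\<exists>d A. Q d A"
  proof -
    \<comment> \<open>The range of the idempotent P, described as its space of fixed
      vectors.\<close>
    define W where "W = {v \<in> carrier_vec N. P *\<^sub>v v = v}"
    have PW: "P *\<^sub>v v \<in> W" if "v \<in> carrier_vec N" for v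
    proof -
      have "P *\<^sub>v (P *\<^sub>v v) = P * P *\<^sub>v v"
        using that by (intro mult_vec_assoc[symmetric]) auto
      then show ?thesis
        using that P by (simp add: W_def mult_mat_vec_carrier[of _ N N])
    qed
    have "\<exists>k B. B \<in> carrier_mat N k \<and> adj B * B = 1\<^sub>m k \<and> W = {B *\<^sub>v y | y. y \<in> carrier_vec k}"
      by (rule subspace_isometry)
        (use P(1) in \<open>auto simp: W_def mult_add_distrib_mat_vec[of _ N N] mult_mat_vec[of _ N N]\<close>)
    then obtain k B where B: "B \<in> carrier_mat N k" "adj B * B = 1\<^sub>m k" "W = {B *\<^sub>v y | y. y \<in> carrier_vec k}"
      by blast
    note [simp] = carrier_matD[OF B(1)]
    have By: "B *\<^sub>v y \<in> W" if "y \<in> carrier_vec k" for y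
      using that B(3) by auto
    have "P * B = B"
    proof (rule mat_eq_iff_mult_vec[of _ N k])
      fix y :: "complex vec" assume "y \<in> carrier_vec k"
      then show "P * B *\<^sub>v y = B *\<^sub>v y"
        using By[of y] by (simp add: mult_vec_assoc W_def)
    qed (auto intro!: carrier_matI)
    moreover have "B * (adj B * (x * B)) = x * B" if x: "x \<in> g" for x
    proof (rule isometry_range_invariant[OF B(1,2) gd(4)[OF x]])
      note [simp] = gd[OF x]
      fix y :: "complex vec" assume y: "y \<in> carrier_vec k"
      then have "P *\<^sub>v (x *\<^sub>v (B *\<^sub>v y)) = x *\<^sub>v (P *\<^sub>v (B *\<^sub>v y))"
        using mult_vec_assoc[of P x "B *\<^sub>v y"] mult_vec_assoc[of x P "B *\<^sub>v y"] com[OF x] by simp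
      then have "x *\<^sub>v (B *\<^sub>v y) \<in> W"
        using By[OF y] by (auto simp: W_def intro!: carrier_vecI)
      then show "x *\<^sub>v (B *\<^sub>v y) \<in> {B *\<^sub>v y | y. y \<in> carrier_vec k}"
        unfolding B(3) .
    qed
    moreover have "k > 0"
    proof (rule ccontr)
      assume "\<not> k > 0"
      have "P *\<^sub>v v = 0\<^sub>v N" if "v \<in> carrier_vec N" for v
      proof -
        have "P *\<^sub>v v \<in> {B *\<^sub>v y | y. y \<in> carrier_vec k}"
          using PW[OF that] B(3) by blast
        then obtain y where "P *\<^sub>v v = B *\<^sub>v y"
          and "y \<in> carrier_vec k"
          by blast
        note this(1)
        also have "B *\<^sub>v y = 0\<^sub>v N"
          using \<open>\<not> k > 0\<close> \<open>y \<in> carrier_vec k\<close> by (intro eq_vecI) (auto simp: scalar_prod_def row_def)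
        finally show ?thesis .
      qed
      then have "P = 0\<^sub>m N N"
        by (intro mat_eq_iff_mult_vec[OF P(1)]) (auto intro!: eq_vecI simp: scalar_prod_def row_def)
      with P(3) show False ..
    qed
    ultimately have "Q k B"
      unfolding Q_def using B(1,2) by blast
    then show ?thesis
      by blast
  qed
  then obtain d where d: "\<exists>A. Q d A" and least: "\<And>k. \<exists>A. Q k A \<Longrightarrow> d \<le> k"
    using exists_least_iff[of "\<lambda>d. \<exists>A. Q d A"] by (metis not_less)
  then obtain A where A: "A \<in> carrier_mat N d" and d0: "d > 0" and iso: "adj A * A = 1\<^sub>m d"
    and inv: "\<And>x. x \<in> g \<Longrightarrow> A * (adj A * (x * A)) = x * A" and PA: "P * A = A"
    unfolding Q_def by blast
  note [simp] = carrier_matD[OF A]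
  define r where "r = (\<lambda>x. adj A * (x * A))"
  have rc: "r x \<in> carrier_mat d d" "dim_row (r x) = d" "dim_col (r x) = d" for x
    by (auto simp: r_def intro!: carrier_matI)
  have Ar: "A * r x = x * A" if "x \<in> g" for x
    using inv[OF that] by (simp add: r_def)
  \<comment> \<open>Because the range of A is invariant, compression to it is multiplicative and
    therefore respects brackets.\<close>
  have rr: "r x * r y = adj A * (x * (y * A))" if x: "x \<in> g" and y: "y \<in> g" for x y
  proof -
    note [simp] = gd[OF x] gd[OF y] rc[of y]
    have "r x * r y = adj A * (x * A) * r y"
      by (simp add: r_def)
    also have "\<dots> = adj A * (x * (A * r y))"
      by (simp add: mat_assoc)
    finally show ?thesis
      by (simp add: Ar[OF y])
  qed
  have rep: "is_rep g (d, r)"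
    unfolding is_rep_def lie_hom_def fst_conv snd_conv
  proof (intro conjI ballI allI)
    fix x assume x: "x \<in> g"
    note [simp] = gd[OF x]
    have "adj (r x) = - r x"
      by (simp add: r_def mat_scal mat_assoc)
    then show "r x \<in> lie_u d"
      using rc by (simp add: lie_u_def)
    show "r (complex_of_real t \<cdot>\<^sub>m x) = complex_of_real t \<cdot>\<^sub>m r x" for t
      by (simp add: r_def mat_scal)
    fix y assume y: "y \<in> g"
    note [simp] = gd[OF y]
    show "r (x + y) = r x + r y"
      by (simp add: r_def mat_distr)
    show "r (lie_bracket x y) = lie_bracket (r x) (r y)"
      using x y by (simp add: lie_bracket_def rr) (simp add: r_def mat_distr mat_assoc)
  qed
  have "irreducible_rep g (d, r)"
    unfolding irreducible_rep_def fst_conv snd_conv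
  proof (intro conjI rep d0 allI impI)
    fix W assume W: "VectorSpace.subspace class_ring W (module_vec TYPE(complex) d) \<and>
      (\<forall>x\<in>g. \<forall>w\<in>W. r x *\<^sub>v w \<in> W)"
    note Ws = subspace_vecD[OF conjunct1[OF W]]
    obtain k B where B: "B \<in> carrier_mat d k" "adj B * B = 1\<^sub>m k" "W = {B *\<^sub>v y | y. y \<in> carrier_vec k}"
      using subspace_isometry[OF Ws] by blast
    note [simp] = carrier_matD[OF B(1)]
    have rB: "B * (adj B * (r x * B)) = r x * B" if x: "x \<in> g" for x
      by (rule isometry_range_invariant[OF B(1,2) rc(1)]) (use W x B(3) in blast)
    show "W = {0\<^sub>v d} \<or> W = carrier_vec d"
    proof (cases "k > 0")
      case False
      then have "B *\<^sub>v y = 0\<^sub>v d" if "y \<in> carrier_vec k" for y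
        using that by (intro eq_vecI) (auto simp: scalar_prod_def)
      then have "W \<subseteq> {0\<^sub>v d}"
        unfolding B(3) by auto
      then show ?thesis
        using Ws(2) by auto
    next
      case True
      have "A * B * (adj (A * B) * (x * (A * B))) = x * (A * B)" if x: "x \<in> g" for x
      proof -
        note [simp] = gd[OF x] rc[of x]
        have xAB: "x * (A * B) = A * (r x * B)"
          by (simp add: Ar[OF x] flip: mat_assoc)
        have "A * B * (adj (A * B) * (x * (A * B))) = A * (B * (adj B * (adj A * (A * (r x * B)))))"
          unfolding xAB by (simp add: mat_assoc)
        also have "adj A * (A * (r x * B)) = r x * B"
          by (rule cancel_left[OF iso]) auto
        finally show ?thesis
          unfolding rB[OF x] xAB .
      qed
      moreover have "adj (A * B) * (A * B) = 1\<^sub>m k"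
        by (simp add: mat_assoc cancel_left[OF iso] B(2))
      moreover have "P * (A * B) = A * B"
        using PA by (simp flip: mat_assoc)
      moreover have "A * B \<in> carrier_mat N k"
        by (auto intro!: carrier_matI)
      ultimately have "Q k (A * B)"
        unfolding Q_def using True by blast
      then have "d \<le> k"
        using least by blast
      then have k: "k = d"
        using isometry_le[OF B(1,2)] by simp
      then have BB: "B * adj B = 1\<^sub>m d"
        using isometry_square[of B d] B(1,2) by simp
      have "w \<in> W" if w: "w \<in> carrier_vec d" for w
      proof -
        have "w = B *\<^sub>v (adj B *\<^sub>v w)"
          using w BB by (simp flip: mult_vec_assoc)
        then show ?thesis
          unfolding B(3) using w by (auto intro!: carrier_vecI)
      qed
      then show ?thesis
        using Ws(1) by auto
    qed
  qed
  moreover have "A \<in> intw g (d, r) (N, \<lambda>x. x)"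
    using A Ar by (auto simp: intw_def)
  moreover have "A \<noteq> 0\<^sub>m N d"
    using iso d0 by (auto dest: arg_cong[of _ _ "\<lambda>X. X $$ (0, 0)"])
  ultimately show ?thesis
    using PA by (intro exI[of _ "(d, r)"] exI[of _ A]) simp
qed

subsection \<open>Concatenating matrices horizontally\<close>

text \<open>The block row of A and B, encoded as a four-block matrix without lower rows so that
  block multiplication applies.\<close>

definition hcat2 :: "complex mat \<Rightarrow> complex mat \<Rightarrow> complex mat" where
  "hcat2 A B = four_block_mat A B (0\<^sub>m 0 (dim_col A)) (0\<^sub>m 0 (dim_col B))"

lemma dim_hcat2 [simp]:
  "dim_row (hcat2 A B) = dim_row A" "dim_col (hcat2 A B) = dim_col A + dim_col B"
  by (auto simp: hcat2_def)

lemma index_hcat2: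
  "i < dim_row A \<Longrightarrow> j < dim_col A + dim_col B \<Longrightarrow>
    hcat2 A B $$ (i, j) = (if j < dim_col A then A $$ (i, j) else B $$ (i, j - dim_col A))"
  by (auto simp: hcat2_def)

lemma mult_hcat2:
  assumes "dim_col Y = dim_row A" "dim_row A = dim_row B"
  shows "Y * hcat2 A B = hcat2 (Y * A) (Y * B)"
  using assms by (intro eq_matI) (auto simp: index_hcat2 scalar_prod_def)

lemma hcat2_add:
  assumes "A \<in> carrier_mat n a" "B \<in> carrier_mat n b" "A' \<in> carrier_mat n a" "B' \<in> carrier_mat n b"
  shows "hcat2 A B + hcat2 A' B' = hcat2 (A + A') (B + B')"
  using assms by (intro eq_matI) (auto simp: index_hcat2)

lemma hcat2_smult: "dim_row A = dim_row B \<Longrightarrow> z \<cdot>\<^sub>m hcat2 A B = hcat2 (z \<cdot>\<^sub>m A) (z \<cdot>\<^sub>m B)"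
  by (rule eq_matI) (auto simp: index_hcat2)

lemma hcat2_eq_iff:
  assumes "A \<in> carrier_mat n a" "B \<in> carrier_mat n b" "A' \<in> carrier_mat n a" "B' \<in> carrier_mat n b"
  shows "hcat2 A B = hcat2 A' B' \<longleftrightarrow> A = A' \<and> B = B'"
proof
  assume *: "hcat2 A B = hcat2 A' B'"
  have "A $$ (i, j) = A' $$ (i, j)" if "i < n" "j < a" for i j
    using arg_cong[OF *, of "\<lambda>X. X $$ (i, j)"] assms that by (simp add: index_hcat2)
  moreover have "B $$ (i, j) = B' $$ (i, j)" if "i < n" "j < b" for i j
    using arg_cong[OF *, of "\<lambda>X. X $$ (i, a + j)"] assms that by (simp add: index_hcat2)
  ultimately show "A = A' \<and> B = B'"
    using assms by (auto intro!: eq_matI)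
qed auto

lemma hcat2_mult_block:
  assumes "A \<in> carrier_mat n a" "B \<in> carrier_mat n b"
    and "X \<in> carrier_mat a a'" "Y \<in> carrier_mat a b'" "Z \<in> carrier_mat b a'" "W \<in> carrier_mat b b'"
  shows "hcat2 A B * four_block_mat X Y Z W = hcat2 (A * X + B * Z) (A * Y + B * W)"
  unfolding hcat2_def
  by (subst mult_four_block_mat[of _ n a _ b _ 0 _ _ a' _ b']) (use assms in \<open>auto intro!: cong_four_block_mat eq_matI\<close>)

lemma adj_hcat2_mult_hcat2:
  assumes "A \<in> carrier_mat n a" "B \<in> carrier_mat n b" "A' \<in> carrier_mat n a'" "B' \<in> carrier_mat n b'"
  shows "adj (hcat2 A B) * hcat2 A' B' = four_block_mat (adj A * A') (adj A * B') (adj B * A') (adj B * B')"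
  using assms by (intro eq_matI) (auto simp: index_hcat2 scalar_prod_def)

lemma adj_hcat2_mult_eq_0_iff:
  assumes "A \<in> carrier_mat n a" "B \<in> carrier_mat n b" "Z \<in> carrier_mat n e"
  shows "adj (hcat2 A B) * Z = 0\<^sub>m (a + b) e \<longleftrightarrow> adj A * Z = 0\<^sub>m a e \<and> adj B * Z = 0\<^sub>m b e"
proof
  assume *: "adj (hcat2 A B) * Z = 0\<^sub>m (a + b) e"
  have "(adj A * Z) $$ (i, j) = 0" if "i < a" "j < e" for i j
    using arg_cong[OF *, of "\<lambda>X. X $$ (i, j)"] assms that by (auto simp: index_hcat2 scalar_prod_def)
  moreover have "(adj B * Z) $$ (i, j) = 0" if "i < b" "j < e" for i j
    using arg_cong[OF *, of "\<lambda>X. X $$ (a + i, j)"] assms that by (auto simp: index_hcat2 scalar_prod_def)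
  ultimately show "adj A * Z = 0\<^sub>m a e \<and> adj B * Z = 0\<^sub>m b e"
    using assms by (auto intro!: eq_matI simp del: index_mult_mat(1))
next
  assume *: "adj A * Z = 0\<^sub>m a e \<and> adj B * Z = 0\<^sub>m b e"
  show "adj (hcat2 A B) * Z = 0\<^sub>m (a + b) e"
  proof (rule eq_matI)
    fix i j assume ij: "i < dim_row (0\<^sub>m (a + b) e :: complex mat)" "j < dim_col (0\<^sub>m (a + b) e :: complex mat)"
    show "(adj (hcat2 A B) * Z) $$ (i, j) = 0\<^sub>m (a + b) e $$ (i, j)"
    proof (cases "i < a")
      case True
      then have "(adj (hcat2 A B) * Z) $$ (i, j) = (adj A * Z) $$ (i, j)"
        using ij assms by (auto simp: index_hcat2 scalar_prod_def)
      then show ?thesis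
        using * ij True by simp
    next
      case False
      then have "(adj (hcat2 A B) * Z) $$ (i, j) = (adj B * Z) $$ (i - a, j)"
        using ij assms by (auto simp: index_hcat2 scalar_prod_def)
      then show ?thesis
        using * ij False by simp
    qed
  qed (use assms in auto)
qed

primrec hcat :: "nat \<Rightarrow> complex mat list \<Rightarrow> complex mat" where
  "hcat N [] = 0\<^sub>m N 0"
| "hcat N (U # Us) = hcat2 U (hcat N Us)"

lemma hcat_carrier:
  "\<forall>U\<in>set Us. dim_row U = N \<Longrightarrow> hcat N Us \<in> carrier_mat N (sum_list (map dim_col Us))"
  by (induction Us) (auto intro!: carrier_matI)

lemma mult_hcat:
  "\<forall>U\<in>set Us. dim_row U = N \<Longrightarrow> dim_col Y = N \<Longrightarrow> Y * hcat N Us = hcat (dim_row Y) (map (\<lambda>U. Y * U) Us)"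
proof (induction Us)
  case (Cons U Us)
  then have "hcat N Us \<in> carrier_mat N (sum_list (map dim_col Us))"
    by (intro hcat_carrier) simp
  then have "dim_row (hcat N Us) = N"
    by simp
  then show ?case
    using Cons by (simp add: mult_hcat2)
qed simp

lemma adj_hcat_mult_eq_0_iff:
  "\<forall>U\<in>set Us. dim_row U = N \<Longrightarrow> Z \<in> carrier_mat N e \<Longrightarrow>
    adj (hcat N Us) * Z = 0\<^sub>m (sum_list (map dim_col Us)) e \<longleftrightarrow> (\<forall>U\<in>set Us. adj U * Z = 0\<^sub>m (dim_col U) e)"
proof (induction Us)
  case (Cons U Us)
  have "hcat N Us \<in> carrier_mat N (sum_list (map dim_col Us))"
    by (rule hcat_carrier) (use Cons.prems in auto)
  moreover have "U \<in> carrier_mat N (dim_col U)"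
    by (rule carrier_matI) (use Cons.prems in auto)
  ultimately have "adj (hcat N (U # Us)) * Z = 0\<^sub>m (sum_list (map dim_col (U # Us))) e \<longleftrightarrow>
    adj U * Z = 0\<^sub>m (dim_col U) e \<and> adj (hcat N Us) * Z = 0\<^sub>m (sum_list (map dim_col Us)) e"
    unfolding hcat.simps list.map sum_list.Cons by (intro adj_hcat2_mult_eq_0_iff[OF _ _ Cons.prems(2)])
  moreover have "adj (hcat N Us) * Z = 0\<^sub>m (sum_list (map dim_col Us)) e \<longleftrightarrow> (\<forall>U\<in>set Us. adj U * Z = 0\<^sub>m (dim_col U) e)"
    by (rule Cons.IH) (use Cons.prems in simp_all)
  ultimately show ?case
    by simp
qed (auto intro!: eq_matI)

text \<open>Each pair of blocks is compared in one order only; the reversed orthogonality follows by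
  taking adjoints.\<close>

lemma hcat_isometry:
  assumes "\<forall>U\<in>set Us. dim_row U = N \<and> adj U * U = 1\<^sub>m (dim_col U)"
    and "sorted_wrt (\<lambda>U U'. adj U' * U = 0\<^sub>m (dim_col U') (dim_col U)) Us"
  shows "adj (hcat N Us) * hcat N Us = 1\<^sub>m (sum_list (map dim_col Us))"
  using assms
proof (induction Us)
  case (Cons U Us)
  let ?H = "hcat N Us" and ?k = "sum_list (map dim_col Us)"
  have H: "?H \<in> carrier_mat N ?k"
    by (rule hcat_carrier) (use Cons.prems in auto)
  have U: "U \<in> carrier_mat N (dim_col U)"
    by (rule carrier_matI) (use Cons.prems in auto)
  have "\<forall>U\<in>set Us. dim_row U = N"
    using Cons.prems(1) by simp
  from adj_hcat_mult_eq_0_iff[OF this U] have 1: "adj ?H * U = 0\<^sub>m ?k (dim_col U)"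
    using Cons.prems(2) by simp
  then have "adj (adj ?H * U) = 0\<^sub>m (dim_col U) ?k"
    by simp
  then have 2: "adj U * ?H = 0\<^sub>m (dim_col U) ?k"
    using carrier_matD[OF H] carrier_matD(1)[OF U] by simp
  have "adj ?H * ?H = 1\<^sub>m ?k"
    by (rule Cons.IH) (use Cons.prems in simp_all)
  moreover have "adj U * U = 1\<^sub>m (dim_col U)"
    using Cons.prems(1) by simp
  ultimately show ?case
    unfolding hcat.simps adj_hcat2_mult_hcat2[OF U H U H] 1 2 by simp
qed (auto intro!: eq_matI)

text \<open>Once the blocks together form a unitary matrix, this equation is the equivalence of the
  action of Y with a direct sum.\<close>

lemma hcat_intertwine:
  assumes "list_all2 (\<lambda>U X. dim_row U = N \<and> X \<in> carrier_mat (dim_col U) (dim_col U) \<and> Y * U = U * X) Us Xs"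
    and "dim_col Y = N" "dim_row Y = N"
  shows "Y * hcat N Us = hcat N Us * diag_block_mat Xs"
  using assms
proof (induction Us Xs rule: list_all2_induct)
  case Nil
  then show ?case
    by (auto intro!: eq_matI)
next
  case (Cons U Us X Xs)
  let ?H = "hcat N Us" and ?k = "sum_list (map dim_col Us)"
  have "\<forall>U\<in>set Us. dim_row U = N"
    using Cons.hyps(2) by (auto simp: list_all2_conv_all_nth in_set_conv_nth)
  then have H: "?H \<in> carrier_mat N ?k"
    by (rule hcat_carrier)
  have U: "U \<in> carrier_mat N (dim_col U)"
    using Cons.hyps by auto
  have "map dim_row Xs = map dim_col Us" "map dim_col Xs = map dim_col Us"
    using Cons.hyps(2) by (auto simp: list_all2_conv_all_nth intro!: nth_equalityI)
  then have D: "diag_block_mat Xs \<in> carrier_mat ?k ?k"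
    by (auto simp: dim_diag_block_mat intro!: carrier_matI)
  have X: "X \<in> carrier_mat (dim_col U) (dim_col U)" and YU: "Y * U = U * X" "dim_row U = N"
    using Cons.hyps(1) by auto
  have DD: "diag_block_mat (X # Xs) = four_block_mat X (0\<^sub>m (dim_col U) ?k) (0\<^sub>m ?k (dim_col U)) (diag_block_mat Xs)"
    using carrier_matD[OF X] carrier_matD[OF D] by (simp add: Let_def)
  have "hcat2 U ?H * diag_block_mat (X # Xs)
      = hcat2 (U * X + ?H * 0\<^sub>m ?k (dim_col U)) (U * 0\<^sub>m (dim_col U) ?k + ?H * diag_block_mat Xs)"
    unfolding DD by (rule hcat2_mult_block[OF U H X _ _ D]) auto
  also have "\<dots> = hcat2 (Y * U) (Y * ?H)"
    unfolding Cons.IH[OF Cons.prems] YU(1)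
    using YU(2) carrier_matD[OF H] carrier_matD[OF X] carrier_matD[OF D] by simp
  also have "\<dots> = Y * hcat2 U ?H"
    using YU(2) carrier_matD[OF H] Cons.prems by (intro mult_hcat2[symmetric]) simp_all
  finally show ?case
    by simp
qed

subsection \<open>Conjugate representations and invariant bilinear forms\<close>

lemma fst_conj_rep [simp]: "fst (conj_rep R) = fst R"
  by (simp add: conj_rep_def)

lemma snd_conj_rep [simp]: "snd (conj_rep R) x = cj (snd R x)"
  by (simp add: conj_rep_def)

lemma conj_conj_rep [simp]: "conj_rep (conj_rep R) = R"
  by (simp add: conj_rep_def prod_eq_iff)

lemma is_rep_conj:
  assumes "is_rep g R"
  shows "is_rep g (conj_rep R)"
proof -
  have hom: "lie_hom g (lie_u (fst R)) (snd R)"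
    using assms by (simp add: is_rep_def)
  have d: "dim_row (snd R x) = fst R" "dim_col (snd R x) = fst R" "adj (snd R x) = - snd R x" if "x \<in> g" for x
    using is_repD[OF assms that] by auto
  show ?thesis
    unfolding is_rep_def lie_hom_def
  proof (intro conjI ballI allI)
    fix x assume x: "x \<in> g"
    show "snd (conj_rep R) x \<in> lie_u (fst (conj_rep R))"
      using d[OF x] by (auto simp: lie_u_def adj_cj)
    show "snd (conj_rep R) (complex_of_real t \<cdot>\<^sub>m x) = complex_of_real t \<cdot>\<^sub>m snd (conj_rep R) x" for t
      using hom x by (simp add: lie_hom_def)
    fix y assume y: "y \<in> g"
    show "snd (conj_rep R) (x + y) = snd (conj_rep R) x + snd (conj_rep R) y"
      using hom x y d by (simp add: lie_hom_def)
    show "snd (conj_rep R) (lie_bracket x y) = lie_bracket (snd (conj_rep R) x) (snd (conj_rep R) y)"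
      using hom x y d by (simp add: lie_hom_def) (simp add: lie_bracket_def)
  qed
qed

lemma intw_conj:
  assumes R: "is_rep g R" and R': "is_rep g R'" and B: "B \<in> intw g R R'"
  shows "cj B \<in> intw g (conj_rep R) (conj_rep R')"
proof -
  have "cj (snd R' x) * cj B = cj B * cj (snd R x)" if x: "x \<in> g" for x
  proof -
    have "cj (snd R' x * B) = cj (B * snd R x)"
      using intwD[OF B x] by simp
    then show ?thesis
      using is_repD[OF R x] is_repD[OF R' x] intw_dim[OF B] by simp
  qed
  then show ?thesis
    using intw_dim[OF B] by (auto simp: intw_def)
qed

definition vec_of :: "nat \<Rightarrow> complex mat \<Rightarrow> complex vec" where
  "vec_of d Y = vec (d * d) (\<lambda>c. Y $$ (c div d, c mod d))"

text \<open>With tensors written as matrices, x with image r acts on the tensor square by Y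
  \<mapsto> r Y + Y r', where r' is the transpose of r, equal to \<open>- cj r\<close> because r is
  anti-Hermitian. Invariant tensors are thus the intertwiners from the conjugate representation to
  R.\<close>

lemma tensor_square_vec_of:
  assumes "is_rep g R" "x \<in> g" "Y \<in> carrier_mat d d" "d = fst R"
  shows "snd (tensor_square R) x *\<^sub>v vec_of d Y = vec_of d (snd R x * Y - Y * cj (snd R x))"
proof (rule eq_vecI)
  define r where "r = snd R x"
  have r: "r \<in> carrier_mat d d" "adj r = - r"
    using is_repD[OF assms(1,2)] assms(4) by (auto simp: r_def)
  have rt: "r $$ (i, j) = - cnj (r $$ (j, i))" if "i < d" "j < d" for i j
    using arg_cong[OF r(2), of "\<lambda>X. X $$ (i, j)"] that r(1) by simp
  fix c assume "c < dim_vec (vec_of d (snd R x * Y - Y * cj (snd R x)))"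
  then have c: "c < d * d"
    by (simp add: vec_of_def)
  note cc = div_mod_less[OF c]
  have "(snd (tensor_square R) x *\<^sub>v vec_of d Y) $ c =
    (\<Sum>k<d * d. (\<lambda>a b. (r $$ (c div d, a) * 1\<^sub>m d $$ (c mod d, b) + 1\<^sub>m d $$ (c div d, a) * r $$ (c mod d, b))
      * Y $$ (a, b)) (k div d) (k mod d))"
    using c r assms
    by (auto simp: tensor_square_def ext_tensor_def vec_of_def scalar_prod_def atLeast0LessThan r_def[symmetric]
        div_mod_less intro!: sum.cong)
  also have "\<dots> = (\<Sum>a<d. \<Sum>b<d. (r $$ (c div d, a) * 1\<^sub>m d $$ (c mod d, b)
      + 1\<^sub>m d $$ (c div d, a) * r $$ (c mod d, b)) * Y $$ (a, b))"
    by (rule sum_div_mod)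
  also have "\<dots> = (\<Sum>a<d. \<Sum>b<d. (if b = c mod d then r $$ (c div d, a) * Y $$ (a, b) else 0)) +
     (\<Sum>a<d. \<Sum>b<d. (if a = c div d then r $$ (c mod d, b) * Y $$ (a, b) else 0))"
    unfolding sum.distrib[symmetric] by (intro sum.cong refl) (use cc in \<open>auto simp: algebra_simps\<close>)
  also have "(\<Sum>a<d. \<Sum>b<d. (if b = c mod d then r $$ (c div d, a) * Y $$ (a, b) else 0))
      = (\<Sum>a<d. r $$ (c div d, a) * Y $$ (a, c mod d))"
    using cc by simp
  also have "(\<Sum>a<d. \<Sum>b<d. (if a = c div d then r $$ (c mod d, b) * Y $$ (a, b) else 0))
      = (\<Sum>b<d. r $$ (c mod d, b) * Y $$ (c div d, b))"
    by (subst sum.swap) (use cc in simp)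
  also have "(\<Sum>b<d. r $$ (c mod d, b) * Y $$ (c div d, b)) = (\<Sum>b<d. - (Y $$ (c div d, b) * cnj (r $$ (b, c mod d))))"
    by (intro sum.cong refl, subst rt) (use cc in auto)
  also have "(\<Sum>a<d. r $$ (c div d, a) * Y $$ (a, c mod d)) + \<dots> = (r * Y - Y * cj r) $$ (c div d, c mod d)"
    using cc r assms by (simp add: scalar_prod_def atLeast0LessThan sum_negf)
  finally show "(snd (tensor_square R) x *\<^sub>v vec_of d Y) $ c = vec_of d (snd R x * Y - Y * cj (snd R x)) $ c"
    using c by (simp add: vec_of_def r_def)
qed (use assms is_repD[OF assms(1,2)] in \<open>auto simp: tensor_square_def ext_tensor_def vec_of_def\<close>)

lemma vec_of_eq_0_iff:
  assumes "Y \<in> carrier_mat d d"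
  shows "vec_of d Y = 0\<^sub>v (d * d) \<longleftrightarrow> Y = 0\<^sub>m d d"
proof
  assume *: "vec_of d Y = 0\<^sub>v (d * d)"
  show "Y = 0\<^sub>m d d"
  proof (rule eq_matI)
    fix i j assume ij: "i < dim_row (0\<^sub>m d d :: complex mat)" "j < dim_col (0\<^sub>m d d :: complex mat)"
    then have "i * d + j < d * d"
      by (auto intro: mult_add_less)
    then show "Y $$ (i, j) = 0\<^sub>m d d $$ (i, j)"
      using arg_cong[OF *, of "\<lambda>v. v $ (i * d + j)"] ij by (simp add: vec_of_def)
  qed (use assms in auto)
qed (auto simp: vec_of_def div_mod_less intro!: eq_vecI)

text \<open>The factor z treats \<open>Sym2\<close> (z = 1) and \<open>Wedge2\<close> (z = -1)
  together.\<close>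

lemma contains_trivial_iff:
  assumes "is_rep g R" "d = fst R"
  shows "contains_trivial g (tensor_square R) {v \<in> carrier_vec (d * d). \<forall>i<d. \<forall>j<d. v $ (i * d + j) = z * v $ (j * d + i)}
    \<longleftrightarrow> (\<exists>Y \<in> intw g (conj_rep R) R. Y \<noteq> 0\<^sub>m d d \<and> Y = z \<cdot>\<^sub>m transpose_mat Y)" (is "?L \<longleftrightarrow> ?R")
proof -
  have fst: "fst (tensor_square R) = d * d"
    using assms by (simp add: tensor_square_def)
  have key: "(\<forall>x\<in>g. snd (tensor_square R) x *\<^sub>v vec_of d Y = 0\<^sub>v (d * d)) \<longleftrightarrow> Y \<in> intw g (conj_rep R) R"
    if Y: "Y \<in> carrier_mat d d" for Y
  proof -
    have "snd (tensor_square R) x *\<^sub>v vec_of d Y = 0\<^sub>v (d * d) \<longleftrightarrow> snd R x * Y = Y * cj (snd R x)" if x: "x \<in> g" for x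
    proof -
      note r = is_repD[OF assms(1) x, folded assms(2)]
      have "snd R x * Y - Y * cj (snd R x) = 0\<^sub>m d d \<longleftrightarrow> snd R x * Y = Y * cj (snd R x)"
        by (rule mat_diff_eq_0_iff) (use r Y in auto)
      moreover have "snd R x * Y - Y * cj (snd R x) \<in> carrier_mat d d"
        using r Y by (auto intro!: carrier_matI)
      ultimately show ?thesis
        unfolding tensor_square_vec_of[OF assms(1) x Y assms(2)] by (simp add: vec_of_eq_0_iff)
    qed
    then show ?thesis
      using Y assms(2) by (auto simp: intw_def)
  qed
  have sym: "(\<forall>i<d. \<forall>j<d. vec_of d Y $ (i * d + j) = z * vec_of d Y $ (j * d + i)) \<longleftrightarrow> Y = z \<cdot>\<^sub>m transpose_mat Y"
    if Y: "Y \<in> carrier_mat d d" for Y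
  proof
    assume *: "\<forall>i<d. \<forall>j<d. vec_of d Y $ (i * d + j) = z * vec_of d Y $ (j * d + i)"
    show "Y = z \<cdot>\<^sub>m transpose_mat Y"
    proof (rule eq_matI)
      fix i j assume "i < dim_row (z \<cdot>\<^sub>m transpose_mat Y)" "j < dim_col (z \<cdot>\<^sub>m transpose_mat Y)"
      then have ij: "i < d" "j < d"
        using Y by auto
      then have "i * d + j < d * d" "j * d + i < d * d"
        by (auto intro: mult_add_less)
      then show "Y $$ (i, j) = (z \<cdot>\<^sub>m transpose_mat Y) $$ (i, j)"
        using *[rule_format, OF ij] ij Y by (simp add: vec_of_def)
    qed (use Y in auto)
  next
    assume *: "Y = z \<cdot>\<^sub>m transpose_mat Y"
    show "\<forall>i<d. \<forall>j<d. vec_of d Y $ (i * d + j) = z * vec_of d Y $ (j * d + i)"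
    proof (intro allI impI)
      fix i j assume ij: "i < d" "j < d"
      then have "i * d + j < d * d" "j * d + i < d * d"
        by (auto intro: mult_add_less)
      then show "vec_of d Y $ (i * d + j) = z * vec_of d Y $ (j * d + i)"
        using arg_cong[OF *, of "\<lambda>X. X $$ (i, j)"] ij Y by (simp add: vec_of_def)
    qed
  qed
  show ?thesis
  proof
    assume ?L
    then obtain v where v: "v \<in> carrier_vec (d * d)" "\<forall>i<d. \<forall>j<d. v $ (i * d + j) = z * v $ (j * d + i)"
      "v \<noteq> 0\<^sub>v (d * d)" "\<forall>x\<in>g. snd (tensor_square R) x *\<^sub>v v = 0\<^sub>v (d * d)"
      by (auto simp: contains_trivial_def fst)
    define Y where "Y = mat d d (\<lambda>(i, j). v $ (i * d + j))"
    have Y: "Y \<in> carrier_mat d d"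
      by (simp add: Y_def)
    have vY: "vec_of d Y = v"
      using v(1) by (auto simp: vec_of_def Y_def div_mod_less intro!: eq_vecI)
    show ?R
      using v key[OF Y] sym[OF Y] vec_of_eq_0_iff[OF Y] unfolding vY by blast
  next
    assume ?R
    then obtain Y where Y: "Y \<in> intw g (conj_rep R) R" "Y \<noteq> 0\<^sub>m d d" "Y = z \<cdot>\<^sub>m transpose_mat Y"
      by blast
    have Yc: "Y \<in> carrier_mat d d"
      using intw_dim[OF Y(1)] assms(2) by auto
    have "vec_of d Y \<in> carrier_vec (d * d)"
      by (simp add: vec_of_def)
    then show ?L
      using Y key[OF Yc] sym[OF Yc] vec_of_eq_0_iff[OF Yc] unfolding contains_trivial_def fst by blast
  qed
qed

lemma real_irrep_iff:
  assumes "irreducible_rep g R"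
  shows "real_irrep g R \<longleftrightarrow>
    (\<exists>Y \<in> intw g (conj_rep R) R. Y \<noteq> 0\<^sub>m (fst R) (fst R) \<and> Y = transpose_mat Y)"
  using contains_trivial_iff[of g R "fst R" 1] assms
  by (simp add: real_irrep_def Sym2_def irreducible_rep_def)

lemma pseudoreal_irrep_iff:
  assumes "irreducible_rep g R"
  shows "pseudoreal_irrep g R \<longleftrightarrow>
    (\<exists>Y \<in> intw g (conj_rep R) R. Y \<noteq> 0\<^sub>m (fst R) (fst R) \<and> Y = - transpose_mat Y)"
  using contains_trivial_iff[of g R "fst R" "- 1"] assms
  by (simp add: pseudoreal_irrep_def Wedge2_def irreducible_rep_def smult_minus_one)

text \<open>A (skew-)symmetric invariant form, normalised by Schur's lemma to a unitary intertwiner from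
  a representation to its conjugate.\<close>

lemma unitary_structure:
  assumes irr: "irreducible_rep g R" and Y: "Y \<in> intw g (conj_rep R) R" "Y \<noteq> 0\<^sub>m (fst R) (fst R)"
    and sym: "Y = complex_of_real e \<cdot>\<^sub>m transpose_mat Y"
  shows "\<exists>S \<in> intw g R (conj_rep R). adj S * S = 1\<^sub>m (fst R) \<and> S * adj S = 1\<^sub>m (fst R) \<and>
    cj S * S = complex_of_real e \<cdot>\<^sub>m 1\<^sub>m (fst R)"
proof -
  define d where "d = fst R"
  have rep: "is_rep g R" and d0: "d > 0"
    using irr by (auto simp: irreducible_rep_def d_def)
  note [simp] = intw_dim[OF Y(1), simplified, folded d_def]
  have aY: "adj Y \<in> intw g R (conj_rep R)"
    by (rule intw_adj[OF is_rep_conj[OF rep] rep Y(1)])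
  then have "Y * adj Y \<in> intw g R R"
    by (rule intw_mult[OF rep is_rep_conj[OF rep] rep _ Y(1)])
  then obtain z where z: "Y * adj Y = z \<cdot>\<^sub>m 1\<^sub>m d"
    using schur[OF irr] unfolding d_def by blast
  have "adj Y \<noteq> 0\<^sub>m d d"
    using Y(2) adj_adj[of Y] adj_one(2)[of d d] unfolding d_def by metis
  then obtain u where u: "adj (complex_of_real u \<cdot>\<^sub>m adj Y) * (complex_of_real u \<cdot>\<^sub>m adj Y) = 1\<^sub>m d"
    using normalise_scalar_gram[of "adj Y" z d] z d0 by auto
  define X where "X = complex_of_real u \<cdot>\<^sub>m Y"
  have Xd [simp]: "dim_row X = d" "dim_col X = d"
    by (auto simp: X_def)
  have XX: "X * adj X = 1\<^sub>m d"
    using u by (simp add: X_def)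
  have XX': "adj X * X = 1\<^sub>m d"
    using isometry_square[of "adj X" d] XX by (simp add: carrier_matI)
  have "cj Y = complex_of_real e \<cdot>\<^sub>m adj Y"
    using arg_cong[OF sym, of cj] by (simp add: transpose_eq_cj_adj)
  then have cX: "cj X = complex_of_real e \<cdot>\<^sub>m adj X"
    by (simp add: X_def mult.commute)
  \<comment> \<open>The required S is \<open>cj X\<close>. By the symmetry of Y, \<open>cj X\<close>
    is e times \<open>adj X\<close>, so \<open>cj S * S = X * cj X\<close> is e times
    \<open>X * adj X\<close>, the identity.\<close>
  have "cj X \<in> intw g R (conj_rep R)"
  proof -
    have "cj Y \<in> intw g R (conj_rep R)"
      using intw_conj[OF is_rep_conj[OF rep] rep Y(1)] by simp
    then show ?thesis
      using is_repD[OF rep, folded d_def] by (auto simp: intw_def X_def mat_scal)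
  qed
  moreover have "adj (cj X) * cj X = 1\<^sub>m d"
    using arg_cong[OF XX', of cj] by (simp add: adj_cj)
  moreover have "cj X * adj (cj X) = 1\<^sub>m d"
    using arg_cong[OF XX, of cj] by (simp add: adj_cj)
  moreover have "cj (cj X) * cj X = complex_of_real e \<cdot>\<^sub>m 1\<^sub>m d"
    by simp (simp add: cX mat_scal XX)
  ultimately show ?thesis
    unfolding d_def by blast
qed

lemma real_structure:
  assumes "real_irrep g R"
  shows "\<exists>S \<in> intw g R (conj_rep R). adj S * S = 1\<^sub>m (fst R) \<and> S * adj S = 1\<^sub>m (fst R) \<and> cj S * S = 1\<^sub>m (fst R)"
proof -
  have irr: "irreducible_rep g R"
    using assms by (simp add: real_irrep_def)
  then show ?thesis
    using assms real_irrep_iff[OF irr] unitary_structure[OF irr, of _ 1] by auto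
qed

lemma pseudoreal_structure:
  assumes "pseudoreal_irrep g R"
  shows "\<exists>S \<in> intw g R (conj_rep R). adj S * S = 1\<^sub>m (fst R) \<and> S * adj S = 1\<^sub>m (fst R) \<and> cj S * S = - 1\<^sub>m (fst R)"
proof -
  have irr: "irreducible_rep g R"
    using assms by (simp add: pseudoreal_irrep_def)
  then show ?thesis
    using assms pseudoreal_irrep_iff[OF irr] unitary_structure[OF irr, of _ "- 1"]
    by (auto simp: smult_minus_one)
qed

text \<open>\<open>cj B\<close> and its transpose \<open>adj B\<close> are both intertwiners from
  the conjugate to R. Their sum is symmetric and their difference skew, so both vanish for an R that
  is neither real nor pseudoreal.\<close>

lemma complex_irrep_no_intw:
  assumes "complex_irrep g R" "B \<in> intw g R (conj_rep R)"
  shows "B = 0\<^sub>m (fst R) (fst R)"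
proof -
  define d where "d = fst R"
  have irr: "irreducible_rep g R" and rep: "is_rep g R"
    using assms(1) by (auto simp: complex_irrep_def irreducible_rep_def)
  have Y: "cj B \<in> intw g (conj_rep R) R"
    using intw_conj[OF rep is_rep_conj[OF rep] assms(2)] by simp
  have Z: "adj B \<in> intw g (conj_rep R) R"
    by (rule intw_adj[OF rep is_rep_conj[OF rep] assms(2)])
  note [simp] = intw_dim[OF assms(2), simplified, folded d_def]
  have eq0: "cj B + complex_of_real e \<cdot>\<^sub>m adj B = 0\<^sub>m d d" if e: "e = 1 \<or> e = - 1" for e
  proof (rule ccontr)
    assume "cj B + complex_of_real e \<cdot>\<^sub>m adj B \<noteq> 0\<^sub>m d d"
    moreover have "cj B + complex_of_real e \<cdot>\<^sub>m adj B \<in> intw g (conj_rep R) R"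
      using Y Z is_repD[OF rep] by (auto simp: intw_def mat_scal mat_distr)
    moreover have "cj B + complex_of_real e \<cdot>\<^sub>m adj B
      = complex_of_real e \<cdot>\<^sub>m transpose_mat (cj B + complex_of_real e \<cdot>\<^sub>m adj B)"
      using e by (intro eq_matI) auto
    ultimately show False
      using e assms(1) real_irrep_iff[OF irr] pseudoreal_irrep_iff[OF irr] unfolding complex_irrep_def d_def
      by (auto simp: smult_minus_one)
  qed
  have "cnj (B $$ (i, j)) = 0" if "i < d" "j < d" for i j
    using that arg_cong[OF eq0[of 1], of "\<lambda>X. X $$ (i, j)"] arg_cong[OF eq0[of "- 1"], of "\<lambda>X. X $$ (i, j)"]
    by simp
  then show ?thesis
    unfolding d_def[symmetric] by (intro eq_matI) auto
qed

lemma diag_block_mat_pair: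
  "diag_block_mat [A, B] =
    four_block_mat A (0\<^sub>m (dim_row A) (dim_col B)) (0\<^sub>m (dim_row B) (dim_col A)) B"
  by (subst diag_block_mat.simps(2)) (simp only: Let_def diag_block_mat_singleton)

subsection \<open>Multiplicity spaces\<close>

text \<open>The quaternionic structure is the antilinear map v \<mapsto> J cnj v. Since J is real
  with square -1, this map has square -1; \<open>gJ\<close> says that it commutes with g, and
  \<open>adj J = - J\<close> makes J unitary.\<close>

locale quaternionic =
  fixes N :: nat and g :: "complex mat set" and J :: "complex mat"
  assumes g: "g \<subseteq> lie_u N"
    and J: "J \<in> carrier_mat N N" "cj J = J" "adj J = - J" "J * J = - 1\<^sub>m N"
    and gJ: "x \<in> g \<Longrightarrow> x * J = J * cj x"
begin

lemma J_dim [simp]: "dim_row J = N" "dim_col J = N"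
  using J by auto

lemma g_dim: "x \<in> g \<Longrightarrow> dim_row x = N" "x \<in> g \<Longrightarrow> dim_col x = N" "x \<in> g \<Longrightarrow> adj x = - x"
  using g by (auto simp: lie_u_def)

lemma adj_J_mult [simp]: "dim_row A = N \<Longrightarrow> adj J * (J * A) = A" "dim_row A = N \<Longrightarrow> J * (adj J * A) = A"
proof -
  have "adj J * J = 1\<^sub>m N" "J * adj J = 1\<^sub>m N"
    using J by (simp_all add: mat_scal)
  then show "dim_row A = N \<Longrightarrow> adj J * (J * A) = A" "dim_row A = N \<Longrightarrow> J * (adj J * A) = A"
    by (auto intro: cancel_left)
qed

lemma J_J_mult: "dim_row A = N \<Longrightarrow> J * (J * A) = - A"
  using J(4) mat_assoc[of J J A] by (simp add: mat_scal)

definition V :: "complex mat rep" where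
  "V = (N, \<lambda>x. x)"

lemma V_simps [simp]: "fst V = N" "snd V x = x"
  by (auto simp: V_def)

lemma is_rep_V: "is_rep g V"
  using g by (auto simp: is_rep_def lie_hom_def)

abbreviation M :: "complex mat rep \<Rightarrow> complex mat set" where
  "M R \<equiv> intw g R V"

text \<open>The commutant in the symplectic algebra, with the symplectic condition written as
  commutation with the quaternionic structure.\<close>

definition comm :: "complex mat set" where
  "comm = {c \<in> lie_u N. c * J = J * cj c \<and> (\<forall>x\<in>g. c * x = x * c)}"

lemma comm_dim: "c \<in> comm \<Longrightarrow> dim_row c = N" "c \<in> comm \<Longrightarrow> dim_col c = N" "c \<in> comm \<Longrightarrow> c \<in> carrier_mat N N"
    "c \<in> comm \<Longrightarrow> adj c = - c"
  by (auto simp: comm_def lie_u_def)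

lemma comm_g: "c \<in> comm \<Longrightarrow> x \<in> g \<Longrightarrow> c * x = x * c"
  unfolding comm_def by blast

lemma M_dim: "A \<in> M R \<Longrightarrow> dim_row A = N" "A \<in> M R \<Longrightarrow> dim_col A = fst R" "A \<in> M R \<Longrightarrow> A \<in> carrier_mat N (fst R)"
  by (auto simp: intw_def)

text \<open>The quaternionic structure commutes with g but is antilinear, so it carries copies of R
  to copies of the conjugate of R.\<close>

lemma J_cj_M:
  assumes "is_rep g R" "A \<in> M R"
  shows "J * cj A \<in> M (conj_rep R)"
proof -
  note [simp] = M_dim(1,2)[OF assms(2)]
  have "x * (J * cj A) = J * cj A * cj (snd R x)" if x: "x \<in> g" for x
  proof -
    note [simp] = g_dim[OF x] is_repD(3,4)[OF assms(1) x]
    have "x * (J * cj A) = x * J * cj A"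
      by (simp add: mat_assoc)
    also have "\<dots> = J * cj (x * A)"
      using gJ[OF x] by (simp add: mat_assoc)
    also have "\<dots> = J * cj A * cj (snd R x)"
      using intwD[OF assms(2) x] by (simp add: mat_assoc)
    finally show ?thesis .
  qed
  then show ?thesis
    by (auto simp: intw_def)
qed

lemma J_cj_J_cj: "dim_row A = N \<Longrightarrow> J * cj (J * cj A) = - A"
  by (simp add: J J_J_mult)

lemma adj_J_cj_mult:
  assumes "dim_row A = N" "dim_row B = N"
  shows "adj (J * cj A) * (J * cj B) = cj (adj A * B)"
  using assms by (simp add: mat_assoc adj_cj)

lemma M_add: "is_rep g R \<Longrightarrow> A \<in> M R \<Longrightarrow> B \<in> M R \<Longrightarrow> A + B \<in> M R"
  using is_repD(3,4)[of g R] g_dim by (auto simp: intw_def mat_distr)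

lemma M_smult: "is_rep g R \<Longrightarrow> A \<in> M R \<Longrightarrow> z \<cdot>\<^sub>m A \<in> M R"
  using is_repD(3,4)[of g R] g_dim by (auto simp: intw_def mat_scal)

lemma M_zero: "is_rep g R \<Longrightarrow> 0\<^sub>m N (fst R) \<in> M R"
  using is_repD(3,4)[of g R] g_dim by (auto simp: intw_def)

lemma M_mult: "is_rep g R \<Longrightarrow> is_rep g R' \<Longrightarrow> A \<in> M R' \<Longrightarrow> B \<in> intw g R R' \<Longrightarrow> A * B \<in> M R"
  using intw_mult[OF _ _ is_rep_V] by auto

lemma adj_M_mult_M: "is_rep g R \<Longrightarrow> is_rep g R' \<Longrightarrow> A \<in> M R' \<Longrightarrow> B \<in> M R \<Longrightarrow> adj A * B \<in> intw g R R'"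
  using intw_mult[OF _ is_rep_V] intw_adj[OF _ is_rep_V] by blast

lemma adj_M_mult_scalar:
  assumes "irreducible_rep g R" "A \<in> M R" "B \<in> M R"
  shows "\<exists>z. adj A * B = z \<cdot>\<^sub>m 1\<^sub>m (fst R)"
proof -
  have "is_rep g R"
    using assms(1) by (simp add: irreducible_rep_def)
  then show ?thesis
    using schur[OF assms(1)] adj_M_mult_M assms(2,3) by blast
qed

lemma comm_mult_M:
  assumes c: "c \<in> carrier_mat N N" "\<And>x. x \<in> g \<Longrightarrow> c * x = x * c" and A: "A \<in> M R" and R: "is_rep g R"
  shows "c * A \<in> M R"
proof -
  note [simp] = M_dim(1,2)[OF A] carrier_matD[OF c(1)]
  have "x * (c * A) = c * A * snd R x" if x: "x \<in> g" for x
  proof -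
    note [simp] = g_dim[OF x] is_repD(3,4)[OF R x]
    have "x * (c * A) = c * x * A"
      using c(2)[OF x] by (simp add: mat_assoc)
    also have "\<dots> = c * A * snd R x"
      using intwD[OF A x] by (simp add: mat_assoc)
    finally show ?thesis .
  qed
  then show ?thesis
    by (auto simp: intw_def)
qed

text \<open>\<open>block R H f D U\<close>: the columns of \<open>U\<close> are an orthonormal basis of the sum of the isotypic
  components of \<open>R\<close> and its conjugate, on which the algebra and its commutant act by \<open>D\<close>, and \<open>f\<close>
  identifies the restriction of the commutant to that sum with \<open>H\<close>.\<close>

definition block :: "complex mat rep \<Rightarrow> complex mat set \<Rightarrow> (complex mat \<Rightarrow> complex mat)
    \<Rightarrow> (complex mat \<times> complex mat) rep \<Rightarrow> complex mat \<Rightarrow> bool" where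
  "block R H f D U \<longleftrightarrow>
    U \<in> carrier_mat N (fst D) \<and> adj U * U = 1\<^sub>m (fst D) \<and>
    (\<forall>x\<in>g. \<forall>c\<in>comm. snd D (x, c) \<in> carrier_mat (fst D) (fst D) \<and> (x + c) * U = U * snd D (x, c)) \<and>
    lie_hom comm H f \<and>
    (\<forall>c\<in>comm. \<forall>c'\<in>comm. f c = f c' \<longleftrightarrow> c * U = c' * U) \<and>
    (\<forall>y\<in>H. \<exists>c\<in>comm. f c = y \<and> U * (adj U * c) = c) \<and>
    (\<forall>A\<in>M R \<union> M (conj_rep R). U * (adj U * A) = A) \<and>
    (\<forall>e. \<forall>B\<in>carrier_mat N e.
      (\<forall>A\<in>M R \<union> M (conj_rep R). adj A * B = 0\<^sub>m (fst R) e) \<longrightarrow> adj U * B = 0\<^sub>m (fst D) e)"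

end

section \<open>The action of the algebra and its commutant on one isotypic component\<close>

locale isotypic = quaternionic +
  fixes R :: "complex mat rep" and m :: nat and A :: "nat \<Rightarrow> complex mat"
  assumes irr: "irreducible_rep g R"
    and AM: "b < m \<Longrightarrow> A b \<in> M R"
    and on: "orthonormal (fst R) m A"
    and full: "B \<in> M R \<Longrightarrow> msum N N (\<lambda>b. A b * adj (A b)) m * B = B"
begin

abbreviation d :: nat where "d \<equiv> fst R"

lemma d_pos: "d > 0" and rep: "is_rep g R"
  using irr by (auto simp: irreducible_rep_def)

text \<open>The isometric embedding of the tensor product of representation space and multiplicity
  space onto the isotypic component of R in V.\<close>

definition T :: "complex mat" where
  "T = cols_of N d m A"

lemma A_carrier: "b < m \<Longrightarrow> A b \<in> carrier_mat N d"
  using AM M_dim by blast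

lemma T_dim [simp]: "dim_row T = N" "dim_col T = d * m"
  by (auto simp: T_def)

lemma T_iso: "adj T * T = 1\<^sub>m (d * m)"
  unfolding T_def by (rule cols_of_isometry[OF A_carrier on])

lemma T_cancel: "T * X = T * Y \<Longrightarrow> dim_row X = d * m \<Longrightarrow> dim_row Y = d * m \<Longrightarrow> X = Y"
proof -
  assume *: "T * X = T * Y" "dim_row X = d * m" "dim_row Y = d * m"
  then have "adj T * (T * X) = adj T * (T * Y)"
    by simp
  then show ?thesis
    using *(2,3) by (simp add: cancel_left[OF T_iso])
qed

lemma T_full:
  assumes "B \<in> M R"
  shows "T * (adj T * B) = B"
proof -
  have "T * adj T = msum N N (\<lambda>b. A b * adj (A b)) m"
    unfolding T_def by (rule cols_of_mult_adj[OF A_carrier A_carrier])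
  then have "T * adj T * B = B"
    using full[OF assms] by simp
  then show ?thesis
    using M_dim(1)[OF assms] by (simp add: mat_assoc)
qed

lemma g_mult_T:
  assumes "x \<in> g"
  shows "x * T = T * kronecker (snd R x) (1\<^sub>m m)"
proof -
  have "x * T = cols_of N d m (\<lambda>b. x * A b)"
    unfolding T_def using mult_cols_of[OF A_carrier, where Y = x] g_dim[OF assms] by simp
  also have "\<dots> = cols_of N d m (\<lambda>b. A b * snd R x)"
    by (rule cols_of_cong) (use intwD[OF AM] assms in auto)
  also have "\<dots> = T * kronecker (snd R x) (1\<^sub>m m)"
    unfolding T_def by (rule cols_of_mult_kronecker_left[OF A_carrier is_repD(1)[OF rep assms], symmetric])
  finally show ?thesis .
qed

lemma adj_T_mult_g:
  assumes "x \<in> g"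
  shows "adj T * x = kronecker (snd R x) (1\<^sub>m m) * adj T"
proof -
  note [simp] = g_dim[OF assms] is_repD(2-4)[OF rep assms]
  have "kronecker (- snd R x) (1\<^sub>m m) = - kronecker (snd R x) (1\<^sub>m m)"
    by (rule eq_matI) (auto simp: div_mod_less)
  moreover have "adj (x * T) = adj (T * kronecker (snd R x) (1\<^sub>m m))"
    using g_mult_T[OF assms] by simp
  ultimately show ?thesis
    by (simp add: mat_scal minus_mat_eq_iff)
qed

text \<open>For c commuting with g, \<open>adj T * (c * T)\<close> will turn out to be the Kronecker
  product of an identity with an m x m matrix; this is its top left block.\<close>

definition mul :: "complex mat \<Rightarrow> complex mat" where
  "mul c = mat m m (\<lambda>(a, b). (adj T * (c * T)) $$ (a, b))"

lemma mul_dim [simp]: "dim_row (mul c) = m" "dim_col (mul c) = m" "mul c \<in> carrier_mat m m"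
  by (auto simp: mul_def)

text \<open>Composition with c maps \<open>M R\<close> to itself, so by Schur's lemma each
  \<open>adj (A a) * (c * A b)\<close> is a scalar, the entry of \<open>mul c\<close> at (a, b). By
  fullness \<open>T * adj T\<close> fixes every \<open>c * A b\<close>, which turns the first
  equation into the second.\<close>

lemma mult_T:
  assumes c: "c \<in> carrier_mat N N" "\<And>x. x \<in> g \<Longrightarrow> c * x = x * c"
  shows "adj T * (c * T) = kronecker (1\<^sub>m d) (mul c)" "c * T = T * kronecker (1\<^sub>m d) (mul c)"
proof -
  note [simp] = carrier_matD[OF c(1)]
  have cA: "c * A b \<in> M R" if "b < m" for b
    using comm_mult_M[OF c AM[OF that] rep] .
  have cT: "c * T = cols_of N d m (\<lambda>b. c * A b)"
    unfolding T_def by (subst mult_cols_of[OF A_carrier]) auto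
  have "\<exists>z. adj (A a) * (c * A b) = z \<cdot>\<^sub>m 1\<^sub>m d" if "a < m" "b < m" for a b
    using adj_M_mult_scalar[OF irr AM cA] that .
  then obtain z where z: "\<And>a b. a < m \<Longrightarrow> b < m \<Longrightarrow> adj (A a) * (c * A b) = z a b \<cdot>\<^sub>m 1\<^sub>m d"
    by metis
  have entry: "(adj T * (c * T)) $$ (i, j) = (if i div m = j div m then z (i mod m) (j mod m) else 0)"
    if ij: "i < d * m" "j < d * m" for i j
  proof -
    note ii = div_mod_less[OF ij(1)] and jj = div_mod_less[OF ij(2)]
    have "(adj T * (c * T)) $$ (i, j) = (adj (A (i mod m)) * (c * T)) $$ (i div m, j)"
      unfolding T_def by (rule adj_cols_of_index[OF A_carrier _ ij]) (auto intro!: carrier_matI)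
    also have "adj (A (i mod m)) * (c * T) = cols_of d d m (\<lambda>b. adj (A (i mod m)) * (c * A b))"
      unfolding cT using mult_cols_of[OF M_dim(3)[OF cA], where Y = "adj (A (i mod m))"] A_carrier[OF ii(2)] by simp
    also have "\<dots> $$ (i div m, j) = (z (i mod m) (j mod m) \<cdot>\<^sub>m 1\<^sub>m d) $$ (i div m, j div m)"
      using ii jj ij by (simp add: index_cols_of z)
    finally show ?thesis
      using ii jj by simp
  qed
  have mz: "mul c $$ (a, b) = z a b" if "a < m" "b < m" for a b
    using that entry[of a b] d_pos by (simp add: mul_def less_le_trans)
  show 1: "adj T * (c * T) = kronecker (1\<^sub>m d) (mul c)"
  proof (rule eq_matI)
    fix i j assume "i < dim_row (kronecker (1\<^sub>m d) (mul c))" "j < dim_col (kronecker (1\<^sub>m d) (mul c))"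
    then have ij: "i < d * m" "j < d * m"
      by auto
    then show "(adj T * (c * T)) $$ (i, j) = kronecker (1\<^sub>m d) (mul c) $$ (i, j)"
      using div_mod_less[OF ij(1)] div_mod_less[OF ij(2)] by (simp add: entry mz del: index_mult_mat(1))
  qed auto
  have "T * (adj T * (c * T)) = T * adj T * (c * T)"
    by (rule mat_assoc[symmetric]) simp_all
  also have "\<dots> = cols_of N d m (\<lambda>b. T * adj T * (c * A b))"
    unfolding cT using mult_cols_of[OF M_dim(3)[OF cA], where Y = "T * adj T"] by simp
  also have "\<dots> = c * T"
    unfolding cT
  proof (rule cols_of_cong)
    fix b assume b: "b < m"
    have "T * adj T * (c * A b) = T * (adj T * (c * A b))"
      by (rule mat_assoc) (simp_all add: M_dim(1)[OF AM[OF b]])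
    then show "T * adj T * (c * A b) = c * A b"
      by (simp only: T_full[OF cA[OF b]])
  qed
  finally show "c * T = T * kronecker (1\<^sub>m d) (mul c)"
    by (simp add: 1)
qed

text \<open>T and the Kronecker product with an identity can both be cancelled, so the equation
  determines \<open>mul c\<close>. The homomorphism laws of \<open>mul\<close> are obtained in this
  way.\<close>

lemma mul_eqI:
  assumes "c \<in> carrier_mat N N" "\<And>x. x \<in> g \<Longrightarrow> c * x = x * c" "X \<in> carrier_mat m m"
    and "c * T = T * kronecker (1\<^sub>m d) X"
  shows "mul c = X"
proof -
  have "kronecker (1\<^sub>m d) (mul c) = kronecker (1\<^sub>m d) X"
    by (rule T_cancel) (use mult_T(2)[OF assms(1,2)] assms(3,4) in simp_all)
  then show ?thesis
    using kronecker_one_inj d_pos by blast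
qed

lemma comm_mult_T: "c \<in> comm \<Longrightarrow> c * T = T * kronecker (1\<^sub>m d) (mul c)"
  by (rule mult_T(2)[OF comm_dim(3) comm_g])

lemma mul_eq_iff:
  assumes "c \<in> comm" "c' \<in> comm"
  shows "mul c = mul c' \<longleftrightarrow> c * T = c' * T"
proof
  show "c * T = c' * T" if "mul c = mul c'"
    using that comm_mult_T[OF assms(1)] comm_mult_T[OF assms(2)] by simp
  show "mul c = mul c'" if "c * T = c' * T"
    unfolding mul_def that ..
qed

lemma mul_hom: "lie_hom comm (lie_u m) mul"
  unfolding lie_hom_def
proof (intro conjI ballI allI)
  fix c assume c: "c \<in> comm"
  note [simp] = comm_dim[OF c]
  have com: "c * x = x * c" if "x \<in> g" for x
    using comm_g[OF c that] .
  have "kronecker (1\<^sub>m d) (adj (mul c)) = adj (adj T * (c * T))"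
    by (simp add: mult_T(1) com)
  also have "\<dots> = - (adj T * (c * T))"
    by (simp add: mat_assoc mat_scal)
  also have "\<dots> = - kronecker (1\<^sub>m d) (mul c)"
    by (simp add: mult_T(1) com)
  also have "\<dots> = kronecker (1\<^sub>m d) (- mul c)"
    using kronecker_one_smult[of d "- 1" "mul c"] by (simp add: smult_minus_one)
  finally have "adj (mul c) = - mul c"
    by (rule kronecker_one_inj) (rule d_pos)
  then show "mul c \<in> lie_u m"
    by (simp add: lie_u_def)
  show "mul (complex_of_real t \<cdot>\<^sub>m c) = complex_of_real t \<cdot>\<^sub>m mul c" for t
  proof (rule mul_eqI)
    show "complex_of_real t \<cdot>\<^sub>m c * x = x * (complex_of_real t \<cdot>\<^sub>m c)" if "x \<in> g" for x
      using com[OF that] g_dim[OF that] by (simp add: mat_scal)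
    show "complex_of_real t \<cdot>\<^sub>m c * T = T * kronecker (1\<^sub>m d) (complex_of_real t \<cdot>\<^sub>m mul c)"
      by (simp add: mat_scal kronecker_one_smult comm_mult_T[OF c])
  qed auto
  fix c' assume c': "c' \<in> comm"
  note [simp] = comm_dim[OF c']
  have com': "c' * x = x * c'" if "x \<in> g" for x
    using comm_g[OF c' that] .
  show "mul (c + c') = mul c + mul c'"
  proof (rule mul_eqI)
    show "(c + c') * x = x * (c + c')" if "x \<in> g" for x
      using com[OF that] com'[OF that] g_dim[OF that] by (simp add: mat_distr)
    show "(c + c') * T = T * kronecker (1\<^sub>m d) (mul c + mul c')"
      by (simp add: mat_distr kronecker_one_add comm_mult_T[OF c] comm_mult_T[OF c'])
  qed auto
  have mult: "c * c' * T = T * kronecker (1\<^sub>m d) (mul c * mul c')" if c: "c \<in> comm" and c': "c' \<in> comm" for c c'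
  proof -
    note [simp] = comm_dim[OF c] comm_dim[OF c']
    have "c * c' * T = c * T * kronecker (1\<^sub>m d) (mul c')"
      by (simp add: mat_assoc comm_mult_T[OF c'])
    also have "\<dots> = T * (kronecker (1\<^sub>m d) (mul c) * kronecker (1\<^sub>m d) (mul c'))"
      by (simp add: mat_assoc comm_mult_T[OF c])
    finally show ?thesis
      by (simp add: kronecker_mult)
  qed
  show "mul (lie_bracket c c') = lie_bracket (mul c) (mul c')"
  proof (rule mul_eqI)
    show "lie_bracket c c' \<in> carrier_mat N N" "lie_bracket (mul c) (mul c') \<in> carrier_mat m m"
      by (auto simp: lie_bracket_def intro!: carrier_matI)
    have 1: "c * c' * x = x * (c * c')" if c: "c \<in> comm" and c': "c' \<in> comm" and x: "x \<in> g" for c c' x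
    proof -
      note [simp] = comm_dim[OF c] comm_dim[OF c'] g_dim[OF x]
      have "c * c' * x = c * (c' * x)"
        by (simp add: mat_assoc)
      also have "c' * x = x * c'"
        by (rule comm_g[OF c' x])
      also have "c * (x * c') = c * x * c'"
        by (simp add: mat_assoc)
      also have "c * x = x * c"
        by (rule comm_g[OF c x])
      finally show ?thesis
        by (simp add: mat_assoc)
    qed
    show "lie_bracket c c' * x = x * lie_bracket c c'" if "x \<in> g" for x
      using 1[OF c c' that] 1[OF c' c that] g_dim[OF that] by (simp add: lie_bracket_def mat_distr)
    have "kronecker (1\<^sub>m d) (mul c * mul c' - mul c' * mul c)
        = kronecker (1\<^sub>m d) (mul c * mul c') - kronecker (1\<^sub>m d) (mul c' * mul c)"
      by (rule eq_matI) (auto simp: div_mod_less algebra_simps simp del: index_mult_mat(1))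
    then show "lie_bracket c c' * T = T * kronecker (1\<^sub>m d) (lie_bracket (mul c) (mul c'))"
      using mult[OF c c'] mult[OF c' c] by (simp add: lie_bracket_def mat_distr)
  qed
qed

text \<open>The endomorphism of V that acts by y on the multiplicity space and by zero on the
  orthogonal complement of the isotypic component: the starting point for a preimage of y under
  \<open>mul\<close>.\<close>

definition lift :: "complex mat \<Rightarrow> complex mat" where
  "lift y = T * (kronecker (1\<^sub>m d) y * adj T)"

lemma lift_dim [simp]: "dim_row (lift y) = N" "dim_col (lift y) = N" "lift y \<in> carrier_mat N N"
  by (auto simp: lift_def intro!: carrier_matI)

lemma lift_comm:
  assumes y: "y \<in> carrier_mat m m" and x: "x \<in> g"
  shows "lift y * x = x * lift y"
proof -
  note [simp] = carrier_matD[OF y] g_dim[OF x] is_repD(3,4)[OF rep x]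
  have "lift y * x = T * (kronecker (1\<^sub>m d) y * kronecker (snd R x) (1\<^sub>m m) * adj T)"
    by (simp add: lift_def mat_assoc adj_T_mult_g[OF x])
  also have "kronecker (1\<^sub>m d) y * kronecker (snd R x) (1\<^sub>m m) = kronecker (snd R x) (1\<^sub>m m) * kronecker (1\<^sub>m d) y"
    by (simp add: kronecker_mult)
  also have "T * (kronecker (snd R x) (1\<^sub>m m) * kronecker (1\<^sub>m d) y * adj T)
      = T * kronecker (snd R x) (1\<^sub>m m) * (kronecker (1\<^sub>m d) y * adj T)"
    by (simp add: mat_assoc)
  also have "\<dots> = x * lift y"
    by (simp add: g_mult_T[OF x, symmetric] lift_def mat_assoc)
  finally show ?thesis .
qed

lemma adj_lift:
  assumes "y \<in> lie_u m"
  shows "adj (lift y) = - lift y"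
proof -
  have y: "dim_row y = m" "dim_col y = m" "adj y = - y"
    using assms by (auto simp: lie_u_def)
  have "kronecker (1\<^sub>m d) (- y) = - kronecker (1\<^sub>m d) y"
    using kronecker_one_smult[of d "- 1" y] by (simp add: smult_minus_one)
  then show ?thesis
    by (simp add: lift_def y mat_assoc mat_scal)
qed

lemma lift_mult_T: "y \<in> carrier_mat m m \<Longrightarrow> lift y * T = T * kronecker (1\<^sub>m d) y"
  by (simp add: lift_def mat_assoc T_iso)

lemma T_perp:
  assumes "B \<in> carrier_mat N e" "\<And>X. X \<in> M R \<Longrightarrow> adj X * B = 0\<^sub>m d e"
  shows "adj T * B = 0\<^sub>m (d * m) e"
  unfolding T_def by (rule adj_cols_of_eq_0[OF A_carrier assms(1) assms(2)[OF AM]])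

lemma J_cj_T_perp:
  assumes "B \<in> carrier_mat N e" "\<And>X. X \<in> M (conj_rep R) \<Longrightarrow> adj X * B = 0\<^sub>m d e"
  shows "adj (J * cj T) * B = 0\<^sub>m (d * m) e"
proof -
  have "cj (cols_of N d m A) = cols_of N d m (\<lambda>b. cj (A b))"
    by (rule cj_cols_of[OF A_carrier])
  then have "J * cj T = cols_of N d m (\<lambda>b. J * cj (A b))"
    unfolding T_def using mult_cols_of[where A = "\<lambda>b. cj (A b)" and Y = J and N = N and d = d and m = m] A_carrier by simp
  moreover have "adj (cols_of N d m (\<lambda>b. J * cj (A b))) * B = 0\<^sub>m (d * m) e"
  proof (rule adj_cols_of_eq_0[OF _ assms(1) assms(2)[OF J_cj_M[OF rep AM]]])
    show "J * cj (A b) \<in> carrier_mat N d" if "b < m" for b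
      using J_cj_M[OF rep AM[OF that]] M_dim(3) by fastforce
  qed
  ultimately show ?thesis
    by simp
qed

text \<open>Since c commutes with the quaternionic structure, it acts on the mirror image of the
  component by the conjugate matrix. This is the origin of the conjugate representation of u(m) in
  the complex case.\<close>

lemma comm_mult_J_cj_T:
  assumes "c \<in> comm"
  shows "c * (J * cj T) = J * cj T * kronecker (1\<^sub>m d) (cj (mul c))"
proof -
  note [simp] = comm_dim[OF assms]
  have "c * (J * cj T) = c * J * cj T"
    by (simp add: mat_assoc)
  also have "c * J = J * cj c"
    using assms by (simp add: comm_def)
  also have "J * cj c * cj T = J * cj (c * T)"
    by (simp add: mat_assoc)
  finally show ?thesis
    by (simp add: comm_mult_T[OF assms] mat_assoc)
qed

text \<open>The real and pseudoreal cases: \<open>S\<close> and \<open>K\<close> factor the quaternionic structure \<open>J\<close> of the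
  ambient space into structures of the representation and of its multiplicity space.\<close>

lemma block_self_conjugate:
  assumes S: "S \<in> intw g R (conj_rep R)" "adj S * S = 1\<^sub>m d" "S * adj S = 1\<^sub>m d"
    and K: "K \<in> carrier_mat m m" "cj K = K" "adj K * K = 1\<^sub>m m" "K * adj K = 1\<^sub>m m"
    and JT: "J * cj T * kronecker S (1\<^sub>m m) = T * kronecker (1\<^sub>m d) K"
  shows "block R {y \<in> lie_u m. y * K = K * cj y} mul (ext_tensor R (m, mul)) T"
proof -
  note [simp] = intw_dim(1,2)[OF S(1), simplified] carrier_matD[OF K(1)]
  have D: "fst (ext_tensor R (m, mul)) = d * m"
    by (simp add: ext_tensor_def)
  have DX: "snd (ext_tensor R (m, mul)) (x, c) = kronecker (snd R x) (1\<^sub>m m) + kronecker (1\<^sub>m d) (mul c)" for x c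
    by (simp add: ext_tensor_def)
  \<comment> \<open>Apply c to both sides of \<open>JT\<close>: it acts through
    \<open>cj (mul c)\<close> on the left and through \<open>mul c\<close> on the right, and S,
    living on the other tensor factor, moves past it.\<close>
  have mulK: "mul c * K = K * cj (mul c)" if c: "c \<in> comm" for c
  proof -
    note [simp] = comm_dim[OF c]
    have "T * kronecker (1\<^sub>m d) (mul c * K) = T * kronecker (1\<^sub>m d) (mul c) * kronecker (1\<^sub>m d) K"
      by (simp add: mat_assoc kronecker_mult)
    also have "\<dots> = c * (T * kronecker (1\<^sub>m d) K)"
      by (simp add: comm_mult_T[OF c, symmetric] mat_assoc)
    also have "\<dots> = c * (J * cj T) * kronecker S (1\<^sub>m m)"
      unfolding JT[symmetric] by (simp add: mat_assoc)
    also have "\<dots> = J * cj T * (kronecker (1\<^sub>m d) (cj (mul c)) * kronecker S (1\<^sub>m m))"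
      by (simp add: comm_mult_J_cj_T[OF c] mat_assoc)
    also have "kronecker (1\<^sub>m d) (cj (mul c)) * kronecker S (1\<^sub>m m) = kronecker S (1\<^sub>m m) * kronecker (1\<^sub>m d) (cj (mul c))"
      by (simp add: kronecker_mult)
    also have "J * cj T * (kronecker S (1\<^sub>m m) * kronecker (1\<^sub>m d) (cj (mul c)))
        = T * kronecker (1\<^sub>m d) K * kronecker (1\<^sub>m d) (cj (mul c))"
      unfolding JT[symmetric] by (simp add: mat_assoc)
    also have "\<dots> = T * kronecker (1\<^sub>m d) (K * cj (mul c))"
      by (simp add: mat_assoc kronecker_mult)
    finally have "kronecker (1\<^sub>m d) (mul c * K) = kronecker (1\<^sub>m d) (K * cj (mul c))"
      by (rule T_cancel) auto
    then show ?thesis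
      by (rule kronecker_one_inj) (rule d_pos)
  qed
  have JT': "J * cj T = T * kronecker (adj S) K"
  proof -
    have "J * cj T * kronecker S (1\<^sub>m m) * kronecker (adj S) (1\<^sub>m m) = T * kronecker (1\<^sub>m d) K * kronecker (adj S) (1\<^sub>m m)"
      by (simp add: JT)
    then show ?thesis
      by (simp add: mat_assoc kronecker_mult S)
  qed
  have lift: "lift y \<in> comm" if y: "y \<in> lie_u m" "y * K = K * cj y" for y
  proof -
    have [simp]: "dim_row y = m" "dim_col y = m" and yc: "y \<in> carrier_mat m m"
      using y by (auto simp: lie_u_def)
    \<comment> \<open>The condition on y, solved for y. Conjugation by the Kronecker product of
      \<open>adj S\<close> and K then reproduces the action of y, as S cancels by unitarity.\<close>
    have "K * cj y * adj K = y * (K * adj K)"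
      using y(2)[symmetric] by (simp add: mat_assoc)
    then have Ky: "K * (cj y * adj K) = y"
      by (simp add: K mat_assoc)
    have "adj (J * cj T) = adj (T * kronecker (adj S) K)"
      by (simp add: JT')
    then have "cj (adj T) * adj J * J = kronecker S (adj K) * adj T * J"
      by (simp add: adj_cj)
    moreover have "cj (adj T) * adj J * J = cj (adj T)"
      using adj_J_mult(1)[of "1\<^sub>m N"] by (simp add: mat_assoc)
    ultimately have cT: "cj (adj T) = kronecker S (adj K) * adj T * J"
      by simp
    have "J * cj (lift y) = J * cj T * kronecker (1\<^sub>m d) (cj y) * cj (adj T)"
      by (simp add: lift_def mat_assoc)
    also have "\<dots> = T * (kronecker (adj S) K * kronecker (1\<^sub>m d) (cj y) * kronecker S (adj K)) * adj T * J"
      unfolding JT' cT by (simp add: mat_assoc)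
    also have "kronecker (adj S) K * kronecker (1\<^sub>m d) (cj y) * kronecker S (adj K) = kronecker (1\<^sub>m d) y"
      by (simp add: kronecker_mult mat_assoc S Ky)
    finally have "J * cj (lift y) = lift y * J"
      by (simp add: lift_def mat_assoc)
    then show ?thesis
      using adj_lift[OF y(1)] lift_comm[OF yc] by (simp add: comm_def lie_u_def)
  qed
  show ?thesis
    unfolding block_def D
  proof (intro conjI ballI allI impI)
    show "T \<in> carrier_mat N (d * m)"
      by (auto intro!: carrier_matI)
    show "adj T * T = 1\<^sub>m (d * m)"
      by (rule T_iso)
    show "snd (ext_tensor R (m, mul)) (x, c) \<in> carrier_mat (d * m) (d * m)" if "x \<in> g" "c \<in> comm" for x c
      using is_repD[OF rep that(1)] unfolding DX by (auto intro!: carrier_matI)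
    show "(x + c) * T = T * snd (ext_tensor R (m, mul)) (x, c)" if "x \<in> g" "c \<in> comm" for x c
      unfolding DX using g_mult_T[OF that(1)] comm_mult_T[OF that(2)] g_dim[OF that(1)] comm_dim[OF that(2)]
        is_repD(3,4)[OF rep that(1)] by (simp add: mat_distr)
    show "lie_hom comm {y \<in> lie_u m. y * K = K * cj y} mul"
      using mul_hom mulK by (simp add: lie_hom_def)
    show "mul c = mul c' \<longleftrightarrow> c * T = c' * T" if "c \<in> comm" "c' \<in> comm" for c c'
      by (rule mul_eq_iff[OF that])
    show "\<exists>c\<in>comm. mul c = y \<and> T * (adj T * c) = c" if y: "y \<in> {y \<in> lie_u m. y * K = K * cj y}" for y
    proof (intro bexI conjI)
      have yc: "y \<in> carrier_mat m m"
        using y by (auto simp: lie_u_def)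
      then have [simp]: "dim_row y = m" "dim_col y = m"
        by auto
      show "lift y \<in> comm"
        using y lift by blast
      show "mul (lift y) = y"
        using lift_comm lift_mult_T yc by (intro mul_eqI) auto
      show "T * (adj T * lift y) = lift y"
        unfolding lift_def by (simp add: cancel_left[OF T_iso])
    qed
    show "T * (adj T * B) = B" if B: "B \<in> M R \<union> M (conj_rep R)" for B
    proof (cases "B \<in> M R")
      case True
      then show ?thesis
        by (rule T_full)
    next
      case False
      then have B: "B \<in> M (conj_rep R)"
        using B by simp
      note [simp] = M_dim(1,2)[OF B, simplified]
      \<comment> \<open>S identifies R with its conjugate, so a copy of the conjugate is a copy of
        R.\<close>
      have "B * S \<in> M R"
        by (rule M_mult[OF rep is_rep_conj[OF rep] B S(1)])
      then have "T * (adj T * (B * S)) * adj S = B * S * adj S"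
        by (simp only: T_full)
      then show ?thesis
        by (simp add: mat_assoc S)
    qed
    show "adj T * B = 0\<^sub>m (d * m) e"
      if "B \<in> carrier_mat N e" "\<forall>A\<in>M R \<union> M (conj_rep R). adj A * B = 0\<^sub>m d e" for B e
      using that by (intro T_perp) auto
  qed
qed

text \<open>\<open>J * cj T\<close> spans the component of the conjugate, orthogonal to that of R
  for lack of intertwiners. As the two halves are only exchanged, no condition on y arises: it acts
  on one half as y and on the other as its conjugate.\<close>

lemma block_complex:
  assumes "complex_irrep g R"
  shows "block R (lie_u m) mul
    (rep_direct_sum [ext_tensor R (m, mul), ext_tensor (conj_rep R) (conj_rep (m, mul))]) (hcat2 T (J * cj T))"
proof -
  define T' where "T' = J * cj T"
  define U where "U = hcat2 T T'"
  define D where "D = rep_direct_sum [ext_tensor R (m, mul), ext_tensor (conj_rep R) (conj_rep (m, mul))]"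
  have [simp]: "dim_row T' = N" "dim_col T' = d * m"
    by (auto simp: T'_def)
  have [simp]: "dim_row U = N" "dim_col U = d * m + d * m"
    by (auto simp: U_def)
  have Tc: "T \<in> carrier_mat N (d * m)" and T'c: "T' \<in> carrier_mat N (d * m)"
    by (auto intro!: carrier_matI)
  have D1: "fst D = d * m + d * m"
    by (simp add: D_def rep_direct_sum_def ext_tensor_def conj_rep_def)
  have cX: "kronecker (cj r) (1\<^sub>m m) + kronecker (1\<^sub>m d) (cj y) = cj (kronecker r (1\<^sub>m m) + kronecker (1\<^sub>m d) y)"
    if "r \<in> carrier_mat d d" "y \<in> carrier_mat m m" for r y
    using that by (auto intro!: eq_matI simp: div_mod_less)
  have D2: "snd D (x, c) = four_block_mat X (0\<^sub>m (d * m) (d * m)) (0\<^sub>m (d * m) (d * m)) (cj X)"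
    if x: "x \<in> g" and c: "c \<in> comm" and X: "X = kronecker (snd R x) (1\<^sub>m m) + kronecker (1\<^sub>m d) (mul c)" for x c X
    using is_repD(3,4)[OF rep x] cX[OF is_repD(1)[OF rep x] mul_dim(3)[of c]] unfolding X
    by (simp add: D_def rep_direct_sum_def ext_tensor_def diag_block_mat_pair conj_rep_def del: diag_block_mat.simps)
  have orth: "adj T' * T = 0\<^sub>m (d * m) (d * m)"
  proof -
    have "adj X * B = 0\<^sub>m d d" if "X \<in> M (conj_rep R)" "B \<in> M R" for X B
      using complex_irrep_no_intw[OF assms adj_M_mult_M[OF rep is_rep_conj[OF rep] that]] .
    then have "adj T' * B = 0\<^sub>m (d * m) d" if "B \<in> M R" for B
      unfolding T'_def using M_dim(3)[OF that] that by (intro J_cj_T_perp) auto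
    then have "adj T' * T = cols_of (d * m) d m (\<lambda>b. 0\<^sub>m (d * m) d)"
      unfolding T_def using mult_cols_of[OF A_carrier, where Y = "adj T'"] AM by (auto intro: cols_of_cong)
    also have "\<dots> = 0\<^sub>m (d * m) (d * m)"
      by (auto intro!: eq_matI simp: index_cols_of div_mod_less)
    finally show ?thesis .
  qed
  have "adj (adj T' * T) = 0\<^sub>m (d * m) (d * m)"
    using orth by simp
  then have orth': "adj T * T' = 0\<^sub>m (d * m) (d * m)"
    by (subst (asm) adj_mult) simp_all
  have T'_iso: "adj T' * T' = 1\<^sub>m (d * m)"
    unfolding T'_def by (simp only: adj_J_cj_mult[of T T] T_dim T_iso cj_one)
  have U_iso: "adj U * U = 1\<^sub>m (d * m + d * m)"
    unfolding U_def adj_hcat2_mult_hcat2[OF Tc T'c Tc T'c] by (simp add: T_iso T'_iso orth orth')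
  have UT: "U * (adj U * T) = T" "U * (adj U * T') = T'"
  proof -
    have "U * adj U * hcat2 T T' = U * (adj U * U)"
      unfolding U_def[symmetric] by (simp add: mat_assoc)
    also have "\<dots> = hcat2 T T'"
      by (simp add: U_iso) (simp add: U_def)
    finally have "hcat2 (U * adj U * T) (U * adj U * T') = hcat2 T T'"
      by (simp add: mult_hcat2)
    then have "U * adj U * T = T" "U * adj U * T' = T'"
      by (subst (asm) hcat2_eq_iff[of _ N "d * m" _ "d * m"]; simp add: carrier_matI)+
    then show "U * (adj U * T) = T" "U * (adj U * T') = T'"
      by (simp_all add: mat_assoc)
  qed
  have UTX: "U * (adj U * (T * X)) = T * X" "U * (adj U * (T' * X)) = T' * X" if "dim_row X = d * m" for X
    using that UT by (simp_all flip: mat_assoc)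
  have cT': "c * T' = T' * kronecker (1\<^sub>m d) (cj (mul c))" if "c \<in> comm" for c
    unfolding T'_def by (rule comm_mult_J_cj_T[OF that])
  have xT': "x * T' = T' * kronecker (cj (snd R x)) (1\<^sub>m m)" if x: "x \<in> g" for x
  proof -
    note [simp] = g_dim[OF x] is_repD(3,4)[OF rep x]
    have "x * T' = x * J * cj T"
      by (simp add: T'_def mat_assoc)
    also have "\<dots> = J * cj (x * T)"
      using gJ[OF x] by (simp add: mat_assoc)
    finally show ?thesis
      by (simp add: g_mult_T[OF x] T'_def mat_assoc)
  qed
  \<comment> \<open>\<open>lift y\<close> vanishes on the conjugate half; its conjugate by the
    quaternionic structure is added, so that the sum commutes with that structure.\<close>
  have lift: "lift y + J * (cj (lift y) * adj J) \<in> comm"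
    "mul (lift y + J * (cj (lift y) * adj J)) = y"
    "U * (adj U * (lift y + J * (cj (lift y) * adj J))) = lift y + J * (cj (lift y) * adj J)"
    if y: "y \<in> lie_u m" for y
  proof -
    have yc: "y \<in> carrier_mat m m" and [simp]: "dim_row y = m" "dim_col y = m"
      using y by (auto simp: lie_u_def)
    define L where "L = lift y"
    define L' where "L' = J * (cj L * adj J)"
    have [simp]: "dim_row L = N" "dim_col L = N" "dim_row L' = N" "dim_col L' = N"
      by (auto simp: L_def L'_def)
    have aL: "adj L = - L" "L * x = x * L" if "x \<in> g" for x
      using adj_lift[OF y] lift_comm[OF yc that] by (auto simp: L_def)
    have adjL: "adj L = - L"
      using adj_lift[OF y] by (simp add: L_def)
    have "adj L' = - L'"
      by (simp add: L'_def adj_cj adjL mat_scal mat_assoc)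
    then have 1: "adj (L + L') = - (L + L')"
      using adjL by (auto intro!: eq_matI)
    have JL': "L' * J = J * cj L"
      using adj_J_mult(1)[of "1\<^sub>m N"] by (simp add: L'_def mat_assoc)
    have "J * cj L' = L * J"
      by (simp add: L'_def J J_J_mult adj_cj[symmetric] mat_scal)
    then have 2: "(L + L') * J = J * cj (L + L')"
      by (simp add: mat_distr JL') (auto intro!: eq_matI simp del: index_mult_mat(1))
    have 3: "(L + L') * x = x * (L + L')" if x: "x \<in> g" for x
    proof -
      note [simp] = g_dim[OF x]
      have c1: "cj L * cj x = cj x * cj L"
        using arg_cong[OF aL(2)[OF x], of cj] by simp
      have "cj (x * J) = cj (J * cj x)"
        using gJ[OF x] by simp
      then have c2: "adj J * x = cj x * adj J"
        by (simp add: J mat_scal)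
      have "L' * x = J * (cj L * cj x * adj J)"
        by (simp add: L'_def mat_assoc c2)
      also have "\<dots> = J * cj x * (cj L * adj J)"
        by (simp add: c1 mat_assoc)
      also have "\<dots> = x * L'"
        unfolding gJ[OF x, symmetric] by (simp add: L'_def mat_assoc)
      finally show ?thesis
        by (simp add: mat_distr aL(2)[OF x])
    qed
    have L'T: "L' = T' * (kronecker (1\<^sub>m d) (cj y) * adj T')"
      by (simp add: L'_def L_def lift_def T'_def mat_assoc adj_cj)
    have "L' * T = 0\<^sub>m N (d * m)"
      unfolding L'T by (simp add: mat_assoc orth)
    then have 4: "(L + L') * T = T * kronecker (1\<^sub>m d) y"
      using lift_mult_T[OF yc] by (simp add: mat_distr L_def)
    have "L + L' \<in> carrier_mat N N"
      by (auto intro!: carrier_matI)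
    then have "L + L' \<in> comm"
      unfolding comm_def lie_u_def using 1 2 3 by blast
    then show "lift y + J * (cj (lift y) * adj J) \<in> comm"
      by (simp add: L_def L'_def)
    have "mul (L + L') = y"
      using 3 4 yc by (intro mul_eqI) (auto intro!: carrier_matI)
    then show "mul (lift y + J * (cj (lift y) * adj J)) = y"
      by (simp add: L_def L'_def)
    have "U * (adj U * L) = L"
      unfolding L_def lift_def by (rule UTX) simp
    moreover have "U * (adj U * L') = L'"
      unfolding L'T by (rule UTX) simp
    ultimately have "U * (adj U * (L + L')) = L + L'"
      by (simp add: mat_distr)
    then show "U * (adj U * (lift y + J * (cj (lift y) * adj J))) = lift y + J * (cj (lift y) * adj J)"
      by (simp add: L_def L'_def)
  qed
  have "block R (lie_u m) mul D U"
    unfolding block_def D1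
  proof (intro conjI ballI allI impI)
    show "U \<in> carrier_mat N (d * m + d * m)"
      by (auto intro!: carrier_matI)
    show "adj U * U = 1\<^sub>m (d * m + d * m)"
      by (rule U_iso)
    fix x c assume x: "x \<in> g" and c: "c \<in> comm"
    note [simp] = g_dim[OF x] comm_dim[OF c] is_repD(3,4)[OF rep x]
    define X where "X = kronecker (snd R x) (1\<^sub>m m) + kronecker (1\<^sub>m d) (mul c)"
    have X: "X \<in> carrier_mat (d * m) (d * m)"
      by (auto simp: X_def intro!: carrier_matI)
    show "snd D (x, c) \<in> carrier_mat (d * m + d * m) (d * m + d * m)"
      unfolding D2[OF x c X_def] using X by simp
    have "(x + c) * T = T * X"
      by (simp add: X_def mat_distr g_mult_T[OF x] comm_mult_T[OF c])
    moreover have "(x + c) * T' = T' * cj X"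
      by (simp add: X_def mat_distr xT'[OF x] cT'[OF c])
    moreover have "U * snd D (x, c) = hcat2 (T * X) (T' * cj X)"
      unfolding D2[OF x c X_def] U_def
      by (subst hcat2_mult_block[OF Tc T'c, of _ "d * m" _ "d * m"]) (use X carrier_matD[OF X] in auto)
    ultimately show "(x + c) * U = U * snd D (x, c)"
      by (simp add: U_def mult_hcat2)
  next
    show "lie_hom comm (lie_u m) mul"
      by (rule mul_hom)
    fix c c' assume c: "c \<in> comm" "c' \<in> comm"
    note [simp] = comm_dim[OF c(1)] comm_dim[OF c(2)]
    \<comment> \<open>The half T suffices, because c acts on T' through \<open>cj (mul c)\<close>,
      which is determined by c on T.\<close>
    have "c * T = c' * T \<Longrightarrow> c * T' = c' * T'"
      using c by (simp add: mul_eq_iff[symmetric] cT')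
    then have "c * T = c' * T \<longleftrightarrow> c * U = c' * U"
      unfolding U_def
      by (simp add: mult_hcat2 hcat2_eq_iff[of _ N "d * m" _ "d * m"] carrier_matI) blast
    then show "mul c = mul c' \<longleftrightarrow> c * U = c' * U"
      using mul_eq_iff[OF c] by simp
  next
    show "\<exists>c\<in>comm. mul c = y \<and> U * (adj U * c) = c" if "y \<in> lie_u m" for y
      using lift[OF that] by blast
    show "U * (adj U * B) = B" if "B \<in> M R \<union> M (conj_rep R)" for B
    proof (cases "B \<in> M R")
      case True
      have "U * (adj U * (T * (adj T * B))) = T * (adj T * B)"
        by (rule UTX) simp
      then show ?thesis
        unfolding T_full[OF True] .
    next
      case False
      then have B: "B \<in> M (conj_rep R)"
        using that by simp
      note [simp] = M_dim(1)[OF B]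
      \<comment> \<open>The quaternionic structure takes B to \<open>M R\<close>, where fullness
        applies, and back again; its square -1 accounts for the sign below.\<close>
      have "J * cj B \<in> M R"
        using J_cj_M[OF is_rep_conj[OF rep] B] by simp
      then have "J * cj (T * (adj T * (J * cj B))) = J * cj (J * cj B)"
        by (simp only: T_full)
      then have "T' * (cj (adj T) * (cj J * B)) = - B"
        by (simp add: J_cj_J_cj T'_def mat_assoc J J_J_mult)
      then have B': "B = T' * (- (cj (adj T) * (cj J * B)))"
        by (simp add: mat_scal)
      have "U * (adj U * (T' * (- (cj (adj T) * (cj J * B))))) = T' * (- (cj (adj T) * (cj J * B)))"
        by (rule UTX) simp
      then show ?thesis
        unfolding B'[symmetric] .
    qed
    show "adj U * B = 0\<^sub>m (d * m + d * m) e"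
      if "B \<in> carrier_mat N e" "\<forall>A\<in>M R \<union> M (conj_rep R). adj A * B = 0\<^sub>m d e" for B e
      unfolding U_def T'_def
      by (subst adj_hcat2_mult_eq_0_iff[of _ N "d * m" _ "d * m"])
        (use that T_perp[of B e] J_cj_T_perp[of B e] in \<open>auto intro!: carrier_matI\<close>)
  qed
  then show ?thesis
    unfolding D_def U_def T'_def .
qed

end

subsection \<open>Adapted bases of multiplicity spaces\<close>

lemma symplectic_J_carrier [simp]: "symplectic_J n \<in> carrier_mat (2 * n) (2 * n)"
  by (auto simp: symplectic_J_def)

lemma symplectic_J_dim [simp]: "dim_row (symplectic_J n) = 2 * n" "dim_col (symplectic_J n) = 2 * n"
  by (auto simp: symplectic_J_def)

lemma index_symplectic_J:
  assumes "i < 2 * n" "j < 2 * n"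
  shows "symplectic_J n $$ (i, j) =
    (if i < n then (if j = n + i then 1 else 0) else (if i = n + j then - 1 else 0))"
  using assms by (auto simp: symplectic_J_def)

lemma cj_symplectic_J: "cj (symplectic_J n) = symplectic_J n"
  by (rule eq_matI) (auto simp: index_symplectic_J)

lemma adj_symplectic_J: "adj (symplectic_J n) = - symplectic_J n"
  by (rule eq_matI) (auto simp: index_symplectic_J)

lemma symplectic_J_square: "symplectic_J n * symplectic_J n = - 1\<^sub>m (2 * n)"
  unfolding symplectic_J_def
  by (subst mult_four_block_mat[of _ n n _ n _ n _ _ n _ n]) (auto intro!: eq_matI)

text \<open>For anti-Hermitian x the transpose is \<open>- cj x\<close>, so the symplectic condition
  says that x commutes with v \<mapsto> J cnj v.\<close>

lemma lie_sp_eq: "lie_sp n = {x \<in> lie_u (2 * n). x * symplectic_J n = symplectic_J n * cj x}"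
proof -
  let ?J = "symplectic_J n"
  have "transpose_mat x * ?J + ?J * x = 0\<^sub>m (2 * n) (2 * n) \<longleftrightarrow> x * ?J = ?J * cj x" if x: "x \<in> lie_u (2 * n)" for x
  proof -
    have [simp]: "dim_row x = 2 * n" "dim_col x = 2 * n" and "adj x = - x"
      using x by (auto simp: lie_u_def)
    then have t: "transpose_mat x = - cj x"
      by (simp add: transpose_eq_cj_adj)
    have JJ: "?J * (?J * A) = - A" if "dim_row A = 2 * n" for A
      using that symplectic_J_square[of n] mat_assoc[of ?J ?J A] by (simp add: mat_scal)
    have "transpose_mat x * ?J + ?J * x = ?J * x - cj x * ?J"
      by (auto simp: t mat_scal simp del: index_mult_mat(1) intro!: eq_matI)
    then have "transpose_mat x * ?J + ?J * x = 0\<^sub>m (2 * n) (2 * n) \<longleftrightarrow> ?J * x = cj x * ?J"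
      by (simp add: mat_diff_eq_0_iff)
    also have "\<dots> \<longleftrightarrow> x * ?J = ?J * cj x"
    proof
      assume "?J * x = cj x * ?J"
      then have "?J * (?J * x) * ?J = ?J * (cj x * ?J) * ?J"
        by simp
      then show "x * ?J = ?J * cj x"
        by (simp add: JJ mat_assoc symplectic_J_square mat_scal minus_mat_eq_iff)
    next
      assume "x * ?J = ?J * cj x"
      then have "?J * (x * ?J) * ?J = ?J * (?J * cj x) * ?J"
        by simp
      then show "?J * x = cj x * ?J"
        by (simp add: JJ mat_assoc symplectic_J_square mat_scal minus_mat_eq_iff)
    qed
    finally show ?thesis .
  qed
  then show ?thesis
    unfolding lie_sp_def by blast
qed

text \<open>With K the identity, the condition of \<open>block_self_conjugate\<close> says that y is
  real, and a real anti-Hermitian matrix is antisymmetric.\<close>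

lemma lie_so_eq: "lie_so l = {y \<in> lie_u l. y * 1\<^sub>m l = 1\<^sub>m l * cj y}"
proof (intro equalityI subsetI)
  fix y assume "y \<in> lie_so l"
  then have y: "y \<in> carrier_mat l l" "elements_mat y \<subseteq> \<real>" "transpose_mat y = - y"
    by (auto simp: lie_so_def)
  have cy: "cj y = y"
  proof (rule eq_matI)
    fix i j assume "i < dim_row y" "j < dim_col y"
    then have "y $$ (i, j) \<in> elements_mat y"
      by (force simp: elements_mat_def)
    then show "cj y $$ (i, j) = y $$ (i, j)"
      using y(2) \<open>i < dim_row y\<close> \<open>j < dim_col y\<close> by (auto simp: Reals_cnj_iff)
  qed auto
  have "adj y = cj (transpose_mat y)"
    by (simp add: transpose_eq_cj_adj)
  then have "adj y = - y"
    using y(3) cy by simp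
  then show "y \<in> {y \<in> lie_u l. y * 1\<^sub>m l = 1\<^sub>m l * cj y}"
    using y(1) cy by (simp add: lie_u_def)
next
  fix y assume "y \<in> {y \<in> lie_u l. y * 1\<^sub>m l = 1\<^sub>m l * cj y}"
  then have y: "y \<in> carrier_mat l l" "adj y = - y" "cj y = y"
    by (auto simp: lie_u_def)
  have "z \<in> \<real>" if "z \<in> elements_mat y" for z
  proof -
    obtain i j where "i < dim_row y" "j < dim_col y" "z = y $$ (i, j)"
      using \<open>z \<in> elements_mat y\<close> by (auto simp: elements_mat_def)
    then show ?thesis
      using arg_cong[OF y(3), of "\<lambda>X. X $$ (i, j)"] by (simp add: Reals_cnj_iff)
  qed
  moreover have "transpose_mat y = - y"
    using y(2,3) by (simp add: transpose_eq_cj_adj)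
  ultimately show "y \<in> lie_so l"
    using y(1) by (auto simp: lie_so_def)
qed

lemma hcat2_mult_adj:
  assumes "A \<in> carrier_mat n a" "B \<in> carrier_mat n b"
  shows "hcat2 A B * adj (hcat2 A B) = A * adj A + B * adj B"
proof (rule eq_matI)
  fix i j assume "i < dim_row (A * adj A + B * adj B)" "j < dim_col (A * adj A + B * adj B)"
  then have ij: "i < n" "j < n"
    using assms by auto
  have "(hcat2 A B * adj (hcat2 A B)) $$ (i, j) = (\<Sum>c<a + b. hcat2 A B $$ (i, c) * cnj (hcat2 A B $$ (j, c)))"
    using ij assms by (auto simp: scalar_prod_def atLeast0LessThan intro!: sum.cong)
  also have "\<dots> = (\<Sum>c<a. hcat2 A B $$ (i, c) * cnj (hcat2 A B $$ (j, c)))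
      + (\<Sum>c<b. hcat2 A B $$ (i, a + c) * cnj (hcat2 A B $$ (j, a + c)))"
    by (induction b) (simp_all add: add.assoc)
  also have "\<dots> = (\<Sum>c<a. A $$ (i, c) * cnj (A $$ (j, c))) + (\<Sum>c<b. B $$ (i, c) * cnj (B $$ (j, c)))"
    using ij assms by (intro arg_cong2[where f = "(+)"] sum.cong) (auto simp: index_hcat2)
  also have "\<dots> = (A * adj A + B * adj B) $$ (i, j)"
    using ij assms by (simp add: scalar_prod_def atLeast0LessThan)
  finally show "(hcat2 A B * adj (hcat2 A B)) $$ (i, j) = (A * adj A + B * adj B) $$ (i, j)" .
qed (use assms in auto)

lemma four_block_mat_inj:
  assumes "four_block_mat P Q X W = four_block_mat P' Q' X' W'"
    and "P \<in> carrier_mat d d" "Q \<in> carrier_mat d d" "X \<in> carrier_mat d d" "W \<in> carrier_mat d d"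
    and "P' \<in> carrier_mat d d" "Q' \<in> carrier_mat d d" "X' \<in> carrier_mat d d" "W' \<in> carrier_mat d d"
  shows "P = P'" "Q = Q'" "X = X'" "W = W'"
proof -
  have *: "four_block_mat P Q X W $$ (i, j) = four_block_mat P' Q' X' W' $$ (i, j)" for i j
    using assms(1) by simp
  have "P $$ (i, j) = P' $$ (i, j)" "Q $$ (i, j) = Q' $$ (i, j)" "X $$ (i, j) = X' $$ (i, j)"
    "W $$ (i, j) = W' $$ (i, j)" if "i < d" "j < d" for i j
    using *[of i j] *[of i "d + j"] *[of "d + i" j] *[of "d + i" "d + j"] that assms(2-) by auto
  then show "P = P'" "Q = Q'" "X = X'" "W = W'"
    using assms(2-) by (auto intro!: eq_matI)
qed

lemma msum_split:
  "msum r c (\<lambda>b. f b + h b) k = msum r c (\<lambda>b. if b < k then f b else h (b - k)) (k + k)"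
  if "\<And>b. b < k \<Longrightarrow> f b \<in> carrier_mat r c" "\<And>b. b < k \<Longrightarrow> h b \<in> carrier_mat r c"
proof (rule eq_matI)
  let ?F = "\<lambda>b. if b < k then f b else h (b - k)"
  fix i j assume "i < dim_row (msum r c ?F (k + k))" "j < dim_col (msum r c ?F (k + k))"
  then have ij: "i < r" "j < c"
    by auto
  have split: "(\<Sum>b<k + l. u b) = (\<Sum>b<k. u b) + (\<Sum>b<l. u (k + b))" for l and u :: "nat \<Rightarrow> complex"
    by (induction l) (simp_all add: add.assoc)
  have "(\<Sum>b<k. (f b + h b) $$ (i, j)) = (\<Sum>b<k. f b $$ (i, j)) + (\<Sum>b<k. h b $$ (i, j))"
    unfolding sum.distrib[symmetric] using that(2) ij by (intro sum.cong refl index_add_mat(1)) auto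
  also have "\<dots> = (\<Sum>b<k + k. ?F b $$ (i, j))"
    unfolding split by simp
  finally show "msum r c (\<lambda>b. f b + h b) k $$ (i, j) = msum r c ?F (k + k) $$ (i, j)"
    using ij by (simp add: msum_def)
qed auto

context quaternionic
begin

lemma isotypicI:
  assumes "irreducible_rep g R" "\<And>b. b < m \<Longrightarrow> A b \<in> M R" "orthonormal (fst R) m A"
    and "\<And>B. B \<in> M R \<Longrightarrow> msum N N (\<lambda>b. A b * adj (A b)) m * B = B"
  shows "isotypic N g J R m A"
  using assms by (intro isotypic.intro quaternionic_axioms isotypic_axioms.intro)

text \<open>An empty family spans only 0. The positivity of k, l and m in the theorem comes from
  here.\<close>

lemma isotypic_pos:
  assumes "isotypic N g J R m A" "B \<in> M R" "B \<noteq> 0\<^sub>m N (fst R)"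
  shows "m > 0"
proof (rule ccontr)
  assume "\<not> m > 0"
  then have "0\<^sub>m N N * B = B"
    using isotypic.full[OF assms(1,2)] by simp
  then show False
    using assms(3) M_dim[OF assms(2)] by simp
qed

lemma M_mult_adj_mult:
  assumes "irreducible_rep g R" "A \<in> M R" "B \<in> M R" "X \<in> M R"
  shows "\<exists>z. adj B * X = z \<cdot>\<^sub>m 1\<^sub>m (fst R) \<and> A * (adj B * X) = z \<cdot>\<^sub>m A"
  using adj_M_mult_scalar[OF assms(1,3,4)] M_dim[OF assms(2)] by (auto simp: mat_scal)

lemma adj_M_mult_self:
  assumes "irreducible_rep g R" "A \<in> M R"
  shows "\<exists>t. adj A * A = complex_of_real t \<cdot>\<^sub>m 1\<^sub>m (fst R)"
proof -
  obtain z where z: "adj A * A = z \<cdot>\<^sub>m 1\<^sub>m (fst R)"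
    using adj_M_mult_scalar[OF assms(1,2,2)] by blast
  moreover have "fst R > 0"
    using assms(1) by (simp add: irreducible_rep_def)
  ultimately show ?thesis
    using scalar_gram_nonneg[OF z] by auto
qed

text \<open>Gram-Schmidt over the complex numbers: \<open>adj B * X\<close> is a scalar by Schur's
  lemma, and \<open>M R\<close> is closed under complex multiples.\<close>

lemma isotypic_exists:
  assumes irr: "irreducible_rep g R"
  shows "\<exists>m A. isotypic N g J R m A"
proof -
  have rep: "is_rep g R" and d: "fst R > 0"
    using irr by (auto simp: irreducible_rep_def)
  have "M R \<subseteq> carrier_mat N (fst R)"
    using M_dim by blast
  moreover have "A * (adj B * X) \<in> M R" if "A \<in> M R" "B \<in> M R" "X \<in> M R" for A B X
    using M_mult_adj_mult[OF irr that] M_smult[OF rep that(1)] by auto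
  ultimately obtain m A where "\<And>b. b < m \<Longrightarrow> A b \<in> M R" "orthonormal (fst R) m A"
    "\<And>B. B \<in> M R \<Longrightarrow> msum N N (\<lambda>b. A b * adj (A b)) m * B = B"
    using orthonormal_basis_exists[of "M R" N "fst R", OF _ d M_zero[OF rep] M_add[OF rep] M_smult[OF rep]
        _ adj_M_mult_self[OF irr]] by blast
  then show ?thesis
    using isotypicI[OF irr] by blast
qed

end

section \<open>The antiunitary map on the multiplicity space of a self-conjugate irreducible\<close>

locale self_conjugate = quaternionic +
  fixes R :: "complex mat rep" and S :: "complex mat"
  assumes irr: "irreducible_rep g R"
    and S: "S \<in> intw g R (conj_rep R)" "adj S * S = 1\<^sub>m (fst R)" "S * adj S = 1\<^sub>m (fst R)"
begin

lemma S_dim [simp]: "dim_row S = fst R" "dim_col S = fst R"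
  using intw_dim[OF S(1)] by auto

lemma rep: "is_rep g R"
  using irr by (simp add: irreducible_rep_def)

text \<open>The quaternionic structure leads from \<open>M R\<close> to
  \<open>M (conj_rep R)\<close>, and composition with S leads back.\<close>

definition rho :: "complex mat \<Rightarrow> complex mat" where
  "rho A = J * cj A * S"

lemma rho_dim [simp]: "dim_row (rho A) = N" "dim_col (rho A) = fst R"
  by (auto simp: rho_def)

lemma rho_M: "A \<in> M R \<Longrightarrow> rho A \<in> M R"
  unfolding rho_def by (rule M_mult[OF rep is_rep_conj[OF rep] J_cj_M[OF rep] S(1)])

text \<open>J contributes -1 and S contributes z, so the square of \<open>rho\<close> has the sign
  opposite to that of \<open>cj S * S\<close>.\<close>

lemma rho_rho:
  assumes "A \<in> M R" "cj S * S = z \<cdot>\<^sub>m 1\<^sub>m (fst R)"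
  shows "rho (rho A) = - z \<cdot>\<^sub>m A"
proof -
  note [simp] = M_dim(1,2)[OF assms(1)]
  have "rho (rho A) = J * (J * (A * (cj S * S)))"
    by (simp add: rho_def mat_assoc J)
  also have "\<dots> = - (z \<cdot>\<^sub>m A)"
    by (auto simp: assms(2) mat_scal J_J_mult intro!: eq_matI)
  also have "\<dots> = - z \<cdot>\<^sub>m A"
    by (auto intro!: eq_matI)
  finally show ?thesis .
qed

lemma rho_add: "A \<in> M R \<Longrightarrow> B \<in> M R \<Longrightarrow> rho (A + B) = rho A + rho B"
  using M_dim[of A R] M_dim[of B R] by (simp add: rho_def mat_distr)

lemma rho_smult: "A \<in> M R \<Longrightarrow> rho (z \<cdot>\<^sub>m A) = cnj z \<cdot>\<^sub>m rho A"
  using M_dim[of A R] by (simp add: rho_def mat_scal)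

lemma adj_rho_mult_rho:
  assumes "A \<in> M R" "B \<in> M R" "adj A * B = z \<cdot>\<^sub>m 1\<^sub>m (fst R)"
  shows "adj (rho A) * rho B = cnj z \<cdot>\<^sub>m 1\<^sub>m (fst R)"
proof -
  note [simp] = M_dim(1,2)[OF assms(1)] M_dim(1,2)[OF assms(2)]
  have "adj (rho A) * rho B = adj S * (adj (J * cj A) * (J * cj B) * S)"
    by (simp add: rho_def mat_assoc)
  also have "adj (J * cj A) * (J * cj B) = cnj z \<cdot>\<^sub>m 1\<^sub>m (fst R)"
    unfolding adj_J_cj_mult[OF M_dim(1)[OF assms(1)] M_dim(1)[OF assms(2)]] assms(3) by simp
  finally show ?thesis
    by (simp add: mat_scal S)
qed

text \<open>Translates the effect of \<open>rho\<close> on a basis into the hypothesis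
  \<open>JT\<close> of \<open>block_self_conjugate\<close>.\<close>

lemma J_cj_T:
  assumes "isotypic N g J R m A"
  shows "J * cj (isotypic.T N R m A) * kronecker S (1\<^sub>m m) = cols_of N (fst R) m (\<lambda>b. rho (A b))"
proof -
  interpret isotypic N g J R m A
    by (rule assms)
  have cA: "J * cj (A b) \<in> carrier_mat N d" if "b < m" for b
    using A_carrier[OF that] by (auto intro!: carrier_matI)
  have "cj T = cols_of N d m (\<lambda>b. cj (A b))"
    unfolding T_def by (rule cj_cols_of[OF A_carrier])
  then have "J * cj T = cols_of N d m (\<lambda>b. J * cj (A b))"
    using mult_cols_of[where A = "\<lambda>b. cj (A b)" and Y = J and N = N and d = d and m = m] A_carrier by simp
  then show ?thesis
    using cols_of_mult_kronecker_left[OF cA carrier_matI[OF S_dim]] by (simp add: rho_def)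
qed

text \<open>Here \<open>rho\<close> is an involution. On its fixed points inner products are real,
  so Gram-Schmidt runs over the real numbers; the result spans \<open>M R\<close> because every
  element is a complex combination of fixed points.\<close>

lemma real_basis_exists:
  assumes SS: "cj S * S = - 1\<^sub>m (fst R)"
  shows "\<exists>m A. isotypic N g J R m A \<and> (\<forall>b<m. rho (A b) = A b)"
proof -
  have d: "fst R > 0"
    using irr by (simp add: irreducible_rep_def)
  define M0 where "M0 = {A \<in> M R. rho A = A}"
  have M0: "A \<in> M R" "rho A = A" if "A \<in> M0" for A
    using that by (auto simp: M0_def)
  have sub: "M0 \<subseteq> carrier_mat N (fst R)"
    using M0(1) M_dim(3) by blast
  have rho2: "rho (rho A) = A" if "A \<in> M R" for A
    using rho_rho[OF that, of "- 1"] SS by (simp add: smult_minus_one)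
  have zero: "0\<^sub>m N (fst R) \<in> M0"
    using M_zero[OF rep] by (simp add: M0_def rho_def)
  have add: "A + B \<in> M0" if "A \<in> M0" "B \<in> M0" for A B
    using M_add[OF rep M0(1)[OF that(1)] M0(1)[OF that(2)]] rho_add[OF M0(1)[OF that(1)] M0(1)[OF that(2)]]
      M0(2)[OF that(1)] M0(2)[OF that(2)] by (simp add: M0_def)
  have scal: "complex_of_real t \<cdot>\<^sub>m A \<in> M0" if "A \<in> M0" for A t
    using M_smult[OF rep M0(1)[OF that]] rho_smult[OF M0(1)[OF that]] M0(2)[OF that] by (simp add: M0_def)
  have coeff: "A * (adj B * X) \<in> M0" if ABX: "A \<in> M0" "B \<in> M0" "X \<in> M0" for A B X
  proof -
    obtain z where z: "adj B * X = z \<cdot>\<^sub>m 1\<^sub>m (fst R)" "A * (adj B * X) = z \<cdot>\<^sub>m A"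
      using M_mult_adj_mult[OF irr] M0(1) ABX by blast
    have "adj (rho B) * rho X = cnj z \<cdot>\<^sub>m 1\<^sub>m (fst R)"
      by (rule adj_rho_mult_rho[OF M0(1)[OF ABX(2)] M0(1)[OF ABX(3)] z(1)])
    \<comment> \<open>\<open>rho\<close> conjugates inner products and fixes both B and X.\<close>
    then have "cnj z = z"
      using z(1) M0(2)[OF ABX(2)] M0(2)[OF ABX(3)] d smult_one_eqD by metis
    then have "z = complex_of_real (Re z)"
      by (metis Reals_cnj_iff of_real_Re)
    then show ?thesis
      using z(2) scal[OF ABX(1), of "Re z"] by simp
  qed
  have norm: "\<exists>t. adj A * A = complex_of_real t \<cdot>\<^sub>m 1\<^sub>m (fst R)" if "A \<in> M0" for A
    by (rule adj_M_mult_self[OF irr M0(1)[OF that]])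
  obtain m A where A: "\<And>b. b < m \<Longrightarrow> A b \<in> M0" and on: "orthonormal (fst R) m A"
    and full: "\<And>B. B \<in> M0 \<Longrightarrow> msum N N (\<lambda>b. A b * adj (A b)) m * B = B"
    using orthonormal_basis_exists[OF sub d zero add scal coeff norm] by blast
  define Q where "Q = msum N N (\<lambda>b. A b * adj (A b)) m"
  have [simp]: "dim_row Q = N" "dim_col Q = N"
    by (auto simp: Q_def)
  have "Q * B = B" if B: "B \<in> M R" for B
  proof -
    note [simp] = M_dim(1,2)[OF B]
    \<comment> \<open>Real and imaginary parts with respect to \<open>rho\<close>, normalised so
      that B = B1 - \<i> B2.\<close>
    define B1 where "B1 = (1 / 2) \<cdot>\<^sub>m B + (1 / 2) \<cdot>\<^sub>m rho B"
    define B2 where "B2 = (\<i> / 2) \<cdot>\<^sub>m B + (- \<i> / 2) \<cdot>\<^sub>m rho B"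
    note MM = M_smult[OF rep B] M_smult[OF rep rho_M[OF B]]
    have "rho B1 = B1"
      unfolding B1_def rho_add[OF MM] rho_smult[OF B] rho_smult[OF rho_M[OF B]] rho2[OF B]
      by (auto intro!: eq_matI)
    then have 1: "B1 \<in> M0"
      unfolding M0_def B1_def using M_add[OF rep MM] by simp
    have "rho B2 = B2"
      unfolding B2_def rho_add[OF MM] rho_smult[OF B] rho_smult[OF rho_M[OF B]] rho2[OF B]
      by (auto intro!: eq_matI)
    then have 2: "B2 \<in> M0"
      unfolding M0_def B2_def using M_add[OF rep MM] by simp
    have [simp]: "dim_row B1 = N" "dim_col B1 = fst R" "dim_row B2 = N" "dim_col B2 = fst R"
      by (auto simp: B1_def B2_def)
    have Beq: "B = B1 + (- \<i>) \<cdot>\<^sub>m B2"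
      by (rule eq_matI) (auto simp: B1_def B2_def algebra_simps simp flip: distrib_left)
    have "Q * (B1 + (- \<i>) \<cdot>\<^sub>m B2) = B1 + (- \<i>) \<cdot>\<^sub>m B2"
      using full[OF 1] full[OF 2] by (simp add: mat_distr mat_scal Q_def[symmetric])
    then show ?thesis
      unfolding Beq[symmetric] .
  qed
  then have "isotypic N g J R m A"
    using A M0(1) on unfolding Q_def by (intro isotypicI irr) auto
  then show ?thesis
    using A M0(2) by blast
qed

text \<open>In \<open>hcat2 A (rho A)\<close> an element is packed with its image. The Gram matrix
  of two packed elements is a quaternion in block form, with first row z, - cnj w and second row w,
  cnj z. Gram-Schmidt over these quaternions selects orthogonal quaternionic lines, each
  contributing two basis elements A and \<open>rho A\<close>.\<close>

lemma quaternionic_basis_exists: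
  assumes SS: "cj S * S = 1\<^sub>m (fst R)"
  shows "\<exists>k A. isotypic N g J R (k + k) A \<and> (\<forall>b<k. rho (A b) = A (k + b) \<and> rho (A (k + b)) = - A b)"
proof -
  define d where "d = fst R"
  have d: "d > 0"
    using irr by (simp add: irreducible_rep_def d_def)
  define X where "X = (\<lambda>A. hcat2 A (rho A))"
  define M0 where "M0 = X ` M R"
  have Mc: "A \<in> carrier_mat N d" "rho A \<in> carrier_mat N d" if "A \<in> M R" for A
    using M_dim(3)[OF that] M_dim(3)[OF rho_M[OF that]] by (auto simp: d_def)
  have rho2: "rho (rho A) = - A" if "A \<in> M R" for A
    using rho_rho[OF that, of 1] SS by (simp add: smult_minus_one)
  have inner: "\<exists>z w. adj B * C = z \<cdot>\<^sub>m 1\<^sub>m d \<and> adj (rho B) * C = w \<cdot>\<^sub>m 1\<^sub>m d \<and>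
      adj B * rho C = - cnj w \<cdot>\<^sub>m 1\<^sub>m d \<and> adj (rho B) * rho C = cnj z \<cdot>\<^sub>m 1\<^sub>m d"
    if B: "B \<in> M R" and C: "C \<in> M R" for B C
  proof -
    note [simp] = M_dim(1,2)[OF B] M_dim(1,2)[OF C]
    obtain z w where z: "adj B * C = z \<cdot>\<^sub>m 1\<^sub>m d" and w: "adj (rho B) * C = w \<cdot>\<^sub>m 1\<^sub>m d"
      using adj_M_mult_scalar[OF irr B C] adj_M_mult_scalar[OF irr rho_M[OF B] C] unfolding d_def by blast
    have "adj (rho (rho B)) * rho C = cnj w \<cdot>\<^sub>m 1\<^sub>m d"
      using adj_rho_mult_rho[OF rho_M[OF B] C w[unfolded d_def]] by (simp add: d_def)
    then have "- (adj B * rho C) = cnj w \<cdot>\<^sub>m 1\<^sub>m d"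
      by (simp add: rho2[OF B] mat_scal)
    then have "- (- (adj B * rho C)) = - (cnj w \<cdot>\<^sub>m 1\<^sub>m d)"
      by simp
    then have "adj B * rho C = - cnj w \<cdot>\<^sub>m 1\<^sub>m d"
      by (auto intro!: eq_matI simp del: index_mult_mat(1))
    then show ?thesis
      using z w adj_rho_mult_rho[OF B C z[unfolded d_def]] unfolding d_def by blast
  qed
  have XX: "adj (X B) * X C = four_block_mat (adj B * C) (adj B * rho C) (adj (rho B) * C) (adj (rho B) * rho C)"
    if "B \<in> M R" "C \<in> M R" for B C
    unfolding X_def using Mc[OF that(1)] Mc[OF that(2)] by (rule adj_hcat2_mult_hcat2)
  have sub: "M0 \<subseteq> carrier_mat N (d + d)"
  proof -
    have "hcat2 A (rho A) \<in> carrier_mat N (d + d)" if "A \<in> M R" for A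
      using carrier_matD[OF Mc(1)[OF that]] by (auto simp: d_def intro!: carrier_matI)
    then show ?thesis
      unfolding M0_def X_def by blast
  qed
  have zero: "0\<^sub>m N (d + d) \<in> M0"
    unfolding M0_def X_def
    by (rule image_eqI[OF _ M_zero[OF rep]]) (auto intro!: eq_matI simp: index_hcat2 d_def rho_def)
  have Xadd: "X A + X B = X (A + B)" if "A \<in> M R" "B \<in> M R" for A B
    unfolding X_def using hcat2_add[OF Mc[OF that(1)] Mc[OF that(2)]] rho_add[OF that] by simp
  have add: "A + B \<in> M0" if AB: "A \<in> M0" "B \<in> M0" for A B
    using AB Xadd M_add[OF rep] unfolding M0_def by auto
  have scal: "complex_of_real t \<cdot>\<^sub>m A \<in> M0" if A: "A \<in> M0" for A t
  proof -
    obtain B where B: "B \<in> M R" "A = X B"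
      using A by (auto simp: M0_def)
    then have "complex_of_real t \<cdot>\<^sub>m A = X (complex_of_real t \<cdot>\<^sub>m B)"
      using M_dim(1)[OF B(1)] by (simp add: X_def hcat2_smult rho_smult)
    then show ?thesis
      using M_smult[OF rep B(1)] by (simp add: M0_def)
  qed
  have coeff: "A * (adj B * Y) \<in> M0" if ABY: "A \<in> M0" "B \<in> M0" "Y \<in> M0" for A B Y
  proof -
    obtain A' B' C where A': "A' \<in> M R" "A = X A'" and B': "B' \<in> M R" "B = X B'" and C: "C \<in> M R" "Y = X C"
      using ABY by (auto simp: M0_def)
    note [simp] = M_dim(1,2)[OF A'(1)]
    obtain z w where zw: "adj B' * C = z \<cdot>\<^sub>m 1\<^sub>m d" "adj (rho B') * C = w \<cdot>\<^sub>m 1\<^sub>m d"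
      "adj B' * rho C = - cnj w \<cdot>\<^sub>m 1\<^sub>m d" "adj (rho B') * rho C = cnj z \<cdot>\<^sub>m 1\<^sub>m d"
      using inner[OF B'(1) C(1)] by blast
    \<comment> \<open>Right multiplication of a packed element by the quaternion (z, w) is again
      packed: L is its first half, and \<open>rho (rho A') = - A'\<close> makes the second half
      \<open>rho L\<close>.\<close>
    define L where "L = z \<cdot>\<^sub>m A' + w \<cdot>\<^sub>m rho A'"
    note MM = M_smult[OF rep A'(1)] M_smult[OF rep rho_M[OF A'(1)]]
    have L: "L \<in> M R"
      unfolding L_def by (rule M_add[OF rep MM])
    have rL: "rho L = cnj z \<cdot>\<^sub>m rho A' + cnj w \<cdot>\<^sub>m (- A')"
      unfolding L_def rho_add[OF MM] rho_smult[OF A'(1)] rho_smult[OF rho_M[OF A'(1)]] rho2[OF A'(1)] ..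
    have BY: "adj B * Y = four_block_mat (z \<cdot>\<^sub>m 1\<^sub>m d) (- cnj w \<cdot>\<^sub>m 1\<^sub>m d) (w \<cdot>\<^sub>m 1\<^sub>m d) (cnj z \<cdot>\<^sub>m 1\<^sub>m d)"
      unfolding B'(2) C(2) XX[OF B'(1) C(1)] zw ..
    have "A * (adj B * Y) = hcat2 (A' * (z \<cdot>\<^sub>m 1\<^sub>m d) + rho A' * (w \<cdot>\<^sub>m 1\<^sub>m d))
        (A' * (- cnj w \<cdot>\<^sub>m 1\<^sub>m d) + rho A' * (cnj z \<cdot>\<^sub>m 1\<^sub>m d))"
      unfolding A'(2) BY X_def
      by (rule hcat2_mult_block[OF Mc[OF A'(1)], of _ d _ d]) auto
    also have "\<dots> = hcat2 L (rho L)"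
      unfolding rL by (intro arg_cong2[where f = hcat2])
        (auto simp: L_def mat_scal d_def intro!: eq_matI)
    finally show ?thesis
      using L by (simp add: M0_def X_def)
  qed
  have norm: "\<exists>t. adj A * A = complex_of_real t \<cdot>\<^sub>m 1\<^sub>m (d + d)" if A: "A \<in> M0" for A
  proof -
    obtain B where B: "B \<in> M R" "A = X B"
      using A by (auto simp: M0_def)
    obtain z w where zw: "adj B * B = z \<cdot>\<^sub>m 1\<^sub>m d" "adj (rho B) * B = w \<cdot>\<^sub>m 1\<^sub>m d"
      "adj B * rho B = - cnj w \<cdot>\<^sub>m 1\<^sub>m d" "adj (rho B) * rho B = cnj z \<cdot>\<^sub>m 1\<^sub>m d"
      using inner[OF B(1) B(1)] by blast
    obtain t where t: "z = complex_of_real t"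
      using scalar_gram_nonneg[OF zw(1) d] by blast
    \<comment> \<open>Off-diagonal blocks of a Gram matrix are adjoint to each other, whereas
      \<open>inner\<close> makes them cnj w and - cnj w: B is orthogonal to its image.\<close>
    have "adj (adj (rho B) * B) = adj B * rho B"
      using M_dim[OF B(1)] by simp
    then have "cnj w \<cdot>\<^sub>m 1\<^sub>m d = - cnj w \<cdot>\<^sub>m 1\<^sub>m d"
      using zw by simp
    then have "w = 0"
      using smult_one_eqD[OF _ d] by fastforce
    then have "adj A * A = four_block_mat (z \<cdot>\<^sub>m 1\<^sub>m d) (0\<^sub>m d d) (0\<^sub>m d d) (z \<cdot>\<^sub>m 1\<^sub>m d)"
      unfolding B(2) XX[OF B(1) B(1)] zw by (simp add: t)
    also have "\<dots> = complex_of_real t \<cdot>\<^sub>m 1\<^sub>m (d + d)"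
      by (auto simp: t intro!: eq_matI)
    finally show ?thesis
      by blast
  qed
  obtain k Y where Y: "\<And>b. b < k \<Longrightarrow> Y b \<in> M0" and on: "orthonormal (d + d) k Y"
    and full: "\<And>B. B \<in> M0 \<Longrightarrow> msum N N (\<lambda>b. Y b * adj (Y b)) k * B = B"
    using orthonormal_basis_exists[OF sub _ zero add scal coeff norm] d by auto
  have "\<exists>A. A \<in> M R \<and> Y b = X A" if "b < k" for b
    using Y[OF that] by (auto simp: M0_def)
  then obtain A0 where A0: "\<And>b. b < k \<Longrightarrow> A0 b \<in> M R" "\<And>b. b < k \<Longrightarrow> Y b = X (A0 b)"
    by metis
  \<comment> \<open>All first halves come before their images, the order that matches the blocks of
    \<open>symplectic_J\<close>.\<close>
  define A where "A = (\<lambda>b. if b < k then A0 b else rho (A0 (b - k)))"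
  have AM: "A b \<in> M R" if "b < k + k" for b
    using that A0(1) rho_M by (auto simp: A_def)
  have blocks: "adj (A0 a) * A0 b = (if a = b then 1\<^sub>m d else 0\<^sub>m d d)"
    "adj (A0 a) * rho (A0 b) = 0\<^sub>m d d" "adj (rho (A0 a)) * A0 b = 0\<^sub>m d d"
    "adj (rho (A0 a)) * rho (A0 b) = (if a = b then 1\<^sub>m d else 0\<^sub>m d d)"
    if ab: "a < k" "b < k" for a b
  proof -
    let ?E = "if a = b then 1\<^sub>m d else 0\<^sub>m d d :: complex mat"
    have "adj (Y a) * Y b = four_block_mat ?E (0\<^sub>m d d) (0\<^sub>m d d) ?E"
      using on ab by (auto simp: orthonormal_def)
    then have eq: "four_block_mat (adj (A0 a) * A0 b) (adj (A0 a) * rho (A0 b)) (adj (rho (A0 a)) * A0 b) (adj (rho (A0 a)) * rho (A0 b))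
        = four_block_mat ?E (0\<^sub>m d d) (0\<^sub>m d d) ?E"
      using A0 ab XX by simp
    note c = Mc[OF A0(1)[OF ab(1)]] Mc[OF A0(1)[OF ab(2)]]
    have c': "adj U * W \<in> carrier_mat d d" if "U \<in> carrier_mat N d" "W \<in> carrier_mat N d" for U W
      using that by auto
    note inj = four_block_mat_inj[OF eq c'[OF c(1) c(3)] c'[OF c(1) c(4)] c'[OF c(2) c(3)] c'[OF c(2) c(4)]]
    show "adj (A0 a) * A0 b = ?E" "adj (A0 a) * rho (A0 b) = 0\<^sub>m d d" "adj (rho (A0 a)) * A0 b = 0\<^sub>m d d"
      "adj (rho (A0 a)) * rho (A0 b) = ?E"
      by (rule inj; simp)+
  qed
  have on': "orthonormal (fst R) (k + k) A"
    unfolding orthonormal_def d_def[symmetric]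
  proof (intro allI impI)
    fix a b assume ab: "a < k + k" "b < k + k"
    show "adj (A a) * A b = (if a = b then 1\<^sub>m d else 0\<^sub>m d d)"
      using blocks[of a b] blocks[of a "b - k"] blocks[of "a - k" b] blocks[of "a - k" "b - k"] ab
      by (cases "a < k"; cases "b < k") (auto simp: A_def)
  qed
  define Q where "Q = msum N N (\<lambda>b. A b * adj (A b)) (k + k)"
  have [simp]: "dim_row Q = N" "dim_col Q = N"
    by (auto simp: Q_def)
  have QY: "Q = msum N N (\<lambda>b. Y b * adj (Y b)) k"
  proof -
    have "Y b * adj (Y b) = A0 b * adj (A0 b) + rho (A0 b) * adj (rho (A0 b))" if "b < k" for b
      unfolding A0(2)[OF that] X_def using Mc[OF A0(1)[OF that]] by (rule hcat2_mult_adj)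
    then have "msum N N (\<lambda>b. Y b * adj (Y b)) k
        = msum N N (\<lambda>b. A0 b * adj (A0 b) + rho (A0 b) * adj (rho (A0 b))) k"
      by (rule msum_cong)
    also have "\<dots> = msum N N (\<lambda>b. if b < k then A0 b * adj (A0 b)
        else rho (A0 (b - k)) * adj (rho (A0 (b - k)))) (k + k)"
    proof (rule msum_split)
      show "A0 b * adj (A0 b) \<in> carrier_mat N N" "rho (A0 b) * adj (rho (A0 b)) \<in> carrier_mat N N" if "b < k" for b
        using carrier_matD[OF Mc(1)[OF A0(1)[OF that]]] by (auto intro!: carrier_matI)
    qed
    also have "\<dots> = Q"
      unfolding Q_def A_def by (rule msum_cong) simp
    finally show ?thesis ..
  qed
  have "Q * B = B" if B: "B \<in> M R" for B
  proof -
    note [simp] = M_dim(1,2)[OF B]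
    have "X B \<in> M0"
      using B by (simp add: M0_def)
    then have "Q * X B = X B"
      using full QY by simp
    then have "hcat2 (Q * B) (Q * rho B) = hcat2 B (rho B)"
      by (simp add: X_def mult_hcat2)
    then show ?thesis
      using Mc[OF B] by (subst (asm) hcat2_eq_iff[of _ N d _ d]) (auto intro!: carrier_matI simp: d_def)
  qed
  then have "isotypic N g J R (k + k) A"
    using AM on' unfolding Q_def by (intro isotypicI irr) auto
  moreover have "rho (A b) = A (k + b)" "rho (A (k + b)) = - A b" if "b < k" for b
    using that rho2[OF A0(1)[OF that]] by (auto simp: A_def)
  ultimately show ?thesis
    by blast
qed

end

section \<open>The blocks of pseudoreal, real and complex type\<close>

context quaternionic
begin

text \<open>On a basis fixed by \<open>rho\<close> the structure of the multiplicity space is the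
  identity matrix, so \<open>block_self_conjugate\<close> applies with K = 1.\<close>

lemma block_pseudoreal:
  assumes R: "pseudoreal_irrep g R" and occ: "\<exists>B\<in>M R. B \<noteq> 0\<^sub>m N (fst R)"
  shows "\<exists>l f U. l > 0 \<and> block R (lie_so l) f (ext_tensor R (l, f)) U"
proof -
  have irr: "irreducible_rep g R"
    using R by (simp add: pseudoreal_irrep_def)
  obtain S where St: "S \<in> intw g R (conj_rep R)" "adj S * S = 1\<^sub>m (fst R)" "S * adj S = 1\<^sub>m (fst R)"
    "cj S * S = - 1\<^sub>m (fst R)"
    using pseudoreal_structure[OF R] by blast
  interpret self_conjugate N g J R S
    using irr St by unfold_locales
  obtain m A where iso: "isotypic N g J R m A" and A: "\<And>b. b < m \<Longrightarrow> rho (A b) = A b"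
    using real_basis_exists[OF St(4)] by blast
  interpret isotypic N g J R m A
    by (rule iso)
  have "J * cj T * kronecker S (1\<^sub>m m) = cols_of N d m A"
    unfolding J_cj_T[OF iso] by (rule cols_of_cong) (rule A)
  then have "J * cj T * kronecker S (1\<^sub>m m) = T"
    by (simp add: T_def)
  then have "block R {y \<in> lie_u m. y * 1\<^sub>m m = 1\<^sub>m m * cj y} mul (ext_tensor R (m, mul)) T"
    by (intro block_self_conjugate[OF St(1-3)]) simp_all
  then show ?thesis
    unfolding lie_so_eq[symmetric] using isotypic_pos[OF iso] occ by blast
qed

lemma block_real:
  assumes R: "real_irrep g R" and occ: "\<exists>B\<in>M R. B \<noteq> 0\<^sub>m N (fst R)"
  shows "\<exists>k f U. k > 0 \<and> block R (lie_sp k) f (ext_tensor R (2 * k, f)) U"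
proof -
  have irr: "irreducible_rep g R"
    using R by (simp add: real_irrep_def)
  obtain S where St: "S \<in> intw g R (conj_rep R)" "adj S * S = 1\<^sub>m (fst R)" "S * adj S = 1\<^sub>m (fst R)"
    "cj S * S = 1\<^sub>m (fst R)"
    using real_structure[OF R] by blast
  interpret self_conjugate N g J R S
    using irr St by unfold_locales
  obtain k A where "isotypic N g J R (k + k) A"
    and A': "\<And>b. b < k \<Longrightarrow> rho (A b) = A (k + b)" "\<And>b. b < k \<Longrightarrow> rho (A (k + b)) = - A b"
    using quaternionic_basis_exists[OF St(4)] by blast
  then have iso: "isotypic N g J R (2 * k) A"
    by (simp add: mult_2)
  interpret isotypic N g J R "2 * k" A
    by (rule iso)
  \<comment> \<open>Column b of K holds the coordinates of \<open>rho (A b)\<close>: for b < k an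
    entry 1 in row k + b, and in column k + b an entry -1 in row b. This is minus
    \<open>symplectic_J k\<close>; the sign cancels in the condition on y.\<close>
  let ?K = "- symplectic_J k"
  have "J * cj T * kronecker S (1\<^sub>m (2 * k)) = cols_of N d (2 * k) (\<lambda>b. msum N d (\<lambda>b'. ?K $$ (b', b) \<cdot>\<^sub>m A b') (2 * k))"
    unfolding J_cj_T[OF iso]
  proof (rule cols_of_cong)
    fix b assume b: "b < 2 * k"
    show "rho (A b) = msum N d (\<lambda>b'. ?K $$ (b', b) \<cdot>\<^sub>m A b') (2 * k)"
    proof (cases "b < k")
      case True
      have "msum N d (\<lambda>b'. ?K $$ (b', b) \<cdot>\<^sub>m A b') (2 * k) = ?K $$ (k + b, b) \<cdot>\<^sub>m A (k + b)"
      proof (rule msum_single)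
        show "?K $$ (b', b) \<cdot>\<^sub>m A b' = 0\<^sub>m N d" if "b' < 2 * k" "b' \<noteq> k + b" for b'
          using that True carrier_matD[OF A_carrier[OF that(1)]] by (auto simp: index_symplectic_J intro!: eq_matI)
      qed (use True A_carrier in auto)
      then show ?thesis
        using True by (simp add: index_symplectic_J A'(1))
    next
      case False
      then obtain c where c: "b = k + c" "c < k"
        using b by (metis add_diff_inverse_nat mult_2 nat_add_left_cancel_less)
      have "msum N d (\<lambda>b'. ?K $$ (b', b) \<cdot>\<^sub>m A b') (2 * k) = ?K $$ (c, b) \<cdot>\<^sub>m A c"
      proof (rule msum_single)
        show "?K $$ (b', b) \<cdot>\<^sub>m A b' = 0\<^sub>m N d" if "b' < 2 * k" "b' \<noteq> c" for b'
          using that c carrier_matD[OF A_carrier[OF that(1)]] by (auto simp: index_symplectic_J intro!: eq_matI)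
      qed (use c A_carrier in auto)
      then show ?thesis
        using c by (simp add: index_symplectic_J A'(2) smult_minus_one)
    qed
  qed
  also have "\<dots> = T * kronecker (1\<^sub>m d) ?K"
    unfolding T_def by (rule cols_of_mult_kronecker_right[OF A_carrier, symmetric]) simp_all
  finally have "block R {y \<in> lie_u (2 * k). y * ?K = ?K * cj y} mul (ext_tensor R (2 * k, mul)) T"
    by (intro block_self_conjugate[OF St(1-3)])
      (simp_all add: cj_symplectic_J adj_symplectic_J mat_scal symplectic_J_square)
  moreover have "{y \<in> lie_u (2 * k). y * ?K = ?K * cj y} = lie_sp k"
    unfolding lie_sp_eq by (auto simp: lie_u_def mat_scal minus_mat_eq_iff)
  moreover have "k > 0"
    using isotypic_pos[OF iso] occ by auto
  ultimately show ?thesis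
    by auto
qed

lemma block_complex:
  assumes R: "complex_irrep g R" and occ: "\<exists>B\<in>M R. B \<noteq> 0\<^sub>m N (fst R)"
  shows "\<exists>m f U. m > 0 \<and> block R (lie_u m) f
    (rep_direct_sum [ext_tensor R (m, f), ext_tensor (conj_rep R) (conj_rep (m, f))]) U"
proof -
  have irr: "irreducible_rep g R"
    using R by (simp add: complex_irrep_def)
  obtain m A where iso: "isotypic N g J R m A"
    using isotypic_exists[OF irr] by blast
  then show ?thesis
    using isotypic.block_complex[OF iso R] isotypic_pos[OF iso] occ by blast
qed

end

subsection \<open>Assembling the blocks\<close>

lemma listset_iff: "ys \<in> listset As \<longleftrightarrow> list_all2 (\<in>) ys As"
  by (induction As arbitrary: ys) (auto simp: set_Cons_def list_all2_Cons2)

context quaternionic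
begin

text \<open>Members must occur in V and be unrelated both to each other and to each other's
  conjugates, so a complex irreducible and its conjugate cannot both belong. A member may be
  equivalent to its own conjugate.\<close>

definition independent :: "complex mat rep set \<Rightarrow> bool" where
  "independent \<R> \<longleftrightarrow> finite \<R> \<and>
    (\<forall>R\<in>\<R>. irreducible_rep g R \<and> (\<exists>B\<in>M R. B \<noteq> 0\<^sub>m N (fst R))) \<and>
    (\<forall>R\<in>\<R>. \<forall>R'\<in>\<R>. R \<noteq> R' \<longrightarrow>
      intw g R R' \<subseteq> {0\<^sub>m (fst R') (fst R)} \<and> intw g R (conj_rep R') \<subseteq> {0\<^sub>m (fst R') (fst R)})"

lemma independentD:
  assumes "independent \<R>"
  shows "finite \<R>"
    and "R \<in> \<R> \<Longrightarrow> irreducible_rep g R" "R \<in> \<R> \<Longrightarrow> \<exists>B\<in>M R. B \<noteq> 0\<^sub>m N (fst R)"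
    and "R \<in> \<R> \<Longrightarrow> R' \<in> \<R> \<Longrightarrow> R \<noteq> R' \<Longrightarrow> B \<in> intw g R R' \<Longrightarrow> B = 0\<^sub>m (fst R') (fst R)"
    and "R \<in> \<R> \<Longrightarrow> R' \<in> \<R> \<Longrightarrow> R \<noteq> R' \<Longrightarrow> B \<in> intw g R (conj_rep R') \<Longrightarrow> B = 0\<^sub>m (fst R') (fst R)"
  using assms unfolding independent_def by blast+

lemma independent_rep: "independent \<R> \<Longrightarrow> R \<in> \<R> \<Longrightarrow> is_rep g R"
  using independentD(2) by (auto simp: irreducible_rep_def)

lemma M_normalise:
  assumes irr: "irreducible_rep g R" and B: "B \<in> M R" "B \<noteq> 0\<^sub>m N (fst R)"
  shows "\<exists>A\<in>M R. adj A * A = 1\<^sub>m (fst R)"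
proof -
  have d: "fst R > 0" and rep: "is_rep g R"
    using irr by (auto simp: irreducible_rep_def)
  obtain z where z: "adj B * B = z \<cdot>\<^sub>m 1\<^sub>m (fst R)"
    using adj_M_mult_scalar[OF irr B(1) B(1)] by blast
  then obtain u where "adj (complex_of_real u \<cdot>\<^sub>m B) * (complex_of_real u \<cdot>\<^sub>m B) = 1\<^sub>m (fst R)"
    using normalise_scalar_gram[OF z d] B(2) M_dim(1)[OF B(1)] by auto
  then show ?thesis
    using M_smult[OF rep B(1)] by blast
qed

text \<open>Normalised intertwiners, one for each member, have orthogonal ranges. Side by side they
  form an isometry into V with at least one column per member.\<close>

lemma independent_card:
  assumes ind: "independent \<R>"
  shows "card \<R> \<le> N"
proof -
  note I = independentD[OF ind]
  obtain Rs where Rs: "set Rs = \<R>" "distinct Rs"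
    using finite_distinct_list[OF I(1)] by blast
  have "\<forall>R\<in>\<R>. \<exists>A. A \<in> M R \<and> adj A * A = 1\<^sub>m (fst R)"
    using M_normalise I(2,3) by blast
  then obtain A where A: "\<And>R. R \<in> \<R> \<Longrightarrow> A R \<in> M R" "\<And>R. R \<in> \<R> \<Longrightarrow> adj (A R) * A R = 1\<^sub>m (fst R)"
    by metis
  have orth: "adj (A R') * A R = 0\<^sub>m (fst R') (fst R)" if "R \<in> \<R>" "R' \<in> \<R>" "R \<noteq> R'" for R R'
    using I(4)[OF that] adj_M_mult_M[OF independent_rep[OF ind] independent_rep[OF ind] A(1) A(1)] that by blast
  let ?Us = "map A Rs"
  have 1: "\<forall>U\<in>set ?Us. dim_row U = N \<and> adj U * U = 1\<^sub>m (dim_col U)"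
    using A(2) M_dim(1,2)[OF A(1)] Rs(1) by simp
  have 2: "sorted_wrt (\<lambda>U U'. adj U' * U = 0\<^sub>m (dim_col U') (dim_col U)) ?Us"
    unfolding sorted_wrt_map
  proof (rule sorted_wrt_mono_rel)
    show "sorted_wrt (\<noteq>) Rs"
      using Rs(2) by (simp add: sorted_wrt_iff_nth_less nth_eq_iff_index_eq)
    fix R R' assume "R \<in> set Rs" "R' \<in> set Rs" "R \<noteq> R'"
    then show "adj (A R') * A R = 0\<^sub>m (dim_col (A R')) (dim_col (A R))"
      using orth Rs(1) M_dim(2)[OF A(1)] by simp
  qed
  have "sum_list (map dim_col ?Us) \<le> N"
    by (rule isometry_le[OF hcat_carrier hcat_isometry[OF 1 2]]) (use 1 in blast)
  moreover have "length Rs \<le> sum_list (map dim_col ?Us)"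
  proof -
    have "dim_col (A R) \<ge> 1" if "R \<in> set Rs" for R
      using that Rs(1) M_dim(2)[OF A(1)] I(2) by (simp add: irreducible_rep_def Suc_leI)
    then have "sum_list (map (\<lambda>R. 1) Rs) \<le> sum_list (map (\<lambda>R. dim_col (A R)) Rs)"
      by (rule sum_list_mono)
    then show ?thesis
      by (simp add: sum_list_triv o_def)
  qed
  ultimately show ?thesis
    using Rs distinct_card by fastforce
qed

text \<open>A family of largest size exists by \<open>independent_card\<close>; an irreducible
  occurring in V and unrelated to all members could be added to it.\<close>

lemma maximal_independent:
  "\<exists>\<R>. independent \<R> \<and> (\<forall>R. irreducible_rep g R \<and> (\<exists>B\<in>M R. B \<noteq> 0\<^sub>m N (fst R)) \<longrightarrow>
    (\<exists>R'\<in>\<R>. \<exists>W. W \<in> intw g R R' \<union> intw g R (conj_rep R') \<and> W \<noteq> 0\<^sub>m (fst R') (fst R)))"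
proof -
  have "independent {}"
    by (simp add: independent_def)
  then have "\<exists>\<R>. independent \<R> \<and> card \<R> = card ({} :: complex mat rep set)"
    by blast
  then obtain n where n: "\<exists>\<R>. independent \<R> \<and> card \<R> = n"
    and max: "\<And>k. \<exists>\<R>. independent \<R> \<and> card \<R> = k \<Longrightarrow> k \<le> n"
    using Nat.ex_has_greatest_nat[of "\<lambda>k. \<exists>\<R>. independent \<R> \<and> card \<R> = k" _ N] independent_card by blast
  then obtain \<R> where ind: "independent \<R>" "card \<R> = n"
    by blast
  note I = independentD[OF ind(1)]
  have "\<exists>R'\<in>\<R>. \<exists>W. W \<in> intw g R R' \<union> intw g R (conj_rep R') \<and> W \<noteq> 0\<^sub>m (fst R') (fst R)"
    if irr: "irreducible_rep g R" and occ: "\<exists>B\<in>M R. B \<noteq> 0\<^sub>m N (fst R)" for R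
  proof (rule ccontr)
    assume "\<not> ?thesis"
    then have no: "W = 0\<^sub>m (fst R') (fst R)" if "R' \<in> \<R>" "W \<in> intw g R R' \<union> intw g R (conj_rep R')" for R' W
      using that by blast
    have rep: "is_rep g R" and d: "fst R > 0"
      using irr by (auto simp: irreducible_rep_def)
    have "1\<^sub>m (fst R) \<in> intw g R R"
      using is_repD[OF rep] by (auto simp: intw_def)
    then have new: "R \<notin> \<R>"
      using no[of R "1\<^sub>m (fst R)"] one_neq_zero_mat[OF d] by blast
    \<comment> \<open>\<open>independent\<close> constrains a pair in both orders. Intertwiners
      ending in R are reversed by \<open>adj\<close>; if they end in its conjugate,
      \<open>cj\<close> is applied before that.\<close>
    have no': "W = 0\<^sub>m (fst R) (fst R')" if R': "R' \<in> \<R>" and W: "W \<in> intw g R' R \<union> intw g R' (conj_rep R)" for R' W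
    proof -
      note rep' = independent_rep[OF ind(1) R']
      have "adj W = 0\<^sub>m (fst R') (fst R)"
      proof (cases "W \<in> intw g R' R")
        case True
        then show ?thesis
          using no[OF R'] intw_adj[OF rep' rep] by blast
      next
        case False
        then have "cj W \<in> intw g (conj_rep R') (conj_rep (conj_rep R))"
          using W intw_conj[OF rep' is_rep_conj[OF rep]] by blast
        then have "adj (cj W) \<in> intw g R (conj_rep R')"
          using intw_adj[OF is_rep_conj[OF rep'] rep] by simp
        then have "cj (adj W) = 0\<^sub>m (fst R') (fst R)"
          using no[OF R'] by (simp add: adj_cj)
        then have "cj (cj (adj W)) = cj (0\<^sub>m (fst R') (fst R))"
          by simp
        then show ?thesis
          by simp
      qed
      then have "adj (adj W) = adj (0\<^sub>m (fst R') (fst R))"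
        by simp
      then show ?thesis
        by simp
    qed
    have "independent (insert R \<R>)"
      unfolding independent_def
    proof (intro conjI ballI impI)
      show "finite (insert R \<R>)"
        using I(1) by simp
      show "irreducible_rep g R'" if "R' \<in> insert R \<R>" for R'
        using that irr I(2) by blast
      show "\<exists>B\<in>M R'. B \<noteq> 0\<^sub>m N (fst R')" if "R' \<in> insert R \<R>" for R'
        using that occ I(3) by blast
      fix R1 R2 assume R12: "R1 \<in> insert R \<R>" "R2 \<in> insert R \<R>" "R1 \<noteq> R2"
      show "intw g R1 R2 \<subseteq> {0\<^sub>m (fst R2) (fst R1)}" "intw g R1 (conj_rep R2) \<subseteq> {0\<^sub>m (fst R2) (fst R1)}"
        using R12 no no' I(4,5) by blast+
    qed
    moreover have "card (insert R \<R>) = Suc n"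
      using new ind(2) I(1) by simp
    ultimately show False
      using max by fastforce
  qed
  then show ?thesis
    using ind(1) by blast
qed

lemma blockD:
  assumes "block R H f D U"
  shows "dim_row U = N" "dim_col U = fst D" "U \<in> carrier_mat N (fst D)" "adj U * U = 1\<^sub>m (fst D)"
    and "x \<in> g \<Longrightarrow> c \<in> comm \<Longrightarrow> snd D (x, c) \<in> carrier_mat (fst D) (fst D)"
    and "x \<in> g \<Longrightarrow> c \<in> comm \<Longrightarrow> (x + c) * U = U * snd D (x, c)"
    and "lie_hom comm H f"
    and "c \<in> comm \<Longrightarrow> c' \<in> comm \<Longrightarrow> f c = f c' \<longleftrightarrow> c * U = c' * U"
    and "y \<in> H \<Longrightarrow> \<exists>c\<in>comm. f c = y \<and> U * (adj U * c) = c"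
    and "A \<in> M R \<union> M (conj_rep R) \<Longrightarrow> U * (adj U * A) = A"
    and "B \<in> carrier_mat N e \<Longrightarrow> (\<And>A. A \<in> M R \<union> M (conj_rep R) \<Longrightarrow> adj A * B = 0\<^sub>m (fst R) e)
      \<Longrightarrow> adj U * B = 0\<^sub>m (fst D) e"
  using assms unfolding block_def by auto

text \<open>\<open>adj A' * A\<close> intertwines R or its conjugate with R' or its conjugate; after
  a conjugation if necessary, it is of a kind that \<open>independent\<close> excludes. The last
  property of \<open>block\<close> then passes from multiplicity spaces to U' and afterwards to
  U.\<close>

lemma block_orthogonal:
  assumes ind: "independent \<R>" and R: "R \<in> \<R>" "R' \<in> \<R>" "R \<noteq> R'"
    and U: "block R H f D U" and U': "block R' H' f' D' U'"
  shows "adj U * U' = 0\<^sub>m (fst D) (fst D')"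
proof (rule blockD(11)[OF U blockD(3)[OF U']])
  note I = independentD[OF ind]
  note rep = independent_rep[OF ind R(1)] and rep' = independent_rep[OF ind R(2)]
  fix A assume A: "A \<in> M R \<union> M (conj_rep R)"
  then have Ac: "A \<in> carrier_mat N (fst R)"
    using M_dim(3) by fastforce
  have "adj U' * A = 0\<^sub>m (fst D') (fst R)"
  proof (rule blockD(11)[OF U' Ac])
    fix A' assume A': "A' \<in> M R' \<union> M (conj_rep R')"
    define B where "B = adj A' * A"
    have "B \<in> intw g R R' \<union> intw g R (conj_rep R') \<union> intw g (conj_rep R) R' \<union> intw g (conj_rep R) (conj_rep R')"
      using A A' adj_M_mult_M rep rep' is_rep_conj unfolding B_def by blast
    moreover have "cj B \<in> intw g R (conj_rep R')" if "B \<in> intw g (conj_rep R) R'"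
      using intw_conj[OF is_rep_conj[OF rep] rep' that] by simp
    moreover have "cj B \<in> intw g R R'" if "B \<in> intw g (conj_rep R) (conj_rep R')"
      using intw_conj[OF is_rep_conj[OF rep] is_rep_conj[OF rep'] that] by simp
    ultimately have "B \<in> intw g R R' \<union> intw g R (conj_rep R') \<or> cj B \<in> intw g R R' \<union> intw g R (conj_rep R')"
      by blast
    then have "B = 0\<^sub>m (fst R') (fst R) \<or> cj B = 0\<^sub>m (fst R') (fst R)"
      using I(4,5)[OF R] by blast
    then have "B = 0\<^sub>m (fst R') (fst R)"
    proof
      assume "cj B = 0\<^sub>m (fst R') (fst R)"
      then have "cj (cj B) = cj (0\<^sub>m (fst R') (fst R))"
        by simp
      then show ?thesis
        by simp
    qed
    then show "adj A' * A = 0\<^sub>m (fst R') (fst R)"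
      unfolding B_def .
  qed
  then have "adj (adj U' * A) = 0\<^sub>m (fst R) (fst D')"
    by simp
  then show "adj A * U' = 0\<^sub>m (fst R) (fst D')"
    using blockD(1)[OF U'] carrier_matD[OF Ac] by (subst (asm) adj_mult) simp_all
qed

lemma zero_comm: "0\<^sub>m N N \<in> comm"
proof -
  have "- 0\<^sub>m N N = (0\<^sub>m N N :: complex mat)"
    by (auto intro!: eq_matI)
  moreover have "0\<^sub>m N N * x = x * 0\<^sub>m N N" if "x \<in> g" for x
    using g_dim[OF that] by simp
  ultimately show ?thesis
    unfolding comm_def lie_u_def by (simp add: J)
qed

lemma add_comm:
  assumes "c \<in> comm" "c' \<in> comm"
  shows "c + c' \<in> comm"
proof -
  note [simp] = comm_dim(1,2)[OF assms(1)] comm_dim(1,2)[OF assms(2)]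
  have "adj (c + c') = - (c + c')"
    using comm_dim(4)[OF assms(1)] comm_dim(4)[OF assms(2)] by (auto intro!: eq_matI)
  moreover have "(c + c') * J = J * cj (c + c')"
    using assms by (simp add: mat_distr comm_def)
  moreover have "(c + c') * x = x * (c + c')" if "x \<in> g" for x
    using comm_g[OF assms(1) that] comm_g[OF assms(2) that] g_dim[OF that] by (simp add: mat_distr)
  moreover have "c + c' \<in> carrier_mat N N"
    by (auto intro!: carrier_matI)
  ultimately show ?thesis
    unfolding comm_def lie_u_def by blast
qed

lemma smult_comm:
  assumes "c \<in> comm"
  shows "complex_of_real t \<cdot>\<^sub>m c \<in> comm"
proof -
  note [simp] = comm_dim(1,2)[OF assms]
  have "adj (complex_of_real t \<cdot>\<^sub>m c) = - (complex_of_real t \<cdot>\<^sub>m c)"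
    using comm_dim(4)[OF assms] by (auto intro!: eq_matI)
  moreover have "complex_of_real t \<cdot>\<^sub>m c * J = J * cj (complex_of_real t \<cdot>\<^sub>m c)"
    using assms by (simp add: mat_scal comm_def)
  moreover have "complex_of_real t \<cdot>\<^sub>m c * x = x * (complex_of_real t \<cdot>\<^sub>m c)" if "x \<in> g" for x
    using comm_g[OF assms that] g_dim[OF that] by (simp add: mat_scal)
  moreover have "complex_of_real t \<cdot>\<^sub>m c \<in> carrier_mat N N"
    by (auto intro!: carrier_matI)
  ultimately show ?thesis
    unfolding comm_def lie_u_def by blast
qed

lemma real_subspace_comm: "real_subspace N comm"
  unfolding real_subspace_def using comm_dim(3) zero_comm add_comm smult_comm by blast

end

section \<open>The unitary matrix formed by all blocks\<close>

locale blocks = quaternionic +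
  fixes Rs :: "complex mat rep list" and H :: "nat \<Rightarrow> complex mat set"
    and f :: "nat \<Rightarrow> complex mat \<Rightarrow> complex mat" and D :: "nat \<Rightarrow> (complex mat \<times> complex mat) rep"
    and U :: "nat \<Rightarrow> complex mat"
  assumes ind: "independent (set Rs)" and dist: "distinct Rs"
    and max: "irreducible_rep g R \<Longrightarrow> B \<in> M R \<Longrightarrow> B \<noteq> 0\<^sub>m N (fst R) \<Longrightarrow>
      \<exists>R'\<in>set Rs. \<exists>W. W \<in> intw g R R' \<union> intw g R (conj_rep R') \<and> W \<noteq> 0\<^sub>m (fst R') (fst R)"
    and blk: "i < length Rs \<Longrightarrow> block (Rs ! i) (H i) (f i) (D i) (U i)"
begin

lemma U_orthogonal:
  "i < length Rs \<Longrightarrow> j < length Rs \<Longrightarrow> i \<noteq> j \<Longrightarrow> adj (U i) * U j = 0\<^sub>m (fst (D i)) (fst (D j))"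
  using block_orthogonal[OF ind _ _ _ blk blk] dist by (simp add: nth_eq_iff_index_eq)

definition Y :: "complex mat" where
  "Y = hcat N (map U [0..<length Rs])"

abbreviation dim_sum :: nat where
  "dim_sum \<equiv> sum_list (map (\<lambda>i. fst (D i)) [0..<length Rs])"

lemma dim_sum: "sum_list (map dim_col (map U [0..<length Rs])) = dim_sum"
  using blockD(2)[OF blk] by (auto intro!: arg_cong[of _ _ sum_list])

lemma Y_carrier: "Y \<in> carrier_mat N dim_sum"
  unfolding Y_def dim_sum[symmetric] by (rule hcat_carrier) (use blockD(1)[OF blk] in auto)

lemma Y_dim [simp]: "dim_row Y = N" "dim_col Y = dim_sum"
  using Y_carrier by auto

lemma Y_iso: "adj Y * Y = 1\<^sub>m dim_sum"
  unfolding Y_def dim_sum[symmetric]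
proof (rule hcat_isometry)
  show "\<forall>X\<in>set (map U [0..<length Rs]). dim_row X = N \<and> adj X * X = 1\<^sub>m (dim_col X)"
    using blockD(1,2,4)[OF blk] by auto
  show "sorted_wrt (\<lambda>X X'. adj X' * X = 0\<^sub>m (dim_col X') (dim_col X)) (map U [0..<length Rs])"
    unfolding sorted_wrt_iff_nth_less using blockD(2)[OF blk] U_orthogonal by auto
qed

lemma adj_Y_mult_eq_0_iff:
  assumes "Z \<in> carrier_mat N e"
  shows "adj Y * Z = 0\<^sub>m dim_sum e \<longleftrightarrow> (\<forall>i<length Rs. adj (U i) * Z = 0\<^sub>m (fst (D i)) e)"
proof -
  have "\<forall>X\<in>set (map U [0..<length Rs]). dim_row X = N"
    using blockD(1)[OF blk] by auto
  from adj_hcat_mult_eq_0_iff[OF this assms] show ?thesis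
    unfolding Y_def[symmetric] dim_sum using blockD(2)[OF blk] by auto
qed

text \<open>Otherwise the complementary projection P contains an irreducible A, related by some
  nonzero W to a listed R'. Then \<open>A * adj W\<close> lies in the block of R' and is also
  orthogonal to it, hence zero; but \<open>A * adj W * W\<close> is a nonzero multiple of A by
  Schur's lemma.\<close>

lemma Y_complete: "Y * adj Y = 1\<^sub>m N"
proof (rule ccontr)
  assume neq: "Y * adj Y \<noteq> 1\<^sub>m N"
  define P where "P = 1\<^sub>m N - Y * adj Y"
  have [simp]: "dim_row P = N" "dim_col P = N"
    by (auto simp: P_def)
  have adjP: "adj P = P"
    by (simp add: P_def)
  have YP: "adj Y * P = 0\<^sub>m dim_sum N"
    by (simp add: P_def mat_distr cancel_left[OF Y_iso])
  have PP: "P * P = P"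
  proof -
    have "P * P = P - Y * (adj Y * P)"
      by (subst P_def) (simp add: mat_distr mat_assoc)
    then show ?thesis
      unfolding YP by simp
  qed
  have P0: "P \<noteq> 0\<^sub>m N N"
    using neq mat_diff_eq_0_iff[of "1\<^sub>m N" N N "Y * adj Y"] by (auto simp: P_def)
  have com: "x * P = P * x" if x: "x \<in> g" for x
  proof -
    note [simp] = g_dim[OF x]
    \<comment> \<open>The action of x alone: the commutant component is set to zero.\<close>
    define X where "X = diag_block_mat (map (\<lambda>i. snd (D i) (x, 0\<^sub>m N N)) [0..<length Rs])"
    have "list_all2 (\<lambda>V Z. dim_row V = N \<and> Z \<in> carrier_mat (dim_col V) (dim_col V) \<and> x * V = V * Z)
        (map U [0..<length Rs]) (map (\<lambda>i. snd (D i) (x, 0\<^sub>m N N)) [0..<length Rs])"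
      using blockD(1,2)[OF blk] blockD(5,6)[OF blk x zero_comm] by (auto simp: list_all2_conv_all_nth)
    then have xY: "x * Y = Y * X"
      unfolding Y_def X_def by (rule hcat_intertwine) simp_all
    have "dim_row X = dim_sum"
      using carrier_matD[OF blockD(5)[OF blk x zero_comm]] unfolding X_def dim_diag_block_mat
      by (auto intro!: arg_cong[of _ _ sum_list])
    moreover have "dim_col X = dim_sum"
      using carrier_matD[OF blockD(5)[OF blk x zero_comm]] unfolding X_def dim_diag_block_mat
      by (auto intro!: arg_cong[of _ _ sum_list])
    ultimately have [simp]: "dim_row X = dim_sum" "dim_col X = dim_sum"
      by auto
    have Px: "P * (x * Y) = 0\<^sub>m N dim_sum"
    proof -
      have "adj (adj Y * P) = 0\<^sub>m N dim_sum"
        unfolding YP by simp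
      then have "P * Y = 0\<^sub>m N dim_sum"
        by (subst (asm) adj_mult) (simp_all add: adjP)
      then have "P * Y * X = 0\<^sub>m N dim_sum"
        by simp
      then show ?thesis
        by (simp add: xY mat_assoc)
    qed
    \<comment> \<open>P x vanishes on the range of Y, whence P x = P x P; the adjoint of this, x
      being anti-Hermitian, is x P = P x P.\<close>
    have 1: "P * x = P * (x * P)"
    proof -
      have "P * (x * P) = P * x - P * (x * Y) * adj Y"
        by (simp add: P_def[of] mat_distr mat_assoc)
      then show ?thesis
        unfolding Px by simp
    qed
    then have "adj (P * x) = adj (P * (x * P))"
      by simp
    then have "x * P = P * (x * P)"
      by (simp add: adjP mat_scal mat_assoc minus_mat_eq_iff)
    then show ?thesis
      using 1 by simp
  qed
  have "P \<in> carrier_mat N N"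
    by (rule carrier_matI) simp_all
  then obtain R A where A: "irreducible_rep g R" "A \<in> M R" "A \<noteq> 0\<^sub>m N (fst R)" "P * A = A"
    using exists_irreducible_subrep[OF g _ PP P0 com] unfolding V_def by blast
  note [simp] = M_dim(1,2)[OF A(2)]
  have rep: "is_rep g R" and d: "fst R > 0"
    using A(1) by (auto simp: irreducible_rep_def)
  obtain R' W where R': "R' \<in> set Rs" and W: "W \<in> intw g R R' \<union> intw g R (conj_rep R')" "W \<noteq> 0\<^sub>m (fst R') (fst R)"
    using max[OF A(1-3)] by blast
  have rep': "is_rep g R'"
    using independent_rep[OF ind R'] .
  obtain i where i: "i < length Rs" "Rs ! i = R'"
    using R' by (auto simp: in_set_conv_nth)
  have [simp]: "dim_row W = fst R'" "dim_col W = fst R"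
    using W(1) by (auto simp: intw_def)
  have "adj Y * (P * A) = 0\<^sub>m dim_sum (fst R)"
    using mat_assoc[of "adj Y" P A] unfolding YP by simp
  then have UA: "adj (U i) * A = 0\<^sub>m (fst (D i)) (fst R)"
    unfolding A(4) using adj_Y_mult_eq_0_iff[OF M_dim(3)[OF A(2)]] i(1) by blast
  have "A * adj W \<in> M R' \<union> M (conj_rep R')"
    using W(1) M_mult[OF _ rep A(2)] intw_adj[OF rep] rep' is_rep_conj by blast
  then have "U i * (adj (U i) * (A * adj W)) = A * adj W"
    using blockD(10)[OF blk[OF i(1)]] i(2) by simp
  moreover have "adj (U i) * (A * adj W) = adj (U i) * A * adj W"
    using blockD(1)[OF blk[OF i(1)]] by (intro mat_assoc[symmetric]) simp_all
  ultimately have AW: "A * adj W = 0\<^sub>m N (fst R')"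
    unfolding UA using blockD(1,2)[OF blk[OF i(1)]] by simp
  have "adj W * W \<in> intw g R R"
    using W(1) intw_mult[OF rep _ rep] intw_adj[OF rep] rep' is_rep_conj by blast
  then obtain z where z: "adj W * W = z \<cdot>\<^sub>m 1\<^sub>m (fst R)"
    using schur[OF A(1)] by blast
  then have z0: "z \<noteq> 0"
    using scalar_gram_nonneg[OF z d] W(2) by auto
  have "A * (adj W * W) = A * adj W * W"
    by (rule mat_assoc[symmetric]) simp_all
  then have "z \<cdot>\<^sub>m A = 0\<^sub>m N (fst R)"
    unfolding z AW by (simp add: mat_scal)
  then show False
    using A(3) smult_eq_zero_iff[OF z0] by blast
qed

lemma eqI_mult_U:
  assumes c: "dim_row c = k" "dim_col c = N" "dim_row c' = k" "dim_col c' = N"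
    and "\<And>i. i < length Rs \<Longrightarrow> c * U i = c' * U i"
  shows "c = c'"
proof -
  have d: "\<forall>X\<in>set (map U [0..<length Rs]). dim_row X = N"
    using blockD(1)[OF blk] by auto
  have "c * Y = hcat k (map (\<lambda>i. c * U i) [0..<length Rs])"
    unfolding Y_def using mult_hcat[OF d] c by (simp add: o_def)
  also have "\<dots> = hcat k (map (\<lambda>i. c' * U i) [0..<length Rs])"
    using assms(5) by (intro arg_cong[of _ _ "hcat k"]) simp
  also have "\<dots> = c' * Y"
    unfolding Y_def using mult_hcat[OF d] c by (simp add: o_def)
  finally have "c * Y * adj Y = c' * Y * adj Y"
    by simp
  then show ?thesis
    using c by (simp add: mat_assoc Y_complete)
qed

text \<open>Induction on the number of prescribed components. Vanishing on the blocks not yet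
  treated lets a preimage for block k be added without either summand disturbing the other.\<close>

lemma surjective:
  assumes "\<And>i. i < k \<Longrightarrow> y i \<in> H i" "k \<le> length Rs"
  shows "\<exists>c\<in>comm. (\<forall>i<k. f i c = y i) \<and>
    (\<forall>j. k \<le> j \<longrightarrow> j < length Rs \<longrightarrow> c * U j = 0\<^sub>m N (fst (D j)))"
  using assms
proof (induction k)
  case 0
  have "0\<^sub>m N N * U j = 0\<^sub>m N (fst (D j))" if "j < length Rs" for j
    using blockD(1,2)[OF blk[OF that]] by simp
  then show ?case
    using zero_comm by blast
next
  case (Suc k)
  then obtain c where c: "c \<in> comm" "\<And>i. i < k \<Longrightarrow> f i c = y i"
    "\<And>j. k \<le> j \<Longrightarrow> j < length Rs \<Longrightarrow> c * U j = 0\<^sub>m N (fst (D j))"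
    by (metis Suc_leD less_SucI)
  have k: "k < length Rs"
    using Suc.prems by simp
  note Uk = blk[OF k]
  obtain c1 where c1: "c1 \<in> comm" "f k c1 = y k" "U k * (adj (U k) * c1) = c1"
    using blockD(9)[OF Uk] Suc.prems(1)[of k] by blast
  note [simp] = comm_dim(1,2)[OF c(1)] comm_dim(1,2)[OF c1(1)] blockD(1,2)[OF Uk]
  have c1U: "c1 * U j = 0\<^sub>m N (fst (D j))" if j: "j < length Rs" "j \<noteq> k" for j
  proof -
    note [simp] = blockD(1,2)[OF blk[OF j(1)]]
    \<comment> \<open>c1 is anti-Hermitian with range inside that of \<open>U k\<close>, so it
      vanishes on the orthogonal complement, which contains all other blocks.\<close>
    have "adj (U k * (adj (U k) * c1)) = adj c1"
      by (simp only: c1(3))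
    then have "c1 = c1 * (U k * adj (U k))"
      by (simp add: comm_dim(4)[OF c1(1)] mat_scal mat_assoc minus_mat_eq_iff)
    then have "c1 * U j = c1 * (U k * adj (U k)) * U j"
      by simp
    also have "\<dots> = c1 * (U k * (adj (U k) * U j))"
      by (simp add: mat_assoc)
    finally show ?thesis
      using U_orthogonal[OF k j(1)] j(2) by simp
  qed
  have sum: "c + c1 \<in> comm"
    by (rule add_comm[OF c(1) c1(1)])
  have add: "(c + c1) * U j = c * U j + c1 * U j" if "j < length Rs" for j
    using blockD(1)[OF blk[OF that]] by (simp add: mat_distr)
  have "f i (c + c1) = y i" if i: "i < Suc k" for i
  proof (cases "i = k")
    case True
    then have "(c + c1) * U k = c1 * U k"
      using add[OF k] c(3)[OF _ k] by simp
    then show ?thesis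
      using blockD(8)[OF Uk sum c1(1)] c1(2) True by simp
  next
    case False
    then have i': "i < k" "i < length Rs"
      using i k by auto
    then have "(c + c1) * U i = c * U i"
      using add[OF i'(2)] c1U[OF i'(2)] blockD(1,2)[OF blk[OF i'(2)]] by simp
    then show ?thesis
      using blockD(8)[OF blk[OF i'(2)] sum c(1)] c(2)[OF i'(1)] by simp
  qed
  moreover have "(c + c1) * U j = 0\<^sub>m N (fst (D j))" if "Suc k \<le> j" "j < length Rs" for j
    using that add[OF that(2)] c(3)[of j] c1U[of j] by simp
  ultimately show ?case
    using sum by blast
qed

lemma iso: "lie_iso_direct_sum comm (map H [0..<length Rs]) (map f [0..<length Rs])"
  unfolding lie_iso_direct_sum_def
proof
  show "list_all2 (lie_hom comm) (map H [0..<length Rs]) (map f [0..<length Rs])"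
    using blockD(7)[OF blk] by (auto simp: list_all2_conv_all_nth)
  have hom: "f i c \<in> H i" if "i < length Rs" "c \<in> comm" for i c
    using blockD(7)[OF blk[OF that(1)]] that(2) by (auto simp: lie_hom_def)
  show "bij_betw (\<lambda>x. map (\<lambda>f. f x) (map f [0..<length Rs])) comm (listset (map H [0..<length Rs]))"
    unfolding bij_betw_def
  proof (intro conjI equalityI subsetI)
    show "inj_on (\<lambda>x. map (\<lambda>f. f x) (map f [0..<length Rs])) comm"
    proof (rule inj_onI)
      fix c c' assume c: "c \<in> comm" "c' \<in> comm"
        and eq: "map (\<lambda>f. f c) (map f [0..<length Rs]) = map (\<lambda>f. f c') (map f [0..<length Rs])"
      show "c = c'"
      proof (rule eqI_mult_U)
        fix i assume i: "i < length Rs"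
        then have "f i c = f i c'"
          using arg_cong[OF eq, of "\<lambda>xs. xs ! i"] by simp
        then show "c * U i = c' * U i"
          using blockD(8)[OF blk[OF i] c] by simp
      qed (use comm_dim c in auto)
    qed
    show "ys \<in> listset (map H [0..<length Rs])"
      if "ys \<in> (\<lambda>x. map (\<lambda>f. f x) (map f [0..<length Rs])) ` comm" for ys
      using that hom by (auto simp: listset_iff list_all2_conv_all_nth)
    fix ys assume "ys \<in> listset (map H [0..<length Rs])"
    then have ys: "length ys = length Rs" "\<And>i. i < length Rs \<Longrightarrow> ys ! i \<in> H i"
      by (auto simp: listset_iff list_all2_conv_all_nth)
    then obtain c where c: "c \<in> comm" "\<And>i. i < length Rs \<Longrightarrow> f i c = ys ! i"
      using surjective[of "length Rs" "\<lambda>i. ys ! i"] by auto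
    then have "ys = map (\<lambda>f. f c) (map f [0..<length Rs])"
      using ys(1) by (auto intro!: nth_equalityI)
    then show "ys \<in> (\<lambda>x. map (\<lambda>f. f x) (map f [0..<length Rs])) ` comm"
      using c(1) by blast
  qed
qed

lemma equiv: "rep_equiv (g \<times> comm) (N, \<lambda>(x, c). x + c) (rep_direct_sum (map D [0..<length Rs]))"
proof -
  \<comment> \<open>Both Y and \<open>adj Y\<close> are isometries, so Y is square, as
    \<open>rep_equiv\<close> demands equal dimensions.\<close>
  have "N \<le> dim_sum"
    using isometry_le[of "adj Y" dim_sum N] Y_complete Y_carrier by simp
  moreover have "dim_sum \<le> N"
    using isometry_le[OF Y_carrier Y_iso] .
  ultimately have dN: "dim_sum = N"
    by simp
  have inv: "invertible_mat (adj Y)"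
    unfolding invertible_mat_def inverts_mat_def using Y_iso Y_complete
    by (intro conjI exI[of _ Y]) (simp_all add: dN)
  have "adj Y * (x + c) = diag_block_mat (map (\<lambda>i. snd (D i) (x, c)) [0..<length Rs]) * adj Y"
    if x: "x \<in> g" and c: "c \<in> comm" for x c
  proof -
    note [simp] = g_dim[OF x] comm_dim[OF c]
    define X where "X = diag_block_mat (map (\<lambda>i. snd (D i) (x, c)) [0..<length Rs])"
    have "list_all2 (\<lambda>V Z. dim_row V = N \<and> Z \<in> carrier_mat (dim_col V) (dim_col V) \<and> (x + c) * V = V * Z)
        (map U [0..<length Rs]) (map (\<lambda>i. snd (D i) (x, c)) [0..<length Rs])"
      using blockD(1,2)[OF blk] blockD(5,6)[OF blk x c] by (auto simp: list_all2_conv_all_nth)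
    then have xY: "(x + c) * Y = Y * X"
      unfolding Y_def X_def by (rule hcat_intertwine) simp_all
    have "dim_row X = dim_sum"
      using carrier_matD[OF blockD(5)[OF blk x c]] unfolding X_def dim_diag_block_mat
      by (auto intro!: arg_cong[of _ _ sum_list])
    then have "adj Y * ((x + c) * Y) = X"
      unfolding xY by (simp add: cancel_left[OF Y_iso])
    then have "X * adj Y = adj Y * ((x + c) * Y) * adj Y"
      by simp
    also have "\<dots> = adj Y * (x + c) * (Y * adj Y)"
      by (simp add: mat_assoc)
    also have "\<dots> = adj Y * (x + c)"
      by (simp add: Y_complete)
    finally show ?thesis
      unfolding X_def ..
  qed
  then show ?thesis
    unfolding rep_equiv_def using inv dN Y_carrier
    by (intro conjI bexI[of _ "adj Y"]) (auto simp: rep_direct_sum_def o_def)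
qed

end

section \<open>Inequivalence, the centre, and the passage to the symplectic algebra\<close>

lemma rep_equiv_intw:
  assumes "rep_equiv g R R'" "fst R > 0"
  shows "\<exists>W\<in>intw g R R'. W \<noteq> 0\<^sub>m (fst R') (fst R)"
proof -
  obtain T where T: "T \<in> carrier_mat (fst R) (fst R)" "invertible_mat T"
    "\<And>x. x \<in> g \<Longrightarrow> T * snd R x = snd R' x * T" and eq: "fst R = fst R'"
    using assms(1) by (auto simp: rep_equiv_def)
  obtain B where B: "T * B = 1\<^sub>m (fst R)" "B * T = 1\<^sub>m (dim_row B)"
    using T(1,2) by (auto simp: invertible_mat_def inverts_mat_def)
  have dB: "dim_row B = fst R" "dim_col B = fst R"
    using arg_cong[OF B(2), of dim_col] arg_cong[OF B(1), of dim_col] T(1) by auto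
  have "T \<noteq> 0\<^sub>m (fst R) (fst R)"
  proof
    assume "T = 0\<^sub>m (fst R) (fst R)"
    then have "1\<^sub>m (fst R) = (0\<^sub>m (fst R) (fst R) :: complex mat)"
      using B(1) dB by simp
    then show False
      using one_neq_zero_mat[OF assms(2)] by blast
  qed
  then show ?thesis
    using T eq by (intro bexI[of _ T]) (auto simp: intw_def)
qed

text \<open>A central subspace is an abelian ideal: its derived algebra is 0, so it is solvable in
  one step and semisimplicity makes it 0.\<close>

lemma semisimple_center:
  assumes ss: "semisimple_lie d g" and a: "real_subspace d a" "a \<subseteq> g"
    and com: "\<And>x y. x \<in> g \<Longrightarrow> y \<in> a \<Longrightarrow> lie_bracket x y = 0\<^sub>m d d"
  shows "a = {0\<^sub>m d d}"
proof -
  have "0\<^sub>m d d \<in> a"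
    using a(1) by (simp add: real_subspace_def)
  have br: "lie_bracket x y = 0\<^sub>m d d" if "x \<in> a" "y \<in> a" for x y
    using com a(2) that by blast
  have "{lie_bracket x y | x y. x \<in> a \<and> y \<in> a} = {0\<^sub>m d d}"
  proof (intro equalityI subsetI)
    show "z \<in> {0\<^sub>m d d}" if "z \<in> {lie_bracket x y | x y. x \<in> a \<and> y \<in> a}" for z
      using that br by auto
    show "z \<in> {lie_bracket x y | x y. x \<in> a \<and> y \<in> a}" if "z \<in> {0\<^sub>m d d}" for z
      using that br[OF \<open>0\<^sub>m d d \<in> a\<close> \<open>0\<^sub>m d d \<in> a\<close>] \<open>0\<^sub>m d d \<in> a\<close> by (intro CollectI exI[of _ "0\<^sub>m d d"]) simp
  qed
  moreover have "real_span d {0\<^sub>m d d} = {0\<^sub>m d d}"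
  proof -
    have "real_subspace d {0\<^sub>m d d}"
      by (auto simp: real_subspace_def)
    then show ?thesis
      unfolding real_span_def by blast
  qed
  ultimately have "(derived_algebra d ^^ 1) a = {0\<^sub>m d d}"
    by (simp add: derived_algebra_def)
  then have "solvable_lie d a"
    unfolding solvable_lie_def by blast
  moreover have "lie_bracket x y \<in> a" if "x \<in> g" "y \<in> a" for x y
    using com[OF that] \<open>0\<^sub>m d d \<in> a\<close> by simp
  then have "lie_ideal d a g"
    unfolding lie_ideal_def using a by blast
  ultimately show ?thesis
    using ss by (auto simp: semisimple_lie_def)
qed

lemma quaternionic_sp: "g \<subseteq> lie_sp n \<Longrightarrow> quaternionic (2 * n) g (symplectic_J n)"
  by unfold_locales
    (auto simp: lie_sp_eq cj_symplectic_J adj_symplectic_J symplectic_J_square)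

lemma commutant_sp_eq:
  assumes "g \<subseteq> lie_sp n"
  shows "commutant_sp n g = quaternionic.comm (2 * n) g (symplectic_J n)"
proof -
  have "lie_bracket c y = 0\<^sub>m (2 * n) (2 * n) \<longleftrightarrow> c * y = y * c" if "c \<in> lie_sp n" "y \<in> g" for c y
    unfolding lie_bracket_def using that assms
    by (intro mat_diff_eq_0_iff) (auto simp: lie_sp_def lie_u_def)
  then show ?thesis
    unfolding commutant_sp_def quaternionic.comm_def[OF quaternionic_sp[OF assms]]
    by (auto simp: lie_sp_eq)
qed


text \<open>The locale \<open>blocks\<close> has a single index range, while the theorem separates
  three; this family corresponds to the concatenated lists.\<close>

definition join3 :: "nat \<Rightarrow> nat \<Rightarrow> (nat \<Rightarrow> 'a) \<Rightarrow> (nat \<Rightarrow> 'a) \<Rightarrow> (nat \<Rightarrow> 'a) \<Rightarrow> nat \<Rightarrow> 'a" where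
  "join3 I P a b c j = (if j < I then a j else if j < I + P then b (j - I) else c (j - (I + P)))"

lemma map_join3:
  "map (join3 I P a b c) [0..<I + P + Q] = map a [0..<I] @ map b [0..<P] @ map c [0..<Q]"
  by (rule nth_equalityI) (auto simp: join3_def nth_append)

text \<open>The trivial intersection makes (x, c) \<mapsto> x + c injective on pairs, so the pairs
  in the last conjunct stand for the direct sum of g and its commutant inside the symplectic
  algebra.\<close>

theorem theorem1:
  fixes n :: nat and g :: "complex mat set"
  assumes "n \<ge> 1"
    and "lie_subalgebra (2 * n) g (lie_sp n)"
    and "semisimple_lie (2 * n) g"
  shows "g \<inter> commutant_sp n g = {0\<^sub>m (2 * n) (2 * n)} \<and>
    (\<exists>(I :: nat) (P :: nat) (Q :: nat)
       (k :: nat \<Rightarrow> nat) (l :: nat \<Rightarrow> nat) (m :: nat \<Rightarrow> nat)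
       (rp :: nat \<Rightarrow> complex mat rep) (rm :: nat \<Rightarrow> complex mat rep) (rc :: nat \<Rightarrow> complex mat rep)
       (\<alpha> :: nat \<Rightarrow> complex mat \<Rightarrow> complex mat)
       (\<beta> :: nat \<Rightarrow> complex mat \<Rightarrow> complex mat)
       (\<gamma> :: nat \<Rightarrow> complex mat \<Rightarrow> complex mat).
       (\<forall>i<I. k i > 0 \<and> real_irrep g (rp i)) \<and>
       (\<forall>p<P. l p > 0 \<and> pseudoreal_irrep g (rm p)) \<and>
       (\<forall>q<Q. m q > 0 \<and> complex_irrep g (rc q)) \<and>
       pairwise_inequivalent g (map rp [0..<I] @ map rm [0..<P] @ map rc [0..<Q]) \<and>
       lie_iso_direct_sum (commutant_sp n g)
         (map (\<lambda>i. lie_sp (k i)) [0..<I] @ map (\<lambda>p. lie_so (l p)) [0..<P] @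
          map (\<lambda>q. lie_u (m q)) [0..<Q])
         (map \<alpha> [0..<I] @ map \<beta> [0..<P] @ map \<gamma> [0..<Q]) \<and>
       rep_equiv (g \<times> commutant_sp n g)
         (2 * n, \<lambda>(x, c). x + c)
         (rep_direct_sum
           (map (\<lambda>i. ext_tensor (rp i) (2 * k i, \<alpha> i)) [0..<I] @
            map (\<lambda>p. ext_tensor (rm p) (l p, \<beta> p)) [0..<P] @
            map (\<lambda>q. rep_direct_sum
              [ext_tensor (rc q) (m q, \<gamma> q),
               ext_tensor (conj_rep (rc q)) (conj_rep (m q, \<gamma> q))]) [0..<Q])))"
proof -
  have gsp: "g \<subseteq> lie_sp n" and gsub: "real_subspace (2 * n) g"
    using assms(2) by (auto simp: lie_subalgebra_def lie_algebra_def)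
  interpret quaternionic "2 * n" g "symplectic_J n"
    by (rule quaternionic_sp[OF gsp])
  note C = commutant_sp_eq[OF gsp]
  \<comment> \<open>This intersection is the centre of g.\<close>
  have "real_subspace (2 * n) (g \<inter> comm)"
    using gsub real_subspace_comm unfolding real_subspace_def by blast
  moreover have "lie_bracket x y = 0\<^sub>m (2 * n) (2 * n)" if "x \<in> g" "y \<in> g \<inter> comm" for x y
    using comm_g[of y x] that g_dim[OF that(1)] g_dim[of y] by (auto simp: lie_bracket_def intro!: eq_matI)
  ultimately have center: "g \<inter> commutant_sp n g = {0\<^sub>m (2 * n) (2 * n)}"
    unfolding C by (intro semisimple_center[OF assms(3)]) auto
  obtain \<R> where ind: "independent \<R>"
    and max: "\<And>R. irreducible_rep g R \<Longrightarrow> \<exists>B\<in>M R. B \<noteq> 0\<^sub>m (2 * n) (fst R) \<Longrightarrow>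
      \<exists>R'\<in>\<R>. \<exists>W. W \<in> intw g R R' \<union> intw g R (conj_rep R') \<and> W \<noteq> 0\<^sub>m (fst R') (fst R)"
    using maximal_independent by blast
  note Ind = independentD[OF ind]
  obtain Is where Is: "set Is = {R \<in> \<R>. real_irrep g R}" "distinct Is"
    using finite_distinct_list[of "{R \<in> \<R>. real_irrep g R}"] Ind(1) by auto
  \<comment> \<open>Excluding the real irreducibles makes the three lists disjoint by construction,
    so that their concatenation is distinct.\<close>
  obtain Ps where Ps: "set Ps = {R \<in> \<R>. \<not> real_irrep g R \<and> pseudoreal_irrep g R}" "distinct Ps"
    using finite_distinct_list[of "{R \<in> \<R>. \<not> real_irrep g R \<and> pseudoreal_irrep g R}"] Ind(1) by auto
  obtain Qs where Qs: "set Qs = {R \<in> \<R>. \<not> real_irrep g R \<and> \<not> pseudoreal_irrep g R}" "distinct Qs"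
    using finite_distinct_list[of "{R \<in> \<R>. \<not> real_irrep g R \<and> \<not> pseudoreal_irrep g R}"] Ind(1) by auto
  define Rs where "Rs = Is @ Ps @ Qs"
  have Rs: "set Rs = \<R>" "distinct Rs"
    using Is Ps Qs by (auto simp: Rs_def)
  let ?I = "length Is" and ?P = "length Ps" and ?Q = "length Qs"
  have len: "length Rs = ?I + ?P + ?Q"
    by (simp add: Rs_def)
  have real: "real_irrep g (Is ! i)" "Is ! i \<in> \<R>" if "i < ?I" for i
    using nth_mem[OF that] Is(1) by auto
  have pseudo: "pseudoreal_irrep g (Ps ! p)" "Ps ! p \<in> \<R>" if "p < ?P" for p
    using nth_mem[OF that] Ps(1) by auto
  have cplx: "complex_irrep g (Qs ! q)" "Qs ! q \<in> \<R>" if "q < ?Q" for q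
    using nth_mem[OF that] Qs(1) Ind(2) by (auto simp: complex_irrep_def)
  \<comment> \<open>The bound on i stands under the existential quantifiers, so that choice yields
    functions on all of \<open>nat\<close>; likewise for p and q.\<close>
  have "\<forall>i. \<exists>k f U. i < ?I \<longrightarrow> k > 0 \<and> block (Is ! i) (lie_sp k) f (ext_tensor (Is ! i) (2 * k, f)) U"
    using block_real real Ind(3) by meson
  then obtain k \<alpha> U1 where 1: "\<And>i. i < ?I \<Longrightarrow> k i > 0 \<and>
      block (Is ! i) (lie_sp (k i)) (\<alpha> i) (ext_tensor (Is ! i) (2 * k i, \<alpha> i)) (U1 i)"
    by metis
  have "\<forall>p. \<exists>l f U. p < ?P \<longrightarrow> l > 0 \<and> block (Ps ! p) (lie_so l) f (ext_tensor (Ps ! p) (l, f)) U"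
    using block_pseudoreal pseudo Ind(3) by meson
  then obtain l \<beta> U2 where 2: "\<And>p. p < ?P \<Longrightarrow> l p > 0 \<and>
      block (Ps ! p) (lie_so (l p)) (\<beta> p) (ext_tensor (Ps ! p) (l p, \<beta> p)) (U2 p)"
    by metis
  have "\<forall>q. \<exists>m f U. q < ?Q \<longrightarrow> m > 0 \<and> block (Qs ! q) (lie_u m) f
      (rep_direct_sum [ext_tensor (Qs ! q) (m, f), ext_tensor (conj_rep (Qs ! q)) (conj_rep (m, f))]) U"
    using block_complex cplx Ind(3) by meson
  then obtain m \<gamma> U3 where 3: "\<And>q. q < ?Q \<Longrightarrow> m q > 0 \<and> block (Qs ! q) (lie_u (m q)) (\<gamma> q)
      (rep_direct_sum [ext_tensor (Qs ! q) (m q, \<gamma> q), ext_tensor (conj_rep (Qs ! q)) (conj_rep (m q, \<gamma> q))]) (U3 q)"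
    by metis
  define H where "H = join3 ?I ?P (\<lambda>i. lie_sp (k i)) (\<lambda>p. lie_so (l p)) (\<lambda>q. lie_u (m q))"
  define f where "f = join3 ?I ?P \<alpha> \<beta> \<gamma>"
  define D where "D = join3 ?I ?P (\<lambda>i. ext_tensor (Is ! i) (2 * k i, \<alpha> i)) (\<lambda>p. ext_tensor (Ps ! p) (l p, \<beta> p))
    (\<lambda>q. rep_direct_sum [ext_tensor (Qs ! q) (m q, \<gamma> q), ext_tensor (conj_rep (Qs ! q)) (conj_rep (m q, \<gamma> q))])"
  define U where "U = join3 ?I ?P U1 U2 U3"
  interpret blocks "2 * n" g "symplectic_J n" Rs H f D U
  proof unfold_locales
    show "independent (set Rs)" "distinct Rs"
      using ind Rs by auto
    show "\<exists>R'\<in>set Rs. \<exists>W. W \<in> intw g R R' \<union> intw g R (conj_rep R') \<and> W \<noteq> 0\<^sub>m (fst R') (fst R)"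
      if "irreducible_rep g R" "B \<in> M R" "B \<noteq> 0\<^sub>m (2 * n) (fst R)" for R B
      using max[of R] that unfolding Rs(1) by blast
    show "block (Rs ! j) (H j) (f j) (D j) (U j)" if j: "j < length Rs" for j
    proof -
      consider "j < ?I" | "j \<ge> ?I" "j - ?I < ?P" | "j \<ge> ?I" "j - ?I \<ge> ?P" "j - (?I + ?P) < ?Q"
        using j len by linarith
      then show ?thesis
        using 1[of j] 2[of "j - ?I"] 3[of "j - (?I + ?P)"]
        by cases (auto simp: H_def f_def D_def U_def join3_def Rs_def nth_append)
    qed
  qed
  have "pairwise_inequivalent g Rs"
    unfolding pairwise_inequivalent_def
  proof (intro allI impI notI)
    fix a b assume ab: "a < length Rs" "b < length Rs" "a \<noteq> b" and eq: "rep_equiv g (Rs ! a) (Rs ! b)"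
    have R: "Rs ! a \<in> \<R>" "Rs ! b \<in> \<R>" "Rs ! a \<noteq> Rs ! b"
      using ab Rs nth_mem by (auto simp: nth_eq_iff_index_eq)
    have "fst (Rs ! a) > 0"
      using Ind(2)[OF R(1)] by (simp add: irreducible_rep_def)
    then show False
      using rep_equiv_intw[OF eq] Ind(4)[OF R] by blast
  qed
  then have "pairwise_inequivalent g (map ((!) Is) [0..<?I] @ map ((!) Ps) [0..<?P] @ map ((!) Qs) [0..<?Q])"
    by (simp add: map_nth Rs_def)
  moreover have "lie_iso_direct_sum (commutant_sp n g)
      (map (\<lambda>i. lie_sp (k i)) [0..<?I] @ map (\<lambda>p. lie_so (l p)) [0..<?P] @ map (\<lambda>q. lie_u (m q)) [0..<?Q])
      (map \<alpha> [0..<?I] @ map \<beta> [0..<?P] @ map \<gamma> [0..<?Q])"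
    using iso unfolding C len H_def f_def map_join3 .
  moreover have "rep_equiv (g \<times> commutant_sp n g) (2 * n, \<lambda>(x, c). x + c)
      (rep_direct_sum
        (map (\<lambda>i. ext_tensor (Is ! i) (2 * k i, \<alpha> i)) [0..<?I] @
         map (\<lambda>p. ext_tensor (Ps ! p) (l p, \<beta> p)) [0..<?P] @
         map (\<lambda>q. rep_direct_sum
           [ext_tensor (Qs ! q) (m q, \<gamma> q),
            ext_tensor (conj_rep (Qs ! q)) (conj_rep (m q, \<gamma> q))]) [0..<?Q]))"
    using equiv unfolding C len D_def map_join3 .
  moreover have "\<forall>i<?I. k i > 0 \<and> real_irrep g (Is ! i)" "\<forall>p<?P. l p > 0 \<and> pseudoreal_irrep g (Ps ! p)"
    "\<forall>q<?Q. m q > 0 \<and> complex_irrep g (Qs ! q)"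
    using 1 2 3 real(1) pseudo(1) cplx(1) by blast+
  ultimately show ?thesis
    using center by blast
qed

end
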